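(* Let $a\in C^\infty(\mathbb T;\mathbb R)$, let $a_0=\frac1{2\pi}\int_0^{2\pi}a(t)\,dt$, and let $L=\partial_t-a(t)\partial_x$ on $\mathbb T^2$. Let $k_1,k_2\in\mathbb R$, and let $f\in H_{\mathrm{mix}}^{(k_1,k_2)}(\mathbb T^2)$ satisfy $\widehat f(0,0)=0$. Suppose that $a_0\in\mathbb R\setminus\mathbb Q$ has finite irrationality measure $\mu(a_0)$. Then there exists a unique distributional solution $u\in\mathcal D'(\mathbb T^2)$ of $Lu=f$ satisfying $\widehat u(0,0)=0$. Moreover, for every $r>\mu(a_0)$, every $q\le k_1$, and every $0\le\theta\le1$, this solution satisfies $$u\in H_{\mathrm{mix}}^{(q+\theta,\;k_2+1-r-|q|-\theta)}(\mathbb T^2)$$ and $$\|u-\widehat u(0,0)\|_{H_{\mathrm{mix}}^{(q+\theta,\;k_2+1-r-|q|-\theta)}(\mathbb T^2)}\le C\,\|f\|_{H_{\mathrm{mix}}^{(k_1,k_2)}(\mathbb T^2)},$$ where $C>0$ depends only on $a,k_1,q,r,\theta$.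
   Context: $\mathbb T=\mathbb R/2\pi\mathbb Z$, with variables $(t,x)\in\mathbb T^2$ and dual frequencies $(\tau,\xi)\in\mathbb Z^2$. $\mathcal D'(\mathbb T^2)$ is the space of distributions on $\mathbb T^2$. Fourier coefficients are $\widehat f(\tau,\xi)=\frac1{(2\pi)^2}\int_{\mathbb T^2}f(t,x)e^{-i(t\tau+x\xi)}\,dt\,dx$ (by duality for distributions); the number $\widehat u(0,0)$ is identified with a constant function. $\langle w\rangle=(1+|w|^2)^{1/2}$. For $s_1,s_2\in\mathbb R$, $H_{\mathrm{mix}}^{(s_1,s_2)}(\mathbb T^2)$ is the space of $f\in\mathcal D'(\mathbb T^2)$ with $\|f\|_{H_{\mathrm{mix}}^{(s_1,s_2)}(\mathbb T^2)}^2=\sum_{(\tau,\xi)\in\mathbb Z^2}\langle\tau\rangle^{2s_1}\langle\xi\rangle^{2s_2}|\widehat f(\tau,\xi)|^2<\infty$. The irrationality measure of $\alpha\in\mathbb R\setminus\mathbb Q$ is $\mu(\alpha)=\sup\{\nu>0:\ |\alpha-p/q|<q^{-\nu}\text{ for infinitely many }(p,q)\in\mathbb Z\times\mathbb N\}\in[2,\infty]$. *)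

theory Defs
  imports "HOL-Analysis.Analysis"
begin

section \<open>Smooth functions on the circle and on the torus\<close>

text \<open>
  Functions on \<open>\<real>/2\<pi>\<int>\<close> and on its square are represented by functions on \<open>\<real>\<close> and on \<open>\<real>\<^sup>2\<close>
  that are \<open>2\<pi>\<close>-periodic in every variable; points of \<open>\<real>\<^sup>2\<close> are written \<open>(t, x)\<close>.
\<close>

definition smooth_circle :: "(real \<Rightarrow> real) set" where
  "smooth_circle =
     {a. (\<forall>t. a (t + 2 * pi) = a t) \<and> (\<forall>n t. (deriv ^^ n) a differentiable (at t))}"

definition partial_t :: "(real \<times> real \<Rightarrow> complex) \<Rightarrow> real \<times> real \<Rightarrow> complex" where
  "partial_t \<phi> = (\<lambda>(t, x). vector_derivative (\<lambda>s. \<phi> (s, x)) (at t))"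

definition partial_x :: "(real \<times> real \<Rightarrow> complex) \<Rightarrow> real \<times> real \<Rightarrow> complex" where
  "partial_x \<phi> = (\<lambda>(t, x). vector_derivative (\<lambda>y. \<phi> (t, y)) (at x))"

primrec C_order :: "nat \<Rightarrow> (real \<times> real \<Rightarrow> complex) \<Rightarrow> bool" where
  "C_order 0 \<phi> \<longleftrightarrow> continuous_on UNIV \<phi>"
| "C_order (Suc k) \<phi> \<longleftrightarrow>
     (\<forall>z. \<phi> differentiable (at z)) \<and> C_order k (partial_t \<phi>) \<and> C_order k (partial_x \<phi>)"

definition test_functions :: "(real \<times> real \<Rightarrow> complex) set" where
  "test_functions =
     {\<phi>. (\<forall>t x. \<phi> (t + 2 * pi, x) = \<phi> (t, x) \<and> \<phi> (t, x + 2 * pi) = \<phi> (t, x)) \<and>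
         (\<forall>k. C_order k \<phi>)}"

section \<open>Distributions on the torus\<close>

definition test_seminorm :: "nat \<Rightarrow> (real \<times> real \<Rightarrow> complex) \<Rightarrow> real" where
  "test_seminorm N \<phi> =
     (\<Sum>m\<le>N. \<Sum>n\<le>N. SUP z. cmod ((partial_t ^^ m) ((partial_x ^^ n) \<phi>) z))"

type_synonym functional = "(real \<times> real \<Rightarrow> complex) \<Rightarrow> complex"

text \<open>
  A distribution is a complex-linear functional on the test functions that is continuous for the
  Frechet topology given by the seminorms above, which are increasing in \<open>N\<close>; for a linear
  functional this means that it is bounded by a multiple of one of them. Functionals are
  \<^const>\<open>extensional\<close>, so that equality of distributions is HOL equality.
\<close>

definition distributions :: "functional set" where
  "distributions =
     {u \<in> extensional test_functions.
        (\<forall>\<phi>\<in>test_functions. \<forall>\<psi>\<in>test_functions. u (\<lambda>z. \<phi> z + \<psi> z) = u \<phi> + u \<psi>) \<and>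
        (\<forall>c. \<forall>\<phi>\<in>test_functions. u (\<lambda>z. c * \<phi> z) = c * u \<phi>) \<and>
        (\<exists>N K. \<forall>\<phi>\<in>test_functions. cmod (u \<phi>) \<le> K * test_seminorm N \<phi>)}"

text \<open>Functions are embedded by the bilinear pairing, without complex conjugation.\<close>

definition dist_of_fun :: "(real \<times> real \<Rightarrow> complex) \<Rightarrow> functional" where
  "dist_of_fun g =
     (\<lambda>\<phi>\<in>test_functions. integral (cbox (0, 0) (2 * pi, 2 * pi)) (\<lambda>z. g z * \<phi> z))"

definition dist_diff :: "functional \<Rightarrow> functional \<Rightarrow> functional" where
  "dist_diff u v = (\<lambda>\<phi>\<in>test_functions. u \<phi> - v \<phi>)"

definition dist_partial_t :: "functional \<Rightarrow> functional" where
  "dist_partial_t u = (\<lambda>\<phi>\<in>test_functions. - u (partial_t \<phi>))"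

definition dist_partial_x :: "functional \<Rightarrow> functional" where
  "dist_partial_x u = (\<lambda>\<phi>\<in>test_functions. - u (partial_x \<phi>))"

definition dist_mult :: "(real \<times> real \<Rightarrow> complex) \<Rightarrow> functional \<Rightarrow> functional" where
  "dist_mult g u = (\<lambda>\<phi>\<in>test_functions. u (\<lambda>z. g z * \<phi> z))"

definition L_op :: "(real \<Rightarrow> real) \<Rightarrow> functional \<Rightarrow> functional" where
  "L_op a u =
     dist_diff (dist_partial_t u) (dist_mult (\<lambda>(t, x). complex_of_real (a t)) (dist_partial_x u))"

definition fourier_coeff :: "functional \<Rightarrow> int \<Rightarrow> int \<Rightarrow> complex" where
  "fourier_coeff u \<tau> \<xi> =
     u (\<lambda>(t, x). exp (- (\<i> * complex_of_real (t * of_int \<tau> + x * of_int \<xi>)))) /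
       complex_of_real ((2 * pi) ^ 2)"

section \<open>Mixed Sobolev spaces\<close>

definition japanese_bracket :: "real \<Rightarrow> real" where
  "japanese_bracket w = sqrt (1 + \<bar>w\<bar> ^ 2)"

definition mix_term :: "real \<Rightarrow> real \<Rightarrow> functional \<Rightarrow> int \<times> int \<Rightarrow> real" where
  "mix_term s1 s2 f = (\<lambda>(\<tau>, \<xi>).
     japanese_bracket (of_int \<tau>) powr (2 * s1) * japanese_bracket (of_int \<xi>) powr (2 * s2) *
       (cmod (fourier_coeff f \<tau> \<xi>)) ^ 2)"

definition H_mix :: "real \<Rightarrow> real \<Rightarrow> functional set" where
  "H_mix s1 s2 = {f \<in> distributions. mix_term s1 s2 f summable_on UNIV}"

definition H_mix_norm :: "real \<Rightarrow> real \<Rightarrow> functional \<Rightarrow> real" where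
  "H_mix_norm s1 s2 f = sqrt (infsum (mix_term s1 s2 f) UNIV)"

section \<open>Irrationality measure\<close>

definition irrationality_measure :: "real \<Rightarrow> ereal" where
  "irrationality_measure \<alpha> =
     Sup (ereal ` {\<nu>. \<nu> > 0 \<and>
       infinite {(p :: int, q :: nat). q > 0 \<and> \<bar>\<alpha> - of_int p / real q\<bar> < real q powr (- \<nu>)}})"

definition circle_mean :: "(real \<Rightarrow> real) \<Rightarrow> real" where
  "circle_mean a = 1 / (2 * pi) * integral {0..2 * pi} a"

end

theory Submission
  imports Defs
begin

text \<open>
  A Fourier expansion in \<open>x\<close> turns the equation into ordinary differential equations
  \<open>u' - \<i> \<xi> a u = f\<close> on the circle. Write \<open>a = a0 + A'\<close> with \<open>A\<close> periodic: conjugation by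
  \<open>exp (\<i> \<xi> A)\<close> replaces \<open>a\<close> by its mean \<open>a0\<close>, and the equation is then solved by dividing the Fourier
  coefficients by \<open>\<i> (\<tau> - \<xi> a0)\<close>, at the cost of \<open>\<langle>\<xi>\<rangle>\<close> to the power \<open>r - 1\<close>.

  A separate bound for each conjugation on the Sobolev space of order \<open>q\<close> would lose \<open>\<bar>q\<bar>\<close> powers of
  \<open>\<langle>\<xi>\<rangle>\<close> twice. Instead the weights \<open>(\<xi>\<^sup>2 + \<tau>\<^sup>2) powr (q / 2)\<close> are used. Multiplication by the fixed
  unimodular function \<open>exp (\<i> A)\<close> is a contraction on square-summable sequences and its commutator with
  this weight is of relative size \<open>1 / \<bar>\<xi>\<bar>\<close>. Hence its norm on the weighted space is at most
  \<open>1 + K / \<bar>\<xi>\<bar>\<close>, and its power \<open>\<bar>\<xi>\<bar>\<close>, which is the conjugation, has norm at most \<open>exp K\<close> for every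
  real \<open>q\<close>. Passing between these weights and those of the Sobolev space loses \<open>\<bar>q\<bar>\<close> powers of
  \<open>\<langle>\<xi>\<rangle>\<close> only once. The range \<open>0 \<le> \<theta> \<le> 1\<close> follows by reading \<open>u'\<close> off the equation.
\<close>

section \<open>Weighted sequences on the integers\<close>

text \<open>All estimates are made on coefficient sequences: smooth factors act as convolutions with
  \<open>rapid\<close> sequences, distributions become \<open>tempered\<close> ones, and a
  distribution is rebuilt from its coefficients at the end. The slices \<xi> decouple since the
  coefficient of the operator depends on t alone. The obstacle is uniformity in \<xi>: the loss on a
  slice must be an explicit power of \<langle>\<xi>\<rangle>, because the slices are summed with a
  weight in \<xi>. Hence multiplication by exp (\<i> A) has to be bounded by 1 on square-summable
  sequences, with no constant in front, as such a constant would be raised to the power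
  \<bar>\<xi>\<bar>. The weight is chosen because its logarithm varies in \<tau> at a rate of order
  1 / \<bar>\<xi>\<bar>. The irrationality measure enters through a lower bound on the divisors that
  is uniform in \<tau>. In the equation the derivative equals f plus terms with a factor
  \<bar>\<xi>\<bar>, so one power of \<langle>\<tau>\<rangle> is bought with one power of
  \<langle>\<xi>\<rangle>. The exponent k2 only contributes a factor that is constant on each slice,
  which keeps it out of the constants. On the slice \<xi> = 0 the vanishing mean of f takes the
  place of the divisor bound.\<close>

definition wt :: "int \<Rightarrow> real" where "wt n = 1 + \<bar>real_of_int n\<bar>"

lemma wt_ge1: "wt n \<ge> 1"
  by (simp add: wt_def)

lemma wt_pos [simp]: "wt n > 0" "wt n \<ge> 0" "wt n \<noteq> 0"
  using wt_ge1[of n] by auto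

lemma wt_minus [simp]: "wt (- n) = wt n"
  by (simp add: wt_def)

text \<open>Expanding the product leaves the surplus \<bar>m\<bar> * \<bar>n\<bar>.
  Submultiplicativity with constant 1 is the reason for \<open>wt\<close>:
  \<open>japanese_bracket\<close> fails it at m = n = 1, whereas powers of \<open>wt\<close> pass
  through convolutions without constants.\<close>

lemma wt_add_le: "wt (m + n) \<le> wt m * wt n"
proof -
  have "\<bar>real_of_int m + real_of_int n\<bar> \<le> \<bar>real_of_int m\<bar> + \<bar>real_of_int n\<bar>" by linarith
  moreover have "0 \<le> \<bar>real_of_int m\<bar> * \<bar>real_of_int n\<bar>" by simp
  moreover have "wt m * wt n = 1 + \<bar>real_of_int m\<bar> + \<bar>real_of_int n\<bar> + \<bar>real_of_int m\<bar> * \<bar>real_of_int n\<bar>"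
    by (simp add: wt_def algebra_simps)
  ultimately show ?thesis unfolding wt_def[of "m + n"] of_int_add by linarith
qed

lemma wt_power_ge1: "wt n ^ p \<ge> 1"
  by (simp add: wt_ge1)

lemma wt_power_add_le: "wt (m + n) ^ p \<le> wt m ^ p * wt n ^ p"
  using power_mono[OF wt_add_le, of m n p] by (simp add: power_mult_distrib)

lemma wt_power_diff_le: "wt (m - n) ^ p \<le> wt m ^ p * wt n ^ p"
  using wt_power_add_le[of m "- n" p] by simp

lemma wt_power_mono: "p \<le> p' \<Longrightarrow> wt n ^ p \<le> wt n ^ p'"
  by (simp add: power_increasing wt_ge1)

lemma summable_on_inverse_wt: "(\<lambda>n. 1 / wt n ^ 2) summable_on UNIV"
proof -
  have s: "(\<lambda>n::nat. 1 / (1 + real n) ^ 2) summable_on UNIV"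
  proof (rule norm_summable_imp_summable_on)
    have "summable (\<lambda>n::nat. inverse (real (Suc n) ^ 2))"
      using inverse_power_summable[of 2, where 'a=real] by (subst summable_Suc_iff) simp
    then show "summable (\<lambda>n::nat. norm (1 / (1 + real n) ^ 2))"
      by (simp add: field_simps)
  qed
  have a: "(\<lambda>n. 1 / wt n ^ 2) summable_on range int"
    by (subst summable_on_reindex) (use s in \<open>auto simp: o_def wt_def\<close>)
  have b: "(\<lambda>n. 1 / wt n ^ 2) summable_on range (\<lambda>n. - int n)"
    by (subst summable_on_reindex) (use s in \<open>auto simp: o_def wt_def inj_on_def\<close>)
  have "UNIV = range int \<union> range (\<lambda>n. - int n)"
  proof -
    have "x \<in> range int \<union> range (\<lambda>n. - int n)" for x :: int
      by (cases x rule: int_cases2) auto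
    then show ?thesis by blast
  qed
  then show ?thesis using summable_on_union[OF a b] by simp
qed

text \<open>These are the Fourier coefficients of smooth functions on the circle;
  \<open>tempered\<close> describes those of distributions.\<close>

definition rapid :: "(int \<Rightarrow> complex) \<Rightarrow> bool" where
  "rapid k \<longleftrightarrow> (\<forall>p. \<exists>C. \<forall>n. cmod (k n) * wt n ^ p \<le> C)"

definition tempered :: "(int \<Rightarrow> complex) \<Rightarrow> bool" where
  "tempered u \<longleftrightarrow> (\<exists>p C. \<forall>n. cmod (u n) \<le> C * wt n ^ p)"

text \<open>Multiplication on the Fourier side. \<open>infsum\<close> is 0 for a family that is not
  summable, so additivity and associativity below carry the hypotheses \<open>rapid\<close> and
  \<open>tempered\<close>.\<close>

definition conv :: "(int \<Rightarrow> complex) \<Rightarrow> (int \<Rightarrow> complex) \<Rightarrow> int \<Rightarrow> complex" where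
  "conv k u = (\<lambda>\<tau>. \<Sum>\<^sub>\<infinity>\<sigma>. k \<sigma> * u (\<tau> - \<sigma>))"

lemma temperedE:
  assumes "tempered u"
  obtains C p where "C \<ge> 0" "\<And>n. cmod (u n) \<le> C * wt n ^ p"
proof -
  obtain p C where *: "\<And>n. cmod (u n) \<le> C * wt n ^ p"
    using assms by (auto simp: tempered_def)
  have "0 \<le> C * wt 0 ^ p" using *[of 0] norm_ge_zero order_trans by blast
  then have "0 \<le> C" by (simp add: wt_def)
  then show ?thesis using that * by blast
qed

text \<open>Two of the powers of \<open>wt\<close> granted by rapid decay pay for the summable
  factor \<open>1 / wt n ^ 2\<close>.\<close>

lemma rapid_summable:
  assumes "rapid k" shows "(\<lambda>n. cmod (k n) * wt n ^ p) summable_on UNIV"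
proof -
  obtain C where C: "\<And>n. cmod (k n) * wt n ^ (p + 2) \<le> C"
    using assms by (meson rapid_def)
  show ?thesis
  proof (rule summable_on_comparison_test)
    show "(\<lambda>n. C * (1 / wt n ^ 2)) summable_on UNIV"
      by (intro summable_on_cmult_right summable_on_inverse_wt)
    show "cmod (k n) * wt n ^ p \<le> C * (1 / wt n ^ 2)" for n
      using C[of n] by (simp add: field_simps power_add power2_eq_square)
  qed auto
qed

lemma conv_term_bound:
  assumes "\<And>n. cmod (u n) \<le> C * wt n ^ p" "C \<ge> 0"
  shows "cmod (k \<sigma> * u (\<tau> - \<sigma>)) \<le> C * wt \<tau> ^ p * (cmod (k \<sigma>) * wt \<sigma> ^ p)"
proof -
  have "cmod (u (\<tau> - \<sigma>)) \<le> C * (wt \<tau> ^ p * wt \<sigma> ^ p)"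
    using assms(1)[of "\<tau> - \<sigma>"] mult_left_mono[OF wt_power_diff_le assms(2), of \<tau> \<sigma> p] by linarith
  then have "cmod (k \<sigma>) * cmod (u (\<tau> - \<sigma>)) \<le> cmod (k \<sigma>) * (C * (wt \<tau> ^ p * wt \<sigma> ^ p))"
    by (intro mult_left_mono) auto
  then show ?thesis by (simp add: norm_mult mult_ac)
qed

lemma conv_abs_summable:
  assumes "rapid k" "tempered u"
  shows "(\<lambda>\<sigma>. cmod (k \<sigma> * u (\<tau> - \<sigma>))) summable_on UNIV"
proof -
  obtain C p where u: "C \<ge> 0" "\<And>n. cmod (u n) \<le> C * wt n ^ p" using assms(2) temperedE by blast
  show ?thesis
  proof (rule Infinite_Sum.abs_summable_on_comparison_test')
    show "(\<lambda>\<sigma>. C * wt \<tau> ^ p * (cmod (k \<sigma>) * wt \<sigma> ^ p)) summable_on UNIV"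
      by (intro summable_on_cmult_right rapid_summable assms)
  qed (rule conv_term_bound[OF u(2,1)])
qed

lemma conv_summable:
  assumes "rapid k" "tempered u"
  shows "(\<lambda>\<sigma>. k \<sigma> * u (\<tau> - \<sigma>)) summable_on UNIV"
  by (rule abs_summable_summable[OF conv_abs_summable[OF assms]])

lemma conv_bound:
  assumes "rapid k" "\<And>n. cmod (u n) \<le> C * wt n ^ p" "C \<ge> 0"
  shows "cmod (conv k u \<tau>) \<le> C * (\<Sum>\<^sub>\<infinity>\<sigma>. cmod (k \<sigma>) * wt \<sigma> ^ p) * wt \<tau> ^ p"
proof -
  have "cmod (conv k u \<tau>) \<le> (\<Sum>\<^sub>\<infinity>\<sigma>. C * wt \<tau> ^ p * (cmod (k \<sigma>) * wt \<sigma> ^ p))"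
    unfolding conv_def
  proof (rule norm_infsum_le)
    have "tempered u" using assms by (auto simp: tempered_def)
    then show "((\<lambda>\<sigma>. k \<sigma> * u (\<tau> - \<sigma>)) has_sum (\<Sum>\<^sub>\<infinity>\<sigma>. k \<sigma> * u (\<tau> - \<sigma>))) UNIV"
      using conv_summable[OF assms(1)] by (intro has_sum_infsum)
    show "((\<lambda>\<sigma>. C * wt \<tau> ^ p * (cmod (k \<sigma>) * wt \<sigma> ^ p)) has_sum
        (\<Sum>\<^sub>\<infinity>\<sigma>. C * wt \<tau> ^ p * (cmod (k \<sigma>) * wt \<sigma> ^ p))) UNIV"
      by (intro has_sum_infsum summable_on_cmult_right rapid_summable assms)
  qed (rule conv_term_bound[OF assms(2,3)])
  then show ?thesis by (subst (asm) infsum_cmult_right') (simp only: mult_ac)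
qed

lemma tempered_conv:
  assumes "rapid k" "tempered u" shows "tempered (conv k u)"
proof -
  obtain C p where u: "C \<ge> 0" "\<And>n. cmod (u n) \<le> C * wt n ^ p" using assms(2) temperedE by blast
  show ?thesis unfolding tempered_def using conv_bound[OF assms(1) u(2,1)] by blast
qed

text \<open>The substitution \<sigma> \<mapsto> \<tau> - \<sigma> is a bijection of the index set,
  so both sums exist or default to 0 together and no summability is assumed.\<close>

lemma conv_commute: "conv k l = conv l k"
proof
  fix \<tau>
  show "conv k l \<tau> = conv l k \<tau>" unfolding conv_def
    by (rule infsum_reindex_bij_witness[of UNIV "\<lambda>\<sigma>. \<tau> - \<sigma>" "\<lambda>\<sigma>. \<tau> - \<sigma>"]) auto
qed

lemma summable_on_times:
  fixes f :: "'a \<Rightarrow> real" and g :: "'b \<Rightarrow> real"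
  assumes "f summable_on UNIV" "g summable_on UNIV"
  shows "(\<lambda>(x, y). f x * g y) summable_on UNIV \<times> UNIV"
proof -
  have f: "(\<lambda>x. \<bar>f x\<bar>) summable_on UNIV" and g: "(\<lambda>x. \<bar>g x\<bar>) summable_on UNIV"
    using assms summable_on_iff_abs_summable_on_real by auto
  have "(\<lambda>z. norm ((\<lambda>(x, y). f x * g y) z)) summable_on UNIV \<times> UNIV"
  proof (rule summable_on_SigmaI)
    show "((\<lambda>y. norm ((\<lambda>(x, y). f x * g y) (x, y))) has_sum (\<bar>f x\<bar> * infsum (\<lambda>y. \<bar>g y\<bar>) UNIV)) UNIV" for x
      using has_sum_cmult_right[OF has_sum_infsum[OF g], of "\<bar>f x\<bar>"] by (simp add: abs_mult)
    show "(\<lambda>x. \<bar>f x\<bar> * infsum (\<lambda>y. \<bar>g y\<bar>) UNIV) summable_on UNIV"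
      by (intro summable_on_cmult_left f)
  qed auto
  then show ?thesis by (rule abs_summable_summable)
qed

text \<open>Fubini for the substitution n = \<sigma> + \<rho>. The growth of \<open>u\<close> at
  \<tau> - \<sigma> - \<rho> splits into three powers of \<open>wt\<close>, two of which are
  absorbed by \<open>k\<close> and \<open>l\<close>, so the double family is absolutely
  summable.\<close>

lemma conv_assoc:
  assumes k: "rapid k" and l: "rapid l" and u: "tempered u"
  shows "conv k (conv l u) = conv (conv k l) u"
proof
  fix \<tau>
  obtain C p where C: "C \<ge> 0" "\<And>n. cmod (u n) \<le> C * wt n ^ p" using u temperedE by blast
  define f where "f = (\<lambda>\<sigma> \<rho>. k \<sigma> * l \<rho> * u (\<tau> - \<sigma> - \<rho>))"
  define g where "g = (\<lambda>\<sigma> n. k \<sigma> * l (n - \<sigma>) * u (\<tau> - n))"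
  have bound: "cmod (f \<sigma> \<rho>) \<le> C * wt \<tau> ^ p * ((cmod (k \<sigma>) * wt \<sigma> ^ p) * (cmod (l \<rho>) * wt \<rho> ^ p))" for \<sigma> \<rho>
  proof -
    have "wt (\<tau> - \<sigma> - \<rho>) ^ p \<le> wt \<tau> ^ p * wt \<sigma> ^ p * wt \<rho> ^ p"
      by (rule order_trans[OF wt_power_diff_le]) (intro mult_right_mono wt_power_diff_le, simp)
    then have "cmod (u (\<tau> - \<sigma> - \<rho>)) \<le> C * (wt \<tau> ^ p * wt \<sigma> ^ p * wt \<rho> ^ p)"
      using C mult_left_mono order_trans by blast
    then have "(cmod (k \<sigma>) * cmod (l \<rho>)) * cmod (u (\<tau> - \<sigma> - \<rho>)) \<le> (cmod (k \<sigma>) * cmod (l \<rho>)) * (C * (wt \<tau> ^ p * wt \<sigma> ^ p * wt \<rho> ^ p))"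
      by (intro mult_left_mono) auto
    then show ?thesis by (simp add: f_def norm_mult mult_ac)
  qed
  have "(\<lambda>(\<sigma>, \<rho>). C * wt \<tau> ^ p * ((cmod (k \<sigma>) * wt \<sigma> ^ p) * (cmod (l \<rho>) * wt \<rho> ^ p))) summable_on UNIV \<times> UNIV"
    using summable_on_cmult_right[OF summable_on_times[OF rapid_summable[OF k] rapid_summable[OF l]], of "C * wt \<tau> ^ p"]
    by (simp add: case_prod_unfold)
  then have "(\<lambda>z. norm ((\<lambda>(\<sigma>, \<rho>). f \<sigma> \<rho>) z)) summable_on UNIV \<times> UNIV"
    by (rule Infinite_Sum.abs_summable_on_comparison_test') (auto simp: bound)
  then have fs: "(\<lambda>(\<sigma>, \<rho>). f \<sigma> \<rho>) summable_on UNIV \<times> UNIV" by (rule abs_summable_summable)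
  have gs: "(\<lambda>(\<sigma>, n). g \<sigma> n) summable_on UNIV \<times> UNIV"
  proof -
    have "((\<lambda>(\<sigma>, \<rho>). f \<sigma> \<rho>) summable_on UNIV \<times> UNIV) = ((\<lambda>(\<sigma>, n). g \<sigma> n) summable_on UNIV \<times> UNIV)"
      by (rule summable_on_reindex_bij_witness[where i="\<lambda>(\<sigma>, n). (\<sigma>, n - \<sigma>)" and j="\<lambda>(\<sigma>, \<rho>). (\<sigma>, \<rho> + \<sigma>)"])
        (auto simp: f_def g_def algebra_simps)
    with fs show ?thesis by simp
  qed
  have "conv k (conv l u) \<tau> = (\<Sum>\<^sub>\<infinity>\<sigma>. \<Sum>\<^sub>\<infinity>\<rho>. f \<sigma> \<rho>)"
    by (simp add: conv_def f_def infsum_cmult_right'[symmetric] mult_ac)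
  also have "\<dots> = (\<Sum>\<^sub>\<infinity>\<sigma>. \<Sum>\<^sub>\<infinity>n. g \<sigma> n)"
  proof (rule infsum_cong)
    fix \<sigma>
    show "(\<Sum>\<^sub>\<infinity>\<rho>. f \<sigma> \<rho>) = (\<Sum>\<^sub>\<infinity>n. g \<sigma> n)"
      by (rule infsum_reindex_bij_witness[of UNIV "\<lambda>n. n - \<sigma>" "\<lambda>\<rho>. \<rho> + \<sigma>"]) (auto simp: f_def g_def algebra_simps)
  qed
  also have "\<dots> = (\<Sum>\<^sub>\<infinity>n. \<Sum>\<^sub>\<infinity>\<sigma>. g \<sigma> n)"
    by (rule infsum_swap_banach[OF gs])
  also have "\<dots> = conv (conv k l) u \<tau>"
    by (simp add: conv_def g_def infsum_cmult_left')
  finally show "conv k (conv l u) \<tau> = conv (conv k l) u \<tau>" .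
qed

lemma conv_left_commute:
  assumes "rapid k" "rapid l" "tempered u"
  shows "conv k (conv l u) = conv l (conv k u)"
  using conv_assoc[OF assms] conv_assoc[OF assms(2,1,3)] by (simp add: conv_commute)

text \<open>The coefficients of the constant 1, hence the unit for \<open>conv\<close>.\<close>

definition delta_seq :: "int \<Rightarrow> complex" where "delta_seq n = (if n = 0 then 1 else 0)"

lemma conv_delta: "conv delta_seq u = u"
proof
  fix \<tau>
  have "conv delta_seq u \<tau> = (\<Sum>\<^sub>\<infinity>\<sigma>\<in>{0}. delta_seq \<sigma> * u (\<tau> - \<sigma>))"
    unfolding conv_def by (rule infsum_cong_neutral) (auto simp: delta_seq_def)
  then show "conv delta_seq u \<tau> = u \<tau>" by (simp add: delta_seq_def)
qed

lemma tempered_add: assumes "tempered u" "tempered v" shows "tempered (\<lambda>n. u n + v n)"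
proof -
  obtain C p where u: "C \<ge> 0" "\<And>n. cmod (u n) \<le> C * wt n ^ p" using assms(1) temperedE by blast
  obtain C' p' where v: "C' \<ge> 0" "\<And>n. cmod (v n) \<le> C' * wt n ^ p'" using assms(2) temperedE by blast
  have "cmod (u n + v n) \<le> (C + C') * wt n ^ (max p p')" for n
  proof -
    have "C * wt n ^ p \<le> C * wt n ^ (max p p')" by (intro mult_left_mono wt_power_mono u) auto
    moreover have "C' * wt n ^ p' \<le> C' * wt n ^ (max p p')" by (intro mult_left_mono wt_power_mono v) auto
    ultimately show ?thesis using u(2)[of n] v(2)[of n] norm_triangle_ineq[of "u n" "v n"]
      by (simp add: algebra_simps)
  qed
  then show ?thesis unfolding tempered_def by blast
qed

lemma tempered_mult:
  assumes "tempered u" "\<And>n. cmod (v n) \<le> D * wt n ^ d * cmod (u n)" "D \<ge> 0"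
  shows "tempered v"
proof -
  obtain C p where u: "C \<ge> 0" "\<And>n. cmod (u n) \<le> C * wt n ^ p" using assms(1) temperedE by blast
  have "cmod (v n) \<le> (D * C) * wt n ^ (d + p)" for n
  proof -
    have "D * wt n ^ d * cmod (u n) \<le> D * wt n ^ d * (C * wt n ^ p)"
      by (intro mult_left_mono u) (use assms in auto)
    then show ?thesis using assms(2)[of n] by (simp add: power_add mult_ac)
  qed
  then show ?thesis unfolding tempered_def by blast
qed

lemma tempered_cmult: "tempered u \<Longrightarrow> tempered (\<lambda>n. c * u n)"
  by (rule tempered_mult[where d=0 and D="cmod c"]) (auto simp: norm_mult)

text \<open>Differentiation on the Fourier side.\<close>

definition Dseq :: "(int \<Rightarrow> complex) \<Rightarrow> int \<Rightarrow> complex" where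
  "Dseq u = (\<lambda>n. \<i> * of_int n * u n)"

lemma tempered_Dseq: assumes "tempered u" shows "tempered (Dseq u)"
proof (rule tempered_mult[OF assms, where d=1 and D=1])
  show "cmod (Dseq u n) \<le> 1 * wt n ^ 1 * cmod (u n)" for n
    by (auto simp: Dseq_def norm_mult wt_def intro!: mult_right_mono)
qed simp

lemma rapid_mult:
  assumes "rapid u" "\<And>n. cmod (v n) \<le> D * wt n ^ d * cmod (u n)" "D \<ge> 0"
  shows "rapid v"
  unfolding rapid_def
proof
  fix p
  obtain C where C: "\<And>n. cmod (u n) * wt n ^ (d + p) \<le> C" using assms(1) by (meson rapid_def)
  have "cmod (v n) * wt n ^ p \<le> D * C" for n
  proof -
    have "cmod (v n) * wt n ^ p \<le> D * wt n ^ d * cmod (u n) * wt n ^ p"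
      by (intro mult_right_mono assms) auto
    also have "\<dots> = D * (cmod (u n) * wt n ^ (d + p))" by (simp add: power_add mult_ac)
    also have "\<dots> \<le> D * C" by (intro mult_left_mono C assms)
    finally show ?thesis .
  qed
  then show "\<exists>C. \<forall>n. cmod (v n) * wt n ^ p \<le> C" by blast
qed

lemma rapid_Dseq: assumes "rapid u" shows "rapid (Dseq u)"
proof (rule rapid_mult[OF assms, where d=1 and D=1])
  show "cmod (Dseq u n) \<le> 1 * wt n ^ 1 * cmod (u n)" for n
    by (auto simp: Dseq_def norm_mult wt_def intro!: mult_right_mono)
qed simp

lemma rapid_cmult: "rapid u \<Longrightarrow> rapid (\<lambda>n. c * u n)"
  by (rule rapid_mult[where d=0 and D="cmod c"]) (auto simp: norm_mult)

lemma conv_cmult_left: "conv (\<lambda>n. c * k n) u = (\<lambda>n. c * conv k u n)"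
  by (simp add: conv_def infsum_cmult_right' mult.assoc)

lemma conv_cmult_right: "conv k (\<lambda>n. c * u n) = (\<lambda>n. c * conv k u n)"
  by (metis conv_commute conv_cmult_left)

lemma conv_add_right:
  assumes "rapid k" "tempered u" "tempered v"
  shows "conv k (\<lambda>n. u n + v n) = (\<lambda>n. conv k u n + conv k v n)"
  unfolding conv_def
  by (simp add: distrib_left infsum_add conv_summable assms)

text \<open>The Leibniz rule, obtained by writing \<tau> = \<sigma> + (\<tau> - \<sigma>) under the
  sum.\<close>

lemma Dseq_conv:
  assumes "rapid k" "tempered u"
  shows "Dseq (conv k u) = (\<lambda>n. conv (Dseq k) u n + conv k (Dseq u) n)"
proof
  fix \<tau>
  have "conv (Dseq k) u \<tau> + conv k (Dseq u) \<tau> =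
      (\<Sum>\<^sub>\<infinity>\<sigma>. Dseq k \<sigma> * u (\<tau> - \<sigma>) + k \<sigma> * Dseq u (\<tau> - \<sigma>))"
    unfolding conv_def
    by (intro infsum_add[symmetric] conv_summable rapid_Dseq tempered_Dseq assms)
  also have "\<dots> = (\<Sum>\<^sub>\<infinity>\<sigma>. (\<i> * of_int \<tau>) * (k \<sigma> * u (\<tau> - \<sigma>)))"
    by (intro infsum_cong) (simp add: Dseq_def algebra_simps)
  also have "\<dots> = Dseq (conv k u) \<tau>"
    by (simp add: infsum_cmult_right' Dseq_def conv_def)
  finally show "Dseq (conv k u) \<tau> = conv (Dseq k) u \<tau> + conv k (Dseq u) \<tau>" by simp
qed

text \<open>The norm bound is stated on finite sections, so no summability has to be carried along;
  the triangle inequality and the passage to limits are then those of \<open>L2_set\<close>. The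
  empty section forces B \<ge> 0.\<close>

definition l2_bounded :: "('a \<Rightarrow> real) \<Rightarrow> real \<Rightarrow> bool" where
  "l2_bounded x B \<longleftrightarrow> (\<forall>F. finite F \<longrightarrow> L2_set x F \<le> B)"

lemma l2_boundedD: "l2_bounded x B \<Longrightarrow> finite F \<Longrightarrow> L2_set x F \<le> B"
  by (simp add: l2_bounded_def)

lemma l2_bounded_nonneg: "l2_bounded x B \<Longrightarrow> B \<ge> 0"
  using l2_boundedD[of x B "{}"] by simp

lemma l2_bounded_mono:
  assumes "l2_bounded x B" "\<And>n. 0 \<le> y n" "\<And>n. y n \<le> x n" "B \<le> B'"
  shows "l2_bounded y B'"
  unfolding l2_bounded_def
proof (intro allI impI)
  fix F :: "'a set" assume "finite F"
  then show "L2_set y F \<le> B'"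
    using L2_set_mono[of F y x] l2_boundedD[OF assms(1)] assms by (meson order_trans)
qed

lemma l2_bounded_weaken: "l2_bounded x B \<Longrightarrow> B \<le> B' \<Longrightarrow> l2_bounded x B'"
  unfolding l2_bounded_def using order_trans by blast

lemma l2_bounded_add:
  assumes "l2_bounded x B" "l2_bounded y C"
  shows "l2_bounded (\<lambda>n. x n + y n) (B + C)"
  unfolding l2_bounded_def
proof (intro allI impI)
  fix F :: "'a set" assume "finite F"
  then show "L2_set (\<lambda>n. x n + y n) F \<le> B + C"
    using L2_set_triangle_ineq[of x y F] assms[THEN l2_boundedD, of F] by linarith
qed

lemma l2_bounded_cmult:
  assumes "l2_bounded x B" "c \<ge> 0"
  shows "l2_bounded (\<lambda>n. c * x n) (c * B)"
  using assms unfolding l2_bounded_def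
  by (simp add: L2_set_right_distrib[symmetric] mult_left_mono)

lemma l2_bounded_member: "l2_bounded x B \<Longrightarrow> x n \<le> B"
  using l2_boundedD[of x B "{n}"] by auto

lemma l2_bounded_iff_sum:
  assumes "B \<ge> 0"
  shows "l2_bounded x B \<longleftrightarrow> (\<forall>F. finite F \<longrightarrow> (\<Sum>n\<in>F. (x n)\<^sup>2) \<le> B\<^sup>2)"
  unfolding l2_bounded_def L2_set_def using assms
  by (meson real_le_lsqrt real_sqrt_le_iff sqrt_le_D sum_nonneg zero_le_power2)

lemma L2_set_sum_le: "L2_set (\<lambda>i. \<Sum>j\<in>G. f j i) F \<le> (\<Sum>j\<in>G. L2_set (f j) F)"
proof (induction G rule: infinite_finite_induct)
  case (insert j G)
  then show ?case
    using L2_set_triangle_ineq[of "f j" "\<lambda>i. \<Sum>j\<in>G. f j i" F] by simp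
qed (auto simp: L2_set_0')

text \<open>Fatou's lemma for sequences: a finite section sees only finitely many coordinates, so
  pointwise convergence suffices.\<close>

lemma l2_bounded_tendsto:
  assumes "\<And>n. ((\<lambda>j. X j n) \<longlongrightarrow> x n) G" "\<forall>\<^sub>F j in G. l2_bounded (X j) B" "G \<noteq> bot"
  shows "l2_bounded x B"
  unfolding l2_bounded_def
proof (intro allI impI)
  fix F :: "'a set" assume F: "finite F"
  have "((\<lambda>j. L2_set (X j) F) \<longlongrightarrow> L2_set x F) G"
    unfolding L2_set_def by (intro tendsto_intros assms)
  moreover have "\<forall>\<^sub>F j in G. L2_set (X j) F \<le> B"
    using assms(2) by (rule eventually_mono) (use F in \<open>auto simp: l2_bounded_def\<close>)
  ultimately show "L2_set x F \<le> B"
    using assms(3) by (rule tendsto_upperbound)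
qed

lemma l2_bounded_translate:
  fixes x :: "int \<Rightarrow> real"
  assumes "l2_bounded x B" shows "l2_bounded (\<lambda>n. x (n - m)) B"
  unfolding l2_bounded_def
proof (intro allI impI)
  fix F :: "int set" assume F: "finite F"
  have "L2_set (\<lambda>n. x (n - m)) F = L2_set x ((\<lambda>n. n - m) ` F)"
    unfolding L2_set_def by (subst sum.reindex) (auto simp: inj_on_def)
  also have "\<dots> \<le> B" by (intro l2_boundedD[OF assms] finite_imageI F)
  finally show "L2_set (\<lambda>n. x (n - m)) F \<le> B" .
qed

text \<open>Young's inequality for a summable kernel. Translations preserve the bound, so
  Minkowski's inequality handles finite partial sums of the kernel, and the limit is taken
  coordinatewise.\<close>

lemma l2_bounded_conv:
  fixes x \<kappa> :: "int \<Rightarrow> real"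
  assumes x: "l2_bounded x B" "\<And>n. x n \<ge> 0" and k: "\<kappa> summable_on UNIV" "\<And>n. \<kappa> n \<ge> 0"
  shows "l2_bounded (\<lambda>\<tau>. \<Sum>\<^sub>\<infinity>\<sigma>. \<kappa> \<sigma> * x (\<tau> - \<sigma>)) (infsum \<kappa> UNIV * B)"
    and "(\<lambda>\<sigma>. \<kappa> \<sigma> * x (\<tau> - \<sigma>)) summable_on UNIV"
proof -
  show s: "(\<lambda>\<sigma>. \<kappa> \<sigma> * x (\<tau> - \<sigma>)) summable_on UNIV" for \<tau>
  proof (rule summable_on_comparison_test)
    show "(\<lambda>\<sigma>. \<kappa> \<sigma> * B) summable_on UNIV" by (intro summable_on_cmult_left k)
  qed (auto intro!: mult_left_mono l2_bounded_member[OF x(1)] simp: k x)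
  show "l2_bounded (\<lambda>\<tau>. \<Sum>\<^sub>\<infinity>\<sigma>. \<kappa> \<sigma> * x (\<tau> - \<sigma>)) (infsum \<kappa> UNIV * B)"
  proof (rule l2_bounded_tendsto)
    show "((\<lambda>G. \<Sum>\<sigma>\<in>G. \<kappa> \<sigma> * x (\<tau> - \<sigma>)) \<longlongrightarrow> (\<Sum>\<^sub>\<infinity>\<sigma>. \<kappa> \<sigma> * x (\<tau> - \<sigma>))) (finite_subsets_at_top UNIV)" for \<tau>
      by (rule infsum_tendsto[OF s])
    have "l2_bounded (\<lambda>\<tau>. \<Sum>\<sigma>\<in>G. \<kappa> \<sigma> * x (\<tau> - \<sigma>)) (infsum \<kappa> UNIV * B)" if G: "finite G" for G
      unfolding l2_bounded_def
    proof (intro allI impI)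
      fix F :: "int set" assume F: "finite F"
      have "L2_set (\<lambda>\<tau>. \<Sum>\<sigma>\<in>G. \<kappa> \<sigma> * x (\<tau> - \<sigma>)) F \<le> (\<Sum>\<sigma>\<in>G. L2_set (\<lambda>\<tau>. \<kappa> \<sigma> * x (\<tau> - \<sigma>)) F)"
        by (rule L2_set_sum_le)
      also have "\<dots> \<le> (\<Sum>\<sigma>\<in>G. \<kappa> \<sigma> * B)"
        by (intro sum_mono l2_boundedD[OF _ F] l2_bounded_cmult l2_bounded_translate x k)
      also have "\<dots> = (\<Sum>\<sigma>\<in>G. \<kappa> \<sigma>) * B" by (simp add: sum_distrib_right)
      also have "\<dots> \<le> infsum \<kappa> UNIV * B"
        by (intro mult_right_mono finite_sum_le_infsum k l2_bounded_nonneg[OF x(1)] G) auto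
      finally show "L2_set (\<lambda>\<tau>. \<Sum>\<sigma>\<in>G. \<kappa> \<sigma> * x (\<tau> - \<sigma>)) F \<le> infsum \<kappa> UNIV * B" .
    qed
    then show "\<forall>\<^sub>F G in finite_subsets_at_top UNIV.
        l2_bounded (\<lambda>\<tau>. \<Sum>\<sigma>\<in>G. \<kappa> \<sigma> * x (\<tau> - \<sigma>)) (infsum \<kappa> UNIV * B)"
      by (auto intro: eventually_finite_subsets_at_top_weakI)
  qed simp
qed

text \<open>A weight that changes by at most a power of \<open>wt \<sigma>\<close> under translation
  by \<sigma> can be moved inside the convolution, which reduces the claim to Young's inequality for
  the kernel \<open>cmod (k \<sigma>) * wt \<sigma> ^ p\<close>.\<close>

lemma l2_bounded_weighted_conv:
  fixes v :: "int \<Rightarrow> real"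
  assumes k: "rapid k" and u: "tempered u" and B: "l2_bounded (\<lambda>\<tau>. v \<tau> * cmod (u \<tau>)) B"
    and v: "\<And>\<tau>. v \<tau> \<ge> 0" "\<And>\<tau> \<sigma>. v \<tau> \<le> wt \<sigma> ^ p * v (\<tau> - \<sigma>)"
  shows "l2_bounded (\<lambda>\<tau>. v \<tau> * cmod (conv k u \<tau>)) ((\<Sum>\<^sub>\<infinity>\<sigma>. cmod (k \<sigma>) * wt \<sigma> ^ p) * B)"
proof (rule l2_bounded_mono[OF l2_bounded_conv(1)[OF B _ rapid_summable[OF k, of p]]])
  fix \<tau>
  have "v \<tau> * cmod (conv k u \<tau>) = cmod (\<Sum>\<^sub>\<infinity>\<sigma>. of_real (v \<tau>) * (k \<sigma> * u (\<tau> - \<sigma>)))"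
    by (simp add: conv_def infsum_cmult_right' norm_mult v)
  also have "\<dots> \<le> (\<Sum>\<^sub>\<infinity>\<sigma>. cmod (k \<sigma>) * wt \<sigma> ^ p * (v (\<tau> - \<sigma>) * cmod (u (\<tau> - \<sigma>))))"
  proof (rule norm_infsum_le)
    show "((\<lambda>\<sigma>. of_real (v \<tau>) * (k \<sigma> * u (\<tau> - \<sigma>))) has_sum
        (\<Sum>\<^sub>\<infinity>\<sigma>. of_real (v \<tau>) * (k \<sigma> * u (\<tau> - \<sigma>)))) UNIV"
      by (intro has_sum_infsum summable_on_cmult_right conv_summable k u)
    show "((\<lambda>\<sigma>. cmod (k \<sigma>) * wt \<sigma> ^ p * (v (\<tau> - \<sigma>) * cmod (u (\<tau> - \<sigma>)))) has_sum
       (\<Sum>\<^sub>\<infinity>\<sigma>. cmod (k \<sigma>) * wt \<sigma> ^ p * (v (\<tau> - \<sigma>) * cmod (u (\<tau> - \<sigma>))))) UNIV"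
      by (intro has_sum_infsum l2_bounded_conv(2)[OF B _ rapid_summable[OF k, of p]]) (auto simp: v)
    fix \<sigma>
    have "v \<tau> * (cmod (k \<sigma>) * cmod (u (\<tau> - \<sigma>))) \<le> (wt \<sigma> ^ p * v (\<tau> - \<sigma>)) * (cmod (k \<sigma>) * cmod (u (\<tau> - \<sigma>)))"
      by (intro mult_right_mono v) auto
    then show "cmod (of_real (v \<tau>) * (k \<sigma> * u (\<tau> - \<sigma>))) \<le>
        cmod (k \<sigma>) * wt \<sigma> ^ p * (v (\<tau> - \<sigma>) * cmod (u (\<tau> - \<sigma>)))"
      by (simp add: norm_mult v mult_ac)
  qed
  finally show "v \<tau> * cmod (conv k u \<tau>) \<le>
      (\<Sum>\<^sub>\<infinity>\<sigma>. cmod (k \<sigma>) * wt \<sigma> ^ p * (v (\<tau> - \<sigma>) * cmod (u (\<tau> - \<sigma>))))" .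
qed (auto simp: v)

section \<open>The gauge transformation on a single frequency slice\<close>

definition elliptic_wt :: "real \<Rightarrow> nat \<Rightarrow> int \<Rightarrow> real" where
  "elliptic_wt q m \<tau> = ((real m)\<^sup>2 + (real_of_int \<tau>)\<^sup>2) powr (q / 2)"

abbreviation elliptic_bounded :: "real \<Rightarrow> nat \<Rightarrow> (int \<Rightarrow> complex) \<Rightarrow> real \<Rightarrow> bool" where
  "elliptic_bounded q m u \<equiv> l2_bounded (\<lambda>\<tau>. elliptic_wt q m \<tau> * cmod (u \<tau>))"

text \<open>Rounding the exponent up gives a natural power, the form in which rapid decay is
  available.\<close>

lemma powr_wt_le: "wt n powr \<bar>q\<bar> \<le> wt n ^ nat \<lceil>\<bar>q\<bar>\<rceil>"
proof -
  have "wt n powr \<bar>q\<bar> \<le> wt n powr (real (nat \<lceil>\<bar>q\<bar>\<rceil>))"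
    by (intro powr_mono real_nat_ceiling_ge wt_ge1)
  then show ?thesis by (subst (asm) powr_realpow) simp_all
qed

lemma abs_exp_minus_one_le: "\<bar>exp x - 1\<bar> \<le> \<bar>x\<bar> * exp \<bar>x\<bar>" for x :: real
proof -
  have "\<bar>x\<bar> * 1 \<le> \<bar>x\<bar> * exp \<bar>x\<bar>" by (intro mult_left_mono) auto
  moreover have "exp x - 1 \<ge> x" using exp_ge_add_one_self[of x] by linarith
  moreover have "exp x - 1 \<le> x * exp x"
  proof -
    have "1 - x \<le> exp (- x)" using exp_ge_add_one_self[of "- x"] by simp
    then have "exp x * (1 - x) \<le> exp x * exp (- x)" by (intro mult_left_mono) auto
    then show ?thesis by (simp add: exp_minus algebra_simps)
  qed
  moreover have "x * exp x \<le> \<bar>x\<bar> * exp \<bar>x\<bar>" by (intro mult_mono) auto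
  ultimately show ?thesis by linarith
qed

text \<open>The weight is exp (q ln r) with r the length of the vector (m, \<tau>). This r is
  1-Lipschitz in \<tau> and at least m, so ln r is Lipschitz with constant 1 / m, and the relative
  change of the weight inherits that factor.\<close>

lemma elliptic_wt_diff:
  assumes "m > 0"
  shows "\<bar>elliptic_wt q m \<tau> - elliptic_wt q m \<sigma>\<bar> \<le>
    \<bar>q\<bar> / real m * wt (\<tau> - \<sigma>) ^ (nat \<lceil>\<bar>q\<bar>\<rceil> + 1) * elliptic_wt q m \<sigma>"
proof -
  define r where "r = (\<lambda>\<tau>::int. sqrt ((real m)\<^sup>2 + (real_of_int \<tau>)\<^sup>2))"
  have r_ge: "r \<tau> \<ge> real m" "r \<tau> > 0" for \<tau>
  proof -
    show "r \<tau> \<ge> real m" unfolding r_def by (rule real_le_rsqrt) simp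
    then show "r \<tau> > 0" using assms by linarith
  qed
  have W: "elliptic_wt q m \<tau> = exp (q * ln (r \<tau>))" for \<tau>
  proof -
    have "(real m)\<^sup>2 + (real_of_int \<tau>)\<^sup>2 > 0" using assms by (simp add: add_pos_nonneg)
    then show ?thesis using assms by (simp add: elliptic_wt_def r_def powr_def ln_sqrt)
  qed
  have r_lip: "r \<tau> \<le> r \<sigma> + \<bar>real_of_int (\<tau> - \<sigma>)\<bar>" for \<tau> \<sigma>
    using real_sqrt_sum_squares_triangle_ineq[of "real m" 0 "real_of_int \<sigma>" "real_of_int (\<tau> - \<sigma>)"]
    by (simp add: r_def)
  have ln_le: "ln (r \<tau>) - ln (r \<sigma>) \<le> \<bar>real_of_int (\<tau> - \<sigma>)\<bar> / real m"
    "ln (r \<tau>) - ln (r \<sigma>) \<le> ln (wt (\<tau> - \<sigma>))" for \<tau> \<sigma>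
  proof -
    have eq: "ln (r \<tau>) - ln (r \<sigma>) = ln (r \<tau> / r \<sigma>)"
      using r_ge(2)[of \<tau>] r_ge(2)[of \<sigma>] by (simp add: ln_div)
    have "r \<tau> / r \<sigma> \<le> 1 + \<bar>real_of_int (\<tau> - \<sigma>)\<bar> / r \<sigma>"
      using r_lip[of \<tau> \<sigma>] r_ge(2)[of \<sigma>] by (simp add: field_simps)
    also have "\<dots> \<le> 1 + \<bar>real_of_int (\<tau> - \<sigma>)\<bar> / real m"
      using r_ge[of \<sigma>] assms by (intro add_left_mono divide_left_mono) auto
    finally have le: "r \<tau> / r \<sigma> \<le> 1 + \<bar>real_of_int (\<tau> - \<sigma>)\<bar> / real m" .
    show "ln (r \<tau>) - ln (r \<sigma>) \<le> \<bar>real_of_int (\<tau> - \<sigma>)\<bar> / real m"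
      using le ln_le_minus_one[of "r \<tau> / r \<sigma>"] r_ge by (simp add: eq)
    have "1 + \<bar>real_of_int (\<tau> - \<sigma>)\<bar> / real m \<le> wt (\<tau> - \<sigma>)"
      using assms mult_right_mono[of 1 "real m" "\<bar>real_of_int (\<tau> - \<sigma>)\<bar>"]
      by (simp add: wt_def divide_le_eq mult.commute)
    then show "ln (r \<tau>) - ln (r \<sigma>) \<le> ln (wt (\<tau> - \<sigma>))"
      using le r_ge by (simp add: eq)
  qed
  define d where "d = ln (r \<tau>) - ln (r \<sigma>)"
  have d1: "\<bar>d\<bar> \<le> \<bar>real_of_int (\<tau> - \<sigma>)\<bar> / real m"
    using ln_le(1)[of \<tau> \<sigma>] ln_le(1)[of \<sigma> \<tau>] unfolding d_def by (simp add: abs_minus_commute)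
  have d2: "\<bar>d\<bar> \<le> ln (wt (\<tau> - \<sigma>))"
    using ln_le(2)[of \<tau> \<sigma>] ln_le(2)[of \<sigma> \<tau>] wt_minus[of "\<tau> - \<sigma>"] unfolding d_def by simp
  \<comment> \<open>The ratio of the two weights is exp (q d), where \<open>d\<close> is the
    increment of ln r.\<close>
  have "elliptic_wt q m \<tau> - elliptic_wt q m \<sigma> = elliptic_wt q m \<sigma> * (exp (q * d) - 1)"
    by (simp add: W d_def algebra_simps flip: exp_add)
  then have "\<bar>elliptic_wt q m \<tau> - elliptic_wt q m \<sigma>\<bar> = elliptic_wt q m \<sigma> * \<bar>exp (q * d) - 1\<bar>"
    by (simp add: abs_mult W)
  also have "\<dots> \<le> elliptic_wt q m \<sigma> * (\<bar>q * d\<bar> * exp \<bar>q * d\<bar>)"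
    by (intro mult_left_mono abs_exp_minus_one_le) (simp add: W)
  \<comment> \<open>The bound \<open>d1\<close> supplies the linear factor with its 1 / m, while
    \<open>d2\<close> keeps the exponential polynomial in \<tau> - \<sigma>. The linear factor
    accounts for the + 1 in the final exponent.\<close>
  also have "\<dots> \<le> elliptic_wt q m \<sigma> * ((\<bar>q\<bar> * (wt (\<tau> - \<sigma>) / real m)) * wt (\<tau> - \<sigma>) ^ nat \<lceil>\<bar>q\<bar>\<rceil>)"
  proof (intro mult_left_mono mult_mono)
    have "\<bar>real_of_int (\<tau> - \<sigma>)\<bar> / real m \<le> wt (\<tau> - \<sigma>) / real m"
      by (intro divide_right_mono) (auto simp: wt_def)
    with d1 have "\<bar>d\<bar> \<le> wt (\<tau> - \<sigma>) / real m" by linarith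
    then show "\<bar>q * d\<bar> \<le> \<bar>q\<bar> * (wt (\<tau> - \<sigma>) / real m)"
      unfolding abs_mult by (intro mult_left_mono) auto
    have "exp \<bar>q * d\<bar> \<le> exp (\<bar>q\<bar> * ln (wt (\<tau> - \<sigma>)))"
      using d2 by (simp add: abs_mult mult_left_mono)
    also have "\<dots> = wt (\<tau> - \<sigma>) powr \<bar>q\<bar>" by (simp add: powr_def)
    also have "\<dots> \<le> wt (\<tau> - \<sigma>) ^ nat \<lceil>\<bar>q\<bar>\<rceil>" by (rule powr_wt_le)
    finally show "exp \<bar>q * d\<bar> \<le> wt (\<tau> - \<sigma>) ^ nat \<lceil>\<bar>q\<bar>\<rceil>" .
  qed (auto simp: W)
  finally show ?thesis by (simp add: mult_ac)
qed

lemma elliptic_wt_nonneg [simp]: "elliptic_wt q m \<tau> \<ge> 0"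
  by (simp add: elliptic_wt_def)

text \<open>Comparing the weight with its value at 0 through \<open>elliptic_wt_diff\<close> shows
  that it grows at most polynomially.\<close>

lemma tempered_elliptic_wt:
  assumes "m > 0" "tempered u"
  shows "tempered (\<lambda>\<tau>. of_real (elliptic_wt q m \<tau>) * u \<tau>)"
proof (rule tempered_mult[OF assms(2)])
  let ?D = "(1 + \<bar>q\<bar> / real m) * elliptic_wt q m 0" and ?d = "nat \<lceil>\<bar>q\<bar>\<rceil> + 1"
  fix n
  have "elliptic_wt q m n \<le> elliptic_wt q m 0 + \<bar>q\<bar> / real m * wt n ^ ?d * elliptic_wt q m 0"
    using elliptic_wt_diff[OF assms(1), of q n 0] by (simp add: abs_le_iff)
  also have "\<dots> \<le> wt n ^ ?d * elliptic_wt q m 0 + \<bar>q\<bar> / real m * wt n ^ ?d * elliptic_wt q m 0"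
    using mult_right_mono[OF wt_power_ge1[of n ?d], of "elliptic_wt q m 0"] by simp
  also have "\<dots> = ?D * wt n ^ ?d" by (simp add: algebra_simps)
  finally show "cmod (of_real (elliptic_wt q m n) * u n) \<le> ?D * wt n ^ ?d * cmod (u n)"
    by (simp add: norm_mult mult_right_mono)
qed simp

text \<open>The commutator of the convolution with the weight gains a factor \<open>1 / m\<close>.\<close>
lemma l2_bounded_elliptic_conv:
  assumes e: "rapid e"
    and contr: "\<And>u B. tempered u \<Longrightarrow> l2_bounded (\<lambda>n. cmod (u n)) B \<Longrightarrow> l2_bounded (\<lambda>n. cmod (conv e u n)) B"
    and m: "m > 0" and u: "tempered u"
    and B: "elliptic_bounded q m u B"
  defines "p \<equiv> nat \<lceil>\<bar>q\<bar>\<rceil> + 1"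
  shows "elliptic_bounded q m (conv e u)
           ((1 + \<bar>q\<bar> * (\<Sum>\<^sub>\<infinity>\<sigma>. cmod (e \<sigma>) * wt \<sigma> ^ p) / real m) * B)"
proof -
  define W where "W = elliptic_wt q m"
  define w where "w = (\<lambda>\<tau>. of_real (W \<tau>) * u \<tau>)"
  define \<kappa> where "\<kappa> = (\<lambda>\<sigma>. \<bar>q\<bar> / real m * (cmod (e \<sigma>) * wt \<sigma> ^ p))"
  have W0: "W \<tau> \<ge> 0" for \<tau> by (simp add: W_def)
  have tw: "tempered w" unfolding w_def W_def by (rule tempered_elliptic_wt[OF m u])
  have Bw: "l2_bounded (\<lambda>n. cmod (w n)) B" using B by (simp add: w_def norm_mult W_def)
  have \<kappa>: "\<kappa> summable_on UNIV" "\<And>n. \<kappa> n \<ge> 0"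
    unfolding \<kappa>_def by (intro summable_on_cmult_right rapid_summable e) auto
  have sum: "l2_bounded (\<lambda>\<tau>. cmod (conv e w \<tau>) + (\<Sum>\<^sub>\<infinity>\<sigma>. \<kappa> \<sigma> * cmod (w (\<tau> - \<sigma>)))) (B + infsum \<kappa> UNIV * B)"
    by (intro l2_bounded_add contr tw Bw l2_bounded_conv \<kappa>) auto
  have bound: "W \<tau> * cmod (conv e u \<tau>) \<le> cmod (conv e w \<tau>) + (\<Sum>\<^sub>\<infinity>\<sigma>. \<kappa> \<sigma> * cmod (w (\<tau> - \<sigma>)))" for \<tau>
  proof -
    \<comment> \<open>\<open>g\<close> collects the commutator: \<open>W\<close> times the
      convolution is the convolution with \<open>w\<close>, to which the contraction applies without
      loss, plus the sum of \<open>g\<close>.\<close>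
    define g where "g = (\<lambda>\<sigma>. e \<sigma> * (of_real (W \<tau> - W (\<tau> - \<sigma>)) * u (\<tau> - \<sigma>)))"
    have gs: "g summable_on UNIV"
    proof -
      have "(\<lambda>\<sigma>. of_real (W \<tau>) * (e \<sigma> * u (\<tau> - \<sigma>)) - e \<sigma> * w (\<tau> - \<sigma>)) summable_on UNIV"
        using summable_on_add[OF summable_on_cmult_right[OF conv_summable[OF e u]]
            summable_on_cmult_right[OF conv_summable[OF e tw], of "- 1"]] by simp
      then show ?thesis by (rule back_subst[of "\<lambda>f. f summable_on UNIV"]) (auto simp: g_def w_def algebra_simps)
    qed
    have "of_real (W \<tau>) * conv e u \<tau> = (\<Sum>\<^sub>\<infinity>\<sigma>. e \<sigma> * w (\<tau> - \<sigma>) + g \<sigma>)"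
      unfolding conv_def infsum_cmult_right'[symmetric] g_def w_def by (intro infsum_cong) (simp add: algebra_simps)
    also have "\<dots> = conv e w \<tau> + infsum g UNIV"
      unfolding conv_def by (intro infsum_add conv_summable e tw gs)
    finally have "W \<tau> * cmod (conv e u \<tau>) \<le> cmod (conv e w \<tau>) + cmod (infsum g UNIV)"
      by (metis W0 abs_of_nonneg norm_mult norm_of_real norm_triangle_ineq)
    moreover have "cmod (infsum g UNIV) \<le> (\<Sum>\<^sub>\<infinity>\<sigma>. \<kappa> \<sigma> * cmod (w (\<tau> - \<sigma>)))"
    proof (rule norm_infsum_le)
      show "(g has_sum infsum g UNIV) UNIV" by (rule has_sum_infsum[OF gs])
      show "((\<lambda>\<sigma>. \<kappa> \<sigma> * cmod (w (\<tau> - \<sigma>))) has_sum (\<Sum>\<^sub>\<infinity>\<sigma>. \<kappa> \<sigma> * cmod (w (\<tau> - \<sigma>)))) UNIV"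
        by (intro has_sum_infsum l2_bounded_conv(2)[OF Bw] \<kappa>) auto
      fix \<sigma>
      have "\<bar>W \<tau> - W (\<tau> - \<sigma>)\<bar> \<le> \<bar>q\<bar> / real m * wt \<sigma> ^ p * W (\<tau> - \<sigma>)"
        using elliptic_wt_diff[OF m, of q \<tau> "\<tau> - \<sigma>"] by (simp add: W_def p_def)
      then have "\<bar>W \<tau> - W (\<tau> - \<sigma>)\<bar> * (cmod (e \<sigma>) * cmod (u (\<tau> - \<sigma>))) \<le>
          \<bar>q\<bar> / real m * wt \<sigma> ^ p * W (\<tau> - \<sigma>) * (cmod (e \<sigma>) * cmod (u (\<tau> - \<sigma>)))"
        by (rule mult_right_mono) simp
      moreover have "cmod (g \<sigma>) = \<bar>W \<tau> - W (\<tau> - \<sigma>)\<bar> * (cmod (e \<sigma>) * cmod (u (\<tau> - \<sigma>)))"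
        unfolding g_def norm_mult norm_of_real by simp
      ultimately show "cmod (g \<sigma>) \<le> \<kappa> \<sigma> * cmod (w (\<tau> - \<sigma>))"
        by (simp add: \<kappa>_def w_def norm_mult W0 mult_ac)
    qed
    ultimately show ?thesis by linarith
  qed
  have B0: "0 \<le> B" by (rule l2_bounded_nonneg[OF Bw])
  have eq: "infsum \<kappa> UNIV = \<bar>q\<bar> * (\<Sum>\<^sub>\<infinity>\<sigma>. cmod (e \<sigma>) * wt \<sigma> ^ p) / real m"
    unfolding \<kappa>_def infsum_cmult_right' by simp
  show ?thesis
    by (rule l2_bounded_mono[OF sum]) (use bound W0 in \<open>auto simp: W_def[symmetric] eq algebra_simps\<close>)
qed

text \<open>The same m is the parameter of the weight and the number of iterations, so the factors 1
  + K / m multiply to at most exp K. The resulting constant depends on \<open>e\<close> and q but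
  not on m, u or B.\<close>

lemma l2_bounded_elliptic_conv_power:
  assumes e: "rapid e"
    and contr: "\<And>u B. tempered u \<Longrightarrow> l2_bounded (\<lambda>n. cmod (u n)) B \<Longrightarrow> l2_bounded (\<lambda>n. cmod (conv e u n)) B"
  shows "\<exists>K\<ge>1. \<forall>m>0. \<forall>u B. tempered u \<longrightarrow> elliptic_bounded q m u B \<longrightarrow>
     elliptic_bounded q m ((conv e ^^ m) u) (K * B)"
proof -
  define K where "K = \<bar>q\<bar> * (\<Sum>\<^sub>\<infinity>\<sigma>. cmod (e \<sigma>) * wt \<sigma> ^ (nat \<lceil>\<bar>q\<bar>\<rceil> + 1))"
  have K0: "K \<ge> 0" unfolding K_def by (intro mult_nonneg_nonneg infsum_nonneg) auto
  have "elliptic_bounded q m ((conv e ^^ m) u) (exp K * B)"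
    if m: "m > 0" and u: "tempered u" and B: "elliptic_bounded q m u B" for m u B
  proof -
    have "tempered ((conv e ^^ j) u) \<and>
       elliptic_bounded q m ((conv e ^^ j) u) ((1 + K / real m) ^ j * B)" for j
    proof (induction j)
      case (Suc j)
      then show ?case
        using l2_bounded_elliptic_conv[OF e contr m, of "(conv e ^^ j) u" q] tempered_conv[OF e]
        by (simp add: K_def mult.assoc)
    qed (use u B in auto)
    then have "elliptic_bounded q m ((conv e ^^ m) u) ((1 + K / real m) ^ m * B)" by blast
    moreover have "(1 + K / real m) ^ m * B \<le> exp K * B"
    proof (rule mult_right_mono[OF _ l2_bounded_nonneg[OF B]])
      have "(1 + K / real m) ^ m \<le> exp (K / real m) ^ m"
        using K0 by (intro power_mono) auto
      also have "\<dots> = exp K" using m by (simp flip: exp_of_nat_mult)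
      finally show "(1 + K / real m) ^ m \<le> exp K" .
    qed
    ultimately show ?thesis by (rule l2_bounded_weaken)
  qed
  then show ?thesis using K0 by (intro exI[of _ "exp K"]) auto
qed


section \<open>Comparison of the elliptic weight with the Sobolev weight\<close>

abbreviation bracket :: "int \<Rightarrow> real" where
  "bracket n \<equiv> japanese_bracket (real_of_int n)"

abbreviation sobolev_bounded :: "real \<Rightarrow> (int \<Rightarrow> complex) \<Rightarrow> real \<Rightarrow> bool" where
  "sobolev_bounded q u \<equiv> l2_bounded (\<lambda>\<tau>. bracket \<tau> powr q * cmod (u \<tau>))"

lemma japanese_bracket_ge1: "japanese_bracket x \<ge> 1"
  unfolding japanese_bracket_def by (rule real_le_rsqrt) simp

lemma japanese_bracket_pos [simp]:
  "japanese_bracket x > 0" "japanese_bracket x \<ge> 0" "japanese_bracket x \<noteq> 0"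
  using japanese_bracket_ge1[of x] by auto

lemma japanese_bracket_abs [simp]: "japanese_bracket \<bar>x\<bar> = japanese_bracket x"
  by (simp add: japanese_bracket_def)

lemma abs_le_japanese_bracket: "\<bar>x\<bar> \<le> japanese_bracket x"
  unfolding japanese_bracket_def by (rule real_le_rsqrt) simp

lemma japanese_bracket_le: "japanese_bracket x \<le> 1 + \<bar>x\<bar>"
proof -
  have "1 + \<bar>x\<bar>\<^sup>2 \<le> (1 + \<bar>x\<bar>)\<^sup>2" by (simp add: power2_eq_square algebra_simps)
  then show ?thesis unfolding japanese_bracket_def by (intro real_le_lsqrt) auto
qed

lemma japanese_bracket_powr: "japanese_bracket x powr q = (1 + x\<^sup>2) powr (q / 2)"
proof -
  have "sqrt (1 + x\<^sup>2) = (1 + x\<^sup>2) powr (1/2)" by (rule powr_half_sqrt[symmetric]) simp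
  then show ?thesis by (simp add: japanese_bracket_def powr_powr)
qed

text \<open>The ratio of the two brackets and its inverse are both at most
  \<open>wt \<sigma>\<close>, the second by exchanging (\<tau>, \<sigma>) for (\<tau> - \<sigma>, -
  \<sigma>); this covers either sign of q.\<close>

lemma japanese_bracket_peetre:
  "bracket \<tau> powr q \<le> wt \<sigma> ^ nat \<lceil>\<bar>q\<bar>\<rceil> * bracket (\<tau> - \<sigma>) powr q"
proof -
  have le: "bracket m \<le> wt s * bracket (m - s)" for m s :: int
  proof -
    have "bracket m \<le> bracket (m - s) + \<bar>of_int s\<bar>"
      using real_sqrt_sum_squares_triangle_ineq[of 1 0 "real_of_int (m - s)" "real_of_int s"]
      by (simp add: japanese_bracket_def)
    also have "\<dots> \<le> bracket (m - s) + \<bar>of_int s\<bar> * bracket (m - s)"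
      using mult_left_mono[OF japanese_bracket_ge1, of "\<bar>of_int s\<bar>"] by simp
    finally show ?thesis by (simp add: wt_def algebra_simps)
  qed
  define r where "r = bracket \<tau> / bracket (\<tau> - \<sigma>)"
  have r: "r > 0" "r \<le> wt \<sigma>" "1 / r \<le> wt \<sigma>"
    using le[of \<tau> \<sigma>] le[of "\<tau> - \<sigma>" "- \<sigma>"] by (auto simp: r_def field_simps)
  have "r powr q \<le> wt \<sigma> powr \<bar>q\<bar>"
  proof (cases "q \<ge> 0")
    case True
    then show ?thesis using r by (auto intro: powr_mono2)
  next
    case False
    have "r powr q = (1 / r) powr \<bar>q\<bar>" using r False by (simp add: powr_divide powr_minus_divide flip: powr_minus)
    then show ?thesis using r by (auto intro: powr_mono2)
  qed
  with powr_wt_le have "r powr q \<le> wt \<sigma> ^ nat \<lceil>\<bar>q\<bar>\<rceil>" using order_trans by blast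
  moreover have "r powr q = bracket \<tau> powr q / bracket (\<tau> - \<sigma>) powr q"
    by (simp add: r_def powr_divide)
  ultimately show ?thesis by (simp add: field_simps)
qed

text \<open>Only one factor \<open>\<langle>m\<rangle>\<close> to the power \<open>\<bar>q\<bar>\<close> is lost by passing to the elliptic weight and back.\<close>
lemma elliptic_wt_equiv:
  assumes "m > 0"
  obtains A1 A2 where "A1 \<ge> 0" "A2 \<ge> 0" "A1 * A2 = japanese_bracket (real m) powr \<bar>q\<bar>"
    "\<And>\<tau>. bracket \<tau> powr q \<le> A1 * elliptic_wt q m \<tau>"
    "\<And>\<tau>. elliptic_wt q m \<tau> \<le> A2 * bracket \<tau> powr q"
proof -
  have m1: "1 \<le> (real m)\<^sup>2" using assms by simp
  have le1: "1 + x\<^sup>2 \<le> (real m)\<^sup>2 + x\<^sup>2" for x :: real using m1 by simp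
  have le2: "(real m)\<^sup>2 + x\<^sup>2 \<le> (1 + (real m)\<^sup>2) * (1 + x\<^sup>2)" for x :: real
    by (simp add: algebra_simps)
  have pos: "0 < 1 + x\<^sup>2" "0 < (real m)\<^sup>2 + x\<^sup>2" for x :: real
  proof -
    show "0 < 1 + x\<^sup>2" by (simp add: add_pos_nonneg)
    then show "0 < (real m)\<^sup>2 + x\<^sup>2" using le1[of x] by linarith
  qed
  show thesis
  \<comment> \<open>The quotient of the weights lies between 1 and a power of the bracket of m. The
    sign of q decides on which side the loss falls, hence only the product A1 * A2 is
    prescribed.\<close>
  proof (cases "q \<ge> 0")
    case True
    show thesis
    proof (rule that[of 1 "japanese_bracket (real m) powr \<bar>q\<bar>"])
      fix \<tau> :: int
      show "bracket \<tau> powr q \<le> 1 * elliptic_wt q m \<tau>"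
        unfolding japanese_bracket_powr elliptic_wt_def mult_1 using True le1 pos
        by (intro powr_mono2) (auto intro: less_imp_le)
      have "((real m)\<^sup>2 + (of_int \<tau>)\<^sup>2) powr (q/2) \<le> ((1 + (real m)\<^sup>2) * (1 + (of_int \<tau>)\<^sup>2)) powr (q/2)"
        using True le2 pos by (intro powr_mono2) (auto intro: less_imp_le)
      then show "elliptic_wt q m \<tau> \<le> japanese_bracket (real m) powr \<bar>q\<bar> * bracket \<tau> powr q"
        using True by (simp add: japanese_bracket_powr elliptic_wt_def powr_mult)
    qed auto
  next
    case False
    show thesis
    proof (rule that[of "japanese_bracket (real m) powr \<bar>q\<bar>" 1])
      fix \<tau> :: int
      show "elliptic_wt q m \<tau> \<le> 1 * bracket \<tau> powr q"
        unfolding japanese_bracket_powr elliptic_wt_def mult_1 using False le1 pos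
        by (intro powr_mono2') auto
      have "((1 + (real m)\<^sup>2) * (1 + (of_int \<tau>)\<^sup>2)) powr (q/2) \<le> ((real m)\<^sup>2 + (of_int \<tau>)\<^sup>2) powr (q/2)"
        using False le2 pos by (intro powr_mono2') auto
      then have "(1 + (real m)\<^sup>2) powr (q/2) * (1 + (of_int \<tau>)\<^sup>2) powr (q/2) \<le> ((real m)\<^sup>2 + (of_int \<tau>)\<^sup>2) powr (q/2)"
        by (simp add: powr_mult)
      then have "(1 + (real m)\<^sup>2) powr (- q/2) * ((1 + (real m)\<^sup>2) powr (q/2) * (1 + (of_int \<tau>)\<^sup>2) powr (q/2))
          \<le> (1 + (real m)\<^sup>2) powr (- q/2) * ((real m)\<^sup>2 + (of_int \<tau>)\<^sup>2) powr (q/2)"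
        by (rule mult_left_mono) simp
      moreover have "(1 + (real m)\<^sup>2) powr (- q/2) * (1 + (real m)\<^sup>2) powr (q/2) = 1"
        using pos(1)[of "real m"] by (simp flip: powr_add)
      ultimately show "bracket \<tau> powr q \<le> japanese_bracket (real m) powr \<bar>q\<bar> * elliptic_wt q m \<tau>"
        using False by (simp add: japanese_bracket_powr elliptic_wt_def mult.assoc[symmetric])
    qed auto
  qed
qed

section \<open>The conjugated equation on one frequency slice\<close>

text \<open>
  For \<open>b = A'\<close> with mean zero, \<open>b\<close>, \<open>e\<close> and \<open>e'\<close> stand for the Fourier coefficients of \<open>b\<close>,
  \<open>exp (\<i> A)\<close> and \<open>exp (- \<i> A)\<close>; multiplication by \<open>exp (\<plusminus> \<i> m A)\<close> is the \<open>m\<close>-fold convolution.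
\<close>
locale gauge =
  fixes b e e' :: "int \<Rightarrow> complex"
  assumes rapid_b: "rapid b" and rapid_e: "rapid e" and rapid_e': "rapid e'"
    and conv_e_e': "conv e e' = delta_seq"
    and Dseq_e: "Dseq e = (\<lambda>n. \<i> * conv b e n)"
    and Dseq_e': "Dseq e' = (\<lambda>n. - \<i> * conv b e' n)"
    and contraction_e: "\<And>u B. tempered u \<Longrightarrow> l2_bounded (\<lambda>n. cmod (u n)) B \<Longrightarrow> l2_bounded (\<lambda>n. cmod (conv e u n)) B"
    and contraction_e': "\<And>u B. tempered u \<Longrightarrow> l2_bounded (\<lambda>n. cmod (u n)) B \<Longrightarrow> l2_bounded (\<lambda>n. cmod (conv e' u n)) B"
begin

text \<open>This replaces A by - A. It supplies the inverse conjugation in the opposite order and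
  the frequencies of opposite sign.\<close>

lemma gauge_swap: "gauge (\<lambda>n. - b n) e' e"
proof
  have neg: "conv (\<lambda>n. - b n) u = (\<lambda>n. - conv b u n)" for u
    using conv_cmult_left[of "- 1" b u] by simp
  show "rapid (\<lambda>n. - b n)" using rapid_cmult[OF rapid_b, of "-1"] by simp
  show "Dseq e' = (\<lambda>n. \<i> * conv (\<lambda>n. - b n) e' n)" by (simp add: neg Dseq_e')
  show "Dseq e = (\<lambda>n. - \<i> * conv (\<lambda>n. - b n) e n)" by (simp add: neg Dseq_e)
  show "conv e' e = delta_seq" using conv_e_e' by (simp add: conv_commute)
qed (fact rapid_e rapid_e' contraction_e contraction_e')+

lemma tempered_conv_power: "tempered u \<Longrightarrow> tempered ((conv e ^^ m) u)"
  by (induction m) (auto intro: tempered_conv rapid_e)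

lemma tempered_conv_power': "tempered u \<Longrightarrow> tempered ((conv e' ^^ m) u)"
  by (induction m) (auto intro: tempered_conv rapid_e')

lemma conv_power_inverse:
  assumes "tempered u" shows "(conv e ^^ m) ((conv e' ^^ m) u) = u"
  using assms
proof (induction m)
  case (Suc m)
  let ?v = "(conv e' ^^ m) u"
  have "(conv e ^^ Suc m) ((conv e' ^^ Suc m) u) = (conv e ^^ m) (conv e (conv e' ?v))"
    by (simp add: funpow_swap1)
  also have "conv e (conv e' ?v) = ?v"
    using conv_assoc[OF rapid_e rapid_e' tempered_conv_power'[OF Suc.prems]]
    by (simp add: conv_e_e' conv_delta)
  finally show ?case using Suc by simp
qed simp

lemma conv_power_linear:
  assumes "tempered u" "tempered v"
  shows "(conv e ^^ m) (\<lambda>n. u n + c * v n) = (\<lambda>n. (conv e ^^ m) u n + c * (conv e ^^ m) v n)"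
proof (induction m)
  case (Suc m)
  have "(conv e ^^ Suc m) (\<lambda>n. u n + c * v n) = conv e (\<lambda>n. (conv e ^^ m) u n + c * (conv e ^^ m) v n)"
    using Suc by simp
  also have "\<dots> = (\<lambda>n. conv e ((conv e ^^ m) u) n + conv e (\<lambda>n. c * (conv e ^^ m) v n) n)"
    by (intro conv_add_right tempered_conv_power tempered_cmult rapid_e assms)
  finally show ?case by (simp add: conv_cmult_right)
qed simp

lemma Dseq_conv_e:
  assumes "tempered u"
  shows "Dseq (conv e u) = (\<lambda>n. \<i> * conv b (conv e u) n + conv e (Dseq u) n)"
  by (subst Dseq_conv[OF rapid_e assms])
    (simp add: Dseq_e conv_cmult_left conv_assoc[OF rapid_b rapid_e assms])

text \<open>The product rule for exp (\<i> m A) u, with b the derivative of A. The induction uses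
  that the convolutions with \<open>b\<close> and \<open>e\<close> commute.\<close>

lemma Dseq_conv_power:
  assumes "tempered u"
  shows "Dseq ((conv e ^^ m) u) = (\<lambda>n. (conv e ^^ m) (Dseq u) n + \<i> * of_nat m * conv b ((conv e ^^ m) u) n)"
proof (induction m)
  case (Suc m)
  let ?v = "(conv e ^^ m) u"
  have v: "tempered ?v" by (intro tempered_conv_power assms)
  have Dv: "tempered ((conv e ^^ m) (Dseq u))" by (intro tempered_conv_power tempered_Dseq assms)
  have "conv e (Dseq ?v) = (\<lambda>n. conv e ((conv e ^^ m) (Dseq u)) n + \<i> * of_nat m * conv e (conv b ?v) n)"
    unfolding Suc
    by (subst conv_add_right) (auto intro: rapid_e Dv tempered_cmult tempered_conv rapid_b v simp: conv_cmult_right)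
  moreover have "conv e (conv b ?v) = conv b (conv e ?v)"
    by (rule conv_left_commute[OF rapid_e rapid_b v])
  ultimately show ?case
    using Dseq_conv_e[OF v] by (simp add: algebra_simps)
qed simp

text \<open>With u = exp (\<i> m A) v the equation for v has the constant coefficient \<beta> and
  right-hand side exp (- \<i> m A) f, so it is diagonal in \<tau>. Nonresonance determines v, hence
  the formula contains uniqueness among tempered solutions.\<close>

lemma solution_formula:
  assumes u: "tempered u" and f: "tempered f" and eq: "\<And>\<tau>. \<i> * of_int \<tau> * u \<tau> - \<i> * of_nat m * (of_real \<beta> * u \<tau> + conv b u \<tau>) = f \<tau>"
    and nonres: "\<And>\<tau>. real_of_int \<tau> \<noteq> real m * \<beta>"
  shows "u = (conv e ^^ m) (\<lambda>\<tau>. (conv e' ^^ m) f \<tau> / (\<i> * of_real (real_of_int \<tau> - real m * \<beta>)))"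
proof -
  \<comment> \<open>The swapped instance shows that \<open>conv e' ^^ m\<close> undoes
    \<open>conv e ^^ m\<close>; the unswapped \<open>conv_power_inverse\<close> gives the other
    order.\<close>
  interpret swap: gauge "\<lambda>n. - b n" e' e by (rule gauge_swap)
  define v where "v = (conv e' ^^ m) u"
  have v: "tempered v" unfolding v_def by (intro tempered_conv_power' u)
  have uv: "u = (conv e ^^ m) v" unfolding v_def by (rule conv_power_inverse[OF u, symmetric])
  have Dv: "tempered (Dseq v)" by (intro tempered_Dseq v)
  have "(conv e ^^ m) (\<lambda>n. Dseq v n + (- \<i> * of_nat m * of_real \<beta>) * v n) = f"
  proof
    fix \<tau>
    show "(conv e ^^ m) (\<lambda>n. Dseq v n + (- \<i> * of_nat m * of_real \<beta>) * v n) \<tau> = f \<tau>"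
      unfolding conv_power_linear[OF Dv v] uv[symmetric]
      using fun_cong[OF Dseq_conv_power[OF v, of m], of \<tau>] eq[of \<tau>]
      unfolding uv[symmetric] by (simp add: Dseq_def algebra_simps)
  qed
  moreover have "(conv e' ^^ m) ((conv e ^^ m) (\<lambda>n. Dseq v n + (- \<i> * of_nat m * of_real \<beta>) * v n)) =
      (\<lambda>n. Dseq v n + (- \<i> * of_nat m * of_real \<beta>) * v n)"
    by (intro swap.conv_power_inverse tempered_add Dv tempered_cmult v)
  ultimately have "(conv e' ^^ m) f \<tau> = \<i> * of_real (real_of_int \<tau> - real m * \<beta>) * v \<tau>" for \<tau>
    by (simp add: Dseq_def algebra_simps)
  moreover have "complex_of_real (real_of_int \<tau> - real m * \<beta>) \<noteq> 0" for \<tau>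
    using nonres[of \<tau>] by (metis of_real_eq_0_iff right_minus_eq)
  ultimately have "v = (\<lambda>\<tau>. (conv e' ^^ m) f \<tau> / (\<i> * of_real (real_of_int \<tau> - real m * \<beta>)))"
    by auto
  then show ?thesis using uv by simp
qed

text \<open>The computation of \<open>solution_formula\<close> run backwards. A lower bound on the
  divisors that is uniform in \<tau> keeps the quotient tempered.\<close>

lemma solution_exists:
  assumes f: "tempered f" and \<delta>: "\<delta> > 0" "\<And>\<tau>. \<bar>real_of_int \<tau> - real m * \<beta>\<bar> \<ge> \<delta>"
  obtains u where "tempered u" "\<And>\<tau>. \<i> * of_int \<tau> * u \<tau> - \<i> * of_nat m * (of_real \<beta> * u \<tau> + conv b u \<tau>) = f \<tau>"
proof -
  define v where "v = (\<lambda>\<tau>. (conv e' ^^ m) f \<tau> / (\<i> * of_real (real_of_int \<tau> - real m * \<beta>)))"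
  have nz: "real_of_int \<tau> - real m * \<beta> \<noteq> 0" for \<tau> using \<delta>(1) \<delta>(2)[of \<tau>] by auto
  have v: "tempered v"
  proof (rule tempered_mult[OF tempered_conv_power'[OF f, of m], where d=0 and D="1 / \<delta>"])
    show "cmod (v n) \<le> 1 / \<delta> * wt n ^ 0 * cmod ((conv e' ^^ m) f n)" for n
      unfolding v_def norm_divide norm_mult norm_of_real
      using \<delta> nz[of n] by (auto simp: frac_le)
  qed (use \<delta> in auto)
  have Dv: "tempered (Dseq v)" by (intro tempered_Dseq v)
  have "(\<lambda>n. Dseq v n + (- \<i> * of_nat m * of_real \<beta>) * v n) = (conv e' ^^ m) f"
  proof
    fix n
    have "Dseq v n + (- \<i> * of_nat m * of_real \<beta>) * v n = \<i> * of_real (real_of_int n - real m * \<beta>) * v n"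
      by (simp add: Dseq_def algebra_simps)
    moreover have "complex_of_real (real_of_int n - real m * \<beta>) \<noteq> 0"
      using nz[of n] by (metis of_real_eq_0_iff)
    ultimately show "Dseq v n + (- \<i> * of_nat m * of_real \<beta>) * v n = (conv e' ^^ m) f n"
      by (simp add: v_def)
  qed
  then have *: "(conv e ^^ m) (\<lambda>n. Dseq v n + (- \<i> * of_nat m * of_real \<beta>) * v n) = f"
    by (simp add: conv_power_inverse[OF f])
  show thesis
  proof (rule that[of "(conv e ^^ m) v"])
    show "tempered ((conv e ^^ m) v)" by (intro tempered_conv_power v)
    fix \<tau>
    show "\<i> * of_int \<tau> * (conv e ^^ m) v \<tau> - \<i> * of_nat m * (of_real \<beta> * (conv e ^^ m) v \<tau> + conv b ((conv e ^^ m) v) \<tau>) = f \<tau>"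
      using fun_cong[OF Dseq_conv_power[OF v, of m], of \<tau>] fun_cong[OF *[unfolded conv_power_linear[OF Dv v]], of \<tau>]
      by (simp add: Dseq_def algebra_simps)
  qed
qed

text \<open>Each factor has one source: \<langle>m\<rangle> to the power \<bar>q\<bar> comes from
  changing weights, 1 / \<delta> from the divisors, and \<langle>m\<rangle> to the power \<theta>
  from the extra regularity. The two conjugations contribute only the constants K and K', so C
  depends on neither m nor \<delta>.\<close>

lemma solution_estimate:
  fixes \<beta> q \<theta> :: real
  assumes \<theta>: "0 \<le> \<theta>" "\<theta> \<le> 1"
  shows "\<exists>C\<ge>1. \<forall>m>0. \<forall>\<delta> f u B. 0 < \<delta> \<longrightarrow> \<delta> \<le> 1 \<longrightarrow> (\<forall>\<tau>. \<bar>real_of_int \<tau> - real m * \<beta>\<bar> \<ge> \<delta>) \<longrightarrow>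
     tempered f \<longrightarrow> tempered u \<longrightarrow>
     (\<forall>\<tau>. \<i> * of_int \<tau> * u \<tau> - \<i> * of_nat m * (of_real \<beta> * u \<tau> + conv b u \<tau>) = f \<tau>) \<longrightarrow>
     sobolev_bounded q f B \<longrightarrow>
     sobolev_bounded (q + \<theta>) u
       (C * (japanese_bracket (real m) powr (\<bar>q\<bar> + \<theta>) / \<delta>) * B)"
proof -
  obtain K where K: "K \<ge> 1" "\<And>m u B. m > 0 \<Longrightarrow> tempered u \<Longrightarrow> elliptic_bounded q m u B \<Longrightarrow>
     elliptic_bounded q m ((conv e ^^ m) u) (K * B)"
    using l2_bounded_elliptic_conv_power[OF rapid_e contraction_e, of q] by blast
  obtain K' where K': "K' \<ge> 1" "\<And>m u B. m > 0 \<Longrightarrow> tempered u \<Longrightarrow> elliptic_bounded q m u B \<Longrightarrow>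
     elliptic_bounded q m ((conv e' ^^ m) u) (K' * B)"
    using l2_bounded_elliptic_conv_power[OF rapid_e' contraction_e', of q] by blast
  define Kb where "Kb = (\<Sum>\<^sub>\<infinity>\<sigma>. cmod (b \<sigma>) * wt \<sigma> ^ nat \<lceil>\<bar>q\<bar>\<rceil>)"
  have Kb: "Kb \<ge> 0" unfolding Kb_def by (rule infsum_nonneg) auto
  \<comment> \<open>In the last factor 2 + \<bar>\<beta>\<bar> bounds the terms in \<open>u\<close>,
    Kb the term in \<open>conv b u\<close>, and the remaining 1 the term in \<open>f\<close>,
    absorbed through B \<le> U'.\<close>
  define C where "C = K * K' * (3 + \<bar>\<beta>\<bar> + Kb)"
  have KK: "1 * 1 \<le> K * K'" using K(1) K'(1) by (intro mult_mono) auto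
  have C1: "1 * 1 \<le> C" unfolding C_def using KK Kb by (intro mult_mono) auto
  have main: "sobolev_bounded (q + \<theta>) u
       (C * (japanese_bracket (real m) powr (\<bar>q\<bar> + \<theta>) / \<delta>) * B)"
    if m: "m > 0" and \<delta>: "0 < \<delta>" "\<delta> \<le> 1" "\<And>\<tau>. \<bar>real_of_int \<tau> - real m * \<beta>\<bar> \<ge> \<delta>"
      and f: "tempered f" and u: "tempered u"
      and eq: "\<And>\<tau>. \<i> * of_int \<tau> * u \<tau> - \<i> * of_nat m * (of_real \<beta> * u \<tau> + conv b u \<tau>) = f \<tau>"
      and B: "sobolev_bounded q f B"
    for m \<delta> f u B
  proof -
    let ?J = "\<lambda>\<tau>. bracket \<tau> powr q"
    define M where "M = japanese_bracket (real m)"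
    have M: "M \<ge> 1" "M > 0" "real m \<le> M"
      using japanese_bracket_ge1[of "real m"] abs_le_japanese_bracket[of "real m"] by (auto simp: M_def)
    have B0: "B \<ge> 0" by (rule l2_bounded_nonneg[OF B])
    obtain A1 A2 where A: "A1 \<ge> 0" "A2 \<ge> 0" "A1 * A2 = M powr \<bar>q\<bar>"
      "\<And>\<tau>. ?J \<tau> \<le> A1 * elliptic_wt q m \<tau>" "\<And>\<tau>. elliptic_wt q m \<tau> \<le> A2 * ?J \<tau>"
      unfolding M_def using elliptic_wt_equiv[OF m] by blast
    have nz: "real_of_int \<tau> - real m * \<beta> \<noteq> 0" for \<tau> using \<delta>(1) \<delta>(3)[of \<tau>] by auto
    define v where "v = (\<lambda>\<tau>. (conv e' ^^ m) f \<tau> / (\<i> * of_real (real_of_int \<tau> - real m * \<beta>)))"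
    have v_le: "cmod (v n) \<le> 1 / \<delta> * cmod ((conv e' ^^ m) f n)" for n
      unfolding v_def norm_divide norm_mult norm_of_real
      using \<delta>(1) \<delta>(3)[of n] nz[of n] by (auto simp: frac_le)
    have v: "tempered v"
      by (rule tempered_mult[OF tempered_conv_power'[OF f, of m], where d=0 and D="1 / \<delta>"]) (use v_le \<delta> in auto)
    have uv: "u = (conv e ^^ m) v"
      unfolding v_def by (rule solution_formula[OF u f eq]) (use nz in auto)
    have "elliptic_bounded q m f (A2 * B)"
      by (rule l2_bounded_mono[OF l2_bounded_cmult[OF B A(2)]])
        (auto simp: mult.assoc[symmetric] intro!: mult_right_mono A)
    then have "elliptic_bounded q m ((conv e' ^^ m) f) (K' * (A2 * B))"
      by (rule K'(2)[OF m f])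
    then have "l2_bounded (\<lambda>\<tau>. 1 / \<delta> * (elliptic_wt q m \<tau> * cmod ((conv e' ^^ m) f \<tau>))) (1 / \<delta> * (K' * (A2 * B)))"
      by (rule l2_bounded_cmult) (use \<delta> in auto)
    then have "elliptic_bounded q m v (1 / \<delta> * (K' * (A2 * B)))"
    proof (rule l2_bounded_mono)
      show "elliptic_wt q m n * cmod (v n) \<le> 1 / \<delta> * (elliptic_wt q m n * cmod ((conv e' ^^ m) f n))" for n
        using mult_left_mono[OF v_le[of n] elliptic_wt_nonneg[of q m n]] by (simp add: mult_ac)
    qed auto
    then have "elliptic_bounded q m u (K * (1 / \<delta> * (K' * (A2 * B))))"
      unfolding uv by (rule K(2)[OF m v])
    then have "l2_bounded (\<lambda>\<tau>. A1 * (elliptic_wt q m \<tau> * cmod (u \<tau>))) (A1 * (K * (1 / \<delta> * (K' * (A2 * B)))))"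
      by (rule l2_bounded_cmult) (rule A)
    then have "l2_bounded (\<lambda>\<tau>. ?J \<tau> * cmod (u \<tau>)) (A1 * (K * (1 / \<delta> * (K' * (A2 * B)))))"
      by (rule l2_bounded_mono) (auto simp: mult.assoc[symmetric] intro!: mult_right_mono A)
    also have "A1 * (K * (1 / \<delta> * (K' * (A2 * B)))) = K * K' * (M powr \<bar>q\<bar> / \<delta>) * B"
      by (simp add: A(3)[symmetric] mult_ac)
    finally have U: "l2_bounded (\<lambda>\<tau>. ?J \<tau> * cmod (u \<tau>)) (K * K' * (M powr \<bar>q\<bar> / \<delta>) * B)" .
    define U' where "U' = K * K' * (M powr \<bar>q\<bar> / \<delta>) * B"
    \<comment> \<open>Since \<delta> \<le> 1, M \<ge> 1 and K * K' \<ge> 1, the bound on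
      \<open>f\<close> is dominated by the bound on \<open>u\<close>.\<close>
    have "1 * 1 * B \<le> K * K' * (M powr \<bar>q\<bar> / \<delta>) * B"
    proof (intro mult_right_mono mult_mono B0)
      have "1 \<le> M powr \<bar>q\<bar>" using M by (intro ge_one_powr_ge_zero) auto
      then show "1 \<le> M powr \<bar>q\<bar> / \<delta>" using \<delta> by (simp add: le_divide_eq)
    qed (use KK in auto)
    then have BU: "B \<le> U'" by (simp add: U'_def)
    have bu: "l2_bounded (\<lambda>\<tau>. ?J \<tau> * cmod (conv b u \<tau>)) (Kb * U')"
      unfolding Kb_def U'_def
      by (rule l2_bounded_weighted_conv[OF rapid_b u U _ japanese_bracket_peetre]) auto
    let ?R = "\<lambda>\<tau>. M powr \<theta> * ((2 + \<bar>\<beta>\<bar>) * (?J \<tau> * cmod (u \<tau>)) + (?J \<tau> * cmod (f \<tau>) + ?J \<tau> * cmod (conv b u \<tau>)))"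
    have "l2_bounded ?R (M powr \<theta> * ((2 + \<bar>\<beta>\<bar>) * U' + (B + Kb * U')))"
      by (intro l2_bounded_cmult l2_bounded_add U[folded U'_def] B bu) auto
    then show ?thesis
    proof (rule l2_bounded_mono)
      fix \<tau> :: int
      define j where "j = bracket \<tau>"
      have j: "j \<ge> 1" using japanese_bracket_ge1 by (simp add: j_def)
      \<comment> \<open>The equation is solved for the derivative; the zeroth-order coefficient
        carries a factor m.\<close>
      have tu: "\<bar>of_int \<tau>\<bar> * cmod (u \<tau>) \<le> cmod (f \<tau>) + real m * (\<bar>\<beta>\<bar> * cmod (u \<tau>) + cmod (conv b u \<tau>))"
      proof -
        have "\<i> * of_int \<tau> * u \<tau> = f \<tau> + \<i> * of_nat m * (of_real \<beta> * u \<tau> + conv b u \<tau>)"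
          using eq[of \<tau>] by (simp add: algebra_simps)
        then have "cmod (\<i> * of_int \<tau> * u \<tau>) \<le> cmod (f \<tau>) + cmod (\<i> * of_nat m * (of_real \<beta> * u \<tau> + conv b u \<tau>))"
          by (metis norm_triangle_ineq)
        also have "cmod (\<i> * of_nat m * (of_real \<beta> * u \<tau> + conv b u \<tau>)) \<le> real m * (\<bar>\<beta>\<bar> * cmod (u \<tau>) + cmod (conv b u \<tau>))"
          unfolding norm_mult using norm_triangle_ineq[of "of_real \<beta> * u \<tau>" "conv b u \<tau>"]
          by (simp add: norm_mult mult_left_mono)
        finally show ?thesis by (simp add: norm_mult)
      qed
      \<comment> \<open>Dividing by M \<ge> m removes the factor m, so one power of
        \<langle>\<tau>\<rangle> is exchanged for one of \<langle>m\<rangle>.\<close>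
      have "j / M * cmod (u \<tau>) \<le> (cmod (u \<tau>) + \<bar>of_int \<tau>\<bar> * cmod (u \<tau>)) / M"
        using mult_right_mono[OF japanese_bracket_le[of "of_int \<tau>"], of "cmod (u \<tau>)"] M
        by (simp add: j_def divide_right_mono algebra_simps)
      also have "\<dots> \<le> (cmod (u \<tau>) + (cmod (f \<tau>) + real m * (\<bar>\<beta>\<bar> * cmod (u \<tau>) + cmod (conv b u \<tau>)))) / M"
        using tu M by (intro divide_right_mono add_left_mono) auto
      also have "\<dots> = (cmod (u \<tau>) + cmod (f \<tau>)) / M + real m / M * (\<bar>\<beta>\<bar> * cmod (u \<tau>) + cmod (conv b u \<tau>))"
        by (simp add: add_divide_distrib)
      also have "\<dots> \<le> (cmod (u \<tau>) + cmod (f \<tau>)) / 1 + 1 * (\<bar>\<beta>\<bar> * cmod (u \<tau>) + cmod (conv b u \<tau>))"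
        using M by (intro add_mono divide_left_mono mult_right_mono) auto
      finally have jM: "(1 + j / M) * cmod (u \<tau>) \<le> (2 + \<bar>\<beta>\<bar>) * cmod (u \<tau>) + (cmod (f \<tau>) + cmod (conv b u \<tau>))"
        by (simp add: algebra_simps)
      \<comment> \<open>Pointwise interpolation between the cases \<theta> = 0 and \<theta> =
        1.\<close>
      have "(j / M) powr \<theta> \<le> 1 + j / M"
      proof (cases "j / M \<le> 1")
        case True
        have "(j / M) powr \<theta> \<le> 1 powr \<theta>" using True j M \<theta> by (intro powr_mono2) auto
        moreover have "0 \<le> j / M" using j M by simp
        ultimately show ?thesis by simp
      next
        case False
        have "(j / M) powr \<theta> \<le> (j / M) powr 1" using False \<theta> by (intro powr_mono) auto
        then show ?thesis using False j M by simp
      qed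
      moreover have "j powr \<theta> = M powr \<theta> * (j / M) powr \<theta>" using j M by (simp add: powr_divide)
      ultimately have "j powr \<theta> \<le> M powr \<theta> * (1 + j / M)" by (simp add: mult_left_mono)
      then have "j powr \<theta> * cmod (u \<tau>) \<le> M powr \<theta> * (1 + j / M) * cmod (u \<tau>)" by (rule mult_right_mono) simp
      also have "\<dots> \<le> M powr \<theta> * ((2 + \<bar>\<beta>\<bar>) * cmod (u \<tau>) + (cmod (f \<tau>) + cmod (conv b u \<tau>)))"
        unfolding mult.assoc by (intro mult_left_mono jM) auto
      finally have "j powr q * (j powr \<theta> * cmod (u \<tau>)) \<le>
          j powr q * (M powr \<theta> * ((2 + \<bar>\<beta>\<bar>) * cmod (u \<tau>) + (cmod (f \<tau>) + cmod (conv b u \<tau>))))"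
        by (rule mult_left_mono) simp
      then show "bracket \<tau> powr (q + \<theta>) * cmod (u \<tau>) \<le> ?R \<tau>"
        by (simp add: j_def powr_add algebra_simps)
    next
      have "(2 + \<bar>\<beta>\<bar>) * U' + (B + Kb * U') \<le> (3 + \<bar>\<beta>\<bar> + Kb) * U'"
        using BU by (simp add: algebra_simps)
      then have "M powr \<theta> * ((2 + \<bar>\<beta>\<bar>) * U' + (B + Kb * U')) \<le> M powr \<theta> * ((3 + \<bar>\<beta>\<bar> + Kb) * U')"
        by (rule mult_left_mono) simp
      also have "\<dots> = C * (M powr (\<bar>q\<bar> + \<theta>) / \<delta>) * B"
        by (simp add: C_def U'_def powr_add mult_ac)
      finally show "M powr \<theta> * ((2 + \<bar>\<beta>\<bar>) * U' + (B + Kb * U')) \<le> C * (japanese_bracket (real m) powr (\<bar>q\<bar> + \<theta>) / \<delta>) * B"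
        by (simp add: M_def)
    qed auto
  qed
  show ?thesis
    by (intro exI[of _ C] conjI allI impI) (use C1 main in auto)
qed

end

section \<open>Fourier series on the circle\<close>

definition circle_avg :: "(real \<Rightarrow> complex) \<Rightarrow> complex" where
  "circle_avg h = integral {0..2*pi} h / of_real (2 * pi)"

definition character :: "int \<Rightarrow> real \<Rightarrow> complex" where
  "character n t = cis (of_int n * t)"

definition fc :: "(real \<Rightarrow> complex) \<Rightarrow> int \<Rightarrow> complex" where
  "fc g n = circle_avg (\<lambda>t. g t * character (- n) t)"

lemma character_add: "character (m + n) t = character m t * character n t"
  by (simp add: character_def cis_mult algebra_simps)

lemma character_0 [simp]: "character 0 t = 1"
  by (simp add: character_def)

lemma cnj_character: "cnj (character n t) = character (- n) t"
  by (simp add: character_def cis_cnj)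

lemma norm_character [simp]: "cmod (character n t) = 1"
  by (simp add: character_def)

lemma character_periodic [simp]: "character n (t + 2 * pi) = character n t"
proof -
  have "character n (t + 2 * pi) = cis (of_int n * t) * cis (2 * pi * of_int n)"
    unfolding cis_mult by (simp add: character_def algebra_simps)
  then show ?thesis by (simp add: character_def)
qed

lemma continuous_on_character [continuous_intros]: "continuous_on S (character n)"
  unfolding character_def by (intro continuous_intros)

lemma character_has_vector_derivative:
  "(character n has_vector_derivative \<i> * of_int n * character n t) (at t within S)"
  unfolding character_def has_vector_derivative_def
  by (auto intro!: derivative_eq_intros simp: scaleR_conv_of_real algebra_simps)

lemma circle_integrable:
  fixes g :: "real \<Rightarrow> complex"
  assumes "continuous_on UNIV g" shows "g integrable_on {a..b}"
  by (rule integrable_continuous_interval[OF continuous_on_subset[OF assms]]) simp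

lemma circle_avg_add:
  "continuous_on UNIV g \<Longrightarrow> continuous_on UNIV h \<Longrightarrow> circle_avg (\<lambda>t. g t + h t) = circle_avg g + circle_avg h"
  by (simp add: circle_avg_def integral_add circle_integrable add_divide_distrib)

lemma circle_avg_diff:
  "continuous_on UNIV g \<Longrightarrow> continuous_on UNIV h \<Longrightarrow> circle_avg (\<lambda>t. g t - h t) = circle_avg g - circle_avg h"
  by (simp add: circle_avg_def integral_diff circle_integrable diff_divide_distrib)

lemma circle_avg_cmult: "circle_avg (\<lambda>t. c * g t) = c * circle_avg g"
  by (simp add: circle_avg_def)

lemma circle_avg_sum:
  "finite F \<Longrightarrow> (\<And>i. i \<in> F \<Longrightarrow> continuous_on UNIV (g i)) \<Longrightarrow> circle_avg (\<lambda>t. \<Sum>i\<in>F. g i t) = (\<Sum>i\<in>F. circle_avg (g i))"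
  by (simp add: circle_avg_def integral_sum circle_integrable sum_divide_distrib)

lemma circle_avg_cnj: "circle_avg (\<lambda>t. cnj (g t)) = cnj (circle_avg g)"
  by (simp add: circle_avg_def integral_cnj)

lemma circle_avg_const [simp]: "circle_avg (\<lambda>t. c) = c"
  by (simp add: circle_avg_def content_real scaleR_conv_of_real)

lemma norm_circle_avg_le:
  assumes "continuous_on UNIV g" "\<And>t. cmod (g t) \<le> B"
  shows "cmod (circle_avg g) \<le> B"
proof -
  have "cmod (integral {0..2*pi} g) \<le> B * (2 * pi - 0)"
    by (intro integral_bound continuous_on_subset[OF assms(1)] assms(2)) auto
  then show ?thesis by (simp add: circle_avg_def norm_divide field_simps)
qed

lemma circle_avg_derivative:
  assumes "\<And>t. (g has_vector_derivative g' t) (at t)" "g (2 * pi) = g 0"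
  shows "circle_avg g' = 0"
proof -
  have "(g' has_integral (g (2 * pi) - g 0)) {0..2*pi}"
    using assms by (intro fundamental_theorem_of_calculus) (auto intro: has_vector_derivative_at_within)
  then show ?thesis using assms(2) by (simp add: circle_avg_def integral_unique)
qed

lemma circle_avg_character: "circle_avg (character n) = (if n = 0 then 1 else 0)"
proof (cases "n = 0")
  case True
  then have "character n = (\<lambda>t. 1)" by auto
  then show ?thesis using True by simp
next
  case False
  have "circle_avg (\<lambda>t. \<i> * of_int n * character n t) = 0"
    by (rule circle_avg_derivative[OF character_has_vector_derivative])
      (use character_periodic[of n 0] in simp)
  then show ?thesis using False by (simp add: circle_avg_cmult)
qed

lemma fc_add:
  "continuous_on UNIV g \<Longrightarrow> continuous_on UNIV h \<Longrightarrow> fc (\<lambda>t. g t + h t) n = fc g n + fc h n"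
  unfolding fc_def distrib_right by (intro circle_avg_add continuous_intros)

lemma fc_diff:
  "continuous_on UNIV g \<Longrightarrow> continuous_on UNIV h \<Longrightarrow> fc (\<lambda>t. g t - h t) n = fc g n - fc h n"
  unfolding fc_def left_diff_distrib by (intro circle_avg_diff continuous_intros)

lemma fc_cmult: "fc (\<lambda>t. c * g t) n = c * fc g n"
  by (simp add: fc_def mult.assoc circle_avg_cmult)

lemma fc_sum:
  "finite F \<Longrightarrow> (\<And>i. i \<in> F \<Longrightarrow> continuous_on UNIV (g i)) \<Longrightarrow> fc (\<lambda>t. \<Sum>i\<in>F. g i t) n = (\<Sum>i\<in>F. fc (g i) n)"
  unfolding fc_def sum_distrib_right by (intro circle_avg_sum continuous_intros)

lemma fc_character_mult: "fc (\<lambda>t. character k t * g t) n = fc g (n - k)"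
proof -
  have "character (- (n - k)) t = character k t * character (- n) t" for t
    using character_add[of k "- n" t] by simp
  then show ?thesis by (simp add: fc_def mult_ac del: minus_diff_eq)
qed

lemma fc_1: "fc (\<lambda>t. 1) n = delta_seq n"
  by (simp add: fc_def circle_avg_character delta_seq_def)

lemma fc_character: "fc (character k) n = (if n = k then 1 else 0)"
  using fc_character_mult[of k "\<lambda>_. 1" n] by (auto simp: fc_1 delta_seq_def)

lemma norm_fc_le:
  assumes "continuous_on UNIV g" "\<And>t. cmod (g t) \<le> B"
  shows "cmod (fc g n) \<le> B"
  unfolding fc_def by (rule norm_circle_avg_le) (auto intro!: continuous_intros assms simp: norm_mult)

text \<open>Integration by parts: the derivative of the product with a character has mean zero by
  periodicity.\<close>

lemma fc_derivative:
  assumes "\<And>t. (g has_vector_derivative g' t) (at t)" "continuous_on UNIV g'" "g (2 * pi) = g 0"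
  shows "fc g' n = \<i> * of_int n * fc g n"
proof -
  have cg: "continuous_on UNIV g"
    using assms(1) by (auto intro!: continuous_on_vector_derivative)
  have d: "((\<lambda>t. g t * character (- n) t) has_vector_derivative
      (g' t * character (- n) t - \<i> * of_int n * (g t * character (- n) t))) (at t)" for t
    using has_vector_derivative_mult[OF assms(1)[of t] character_has_vector_derivative[of "- n" t UNIV]]
    by (simp add: algebra_simps)
  have "circle_avg (\<lambda>t. g' t * character (- n) t - \<i> * of_int n * (g t * character (- n) t)) = 0"
    by (rule circle_avg_derivative[OF d])
      (use assms(3) character_periodic[of "- n" 0] in simp)
  then show ?thesis
    by (subst (asm) circle_avg_diff)
      (auto intro!: continuous_intros assms cg simp: circle_avg_cmult fc_def)
qed

lemma circle_avg_mult_trig_poly: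
  assumes "finite F" "continuous_on UNIV g"
  shows "circle_avg (\<lambda>t. g t * cnj (\<Sum>n\<in>F. c n * character n t)) = (\<Sum>n\<in>F. cnj (c n) * fc g n)"
proof -
  have "circle_avg (\<lambda>t. g t * cnj (\<Sum>n\<in>F. c n * character n t)) =
      circle_avg (\<lambda>t. \<Sum>n\<in>F. cnj (c n) * (g t * character (- n) t))"
    by (simp add: sum_distrib_left cnj_sum cnj_character mult_ac)
  also have "\<dots> = (\<Sum>n\<in>F. cnj (c n) * fc g n)"
    using assms by (subst circle_avg_sum) (auto intro!: continuous_intros simp: circle_avg_cmult fc_def)
  finally show ?thesis .
qed

lemma continuous_on_trig_poly: "continuous_on S (\<lambda>t. \<Sum>n\<in>F. c n * character n t)"
  by (intro continuous_intros)

lemma fc_trig_poly: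
  assumes "finite F"
  shows "fc (\<lambda>t. \<Sum>n\<in>F. c n * character n t) k = (if k \<in> F then c k else 0)"
  using assms
  by (subst fc_sum) (auto intro!: continuous_intros simp: fc_cmult fc_character if_distrib cong: if_cong)

text \<open>The squared norm is kept as the real part of a complex mean, so that expanding products
  uses only the linearity of \<open>circle_avg\<close>.\<close>

definition circle_norm2 :: "(real \<Rightarrow> complex) \<Rightarrow> real" where
  "circle_norm2 g = Re (circle_avg (\<lambda>t. g t * cnj (g t)))"

lemma circle_norm2_nonneg:
  assumes "continuous_on UNIV g" shows "circle_norm2 g \<ge> 0"
proof -
  have "integral {0..2*pi} (\<lambda>t. g t * cnj (g t)) = of_real (integral {0..2*pi} (\<lambda>t. (cmod (g t))\<^sup>2))"
    unfolding complex_norm_square[symmetric]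
    by (intro integral_unique has_integral_of_real integrable_integral integrable_continuous_interval
        continuous_intros continuous_on_subset[OF assms]) auto
  moreover have "integral {0..2*pi} (\<lambda>t. (cmod (g t))\<^sup>2) \<ge> 0"
    by (intro integral_nonneg integrable_continuous_interval continuous_intros continuous_on_subset[OF assms]) auto
  ultimately show ?thesis
    unfolding circle_norm2_def circle_avg_def of_real_divide[symmetric] by simp
qed

lemma circle_norm2_trig_poly:
  assumes "finite F"
  shows "circle_norm2 (\<lambda>t. \<Sum>n\<in>F. c n * character n t) = (\<Sum>n\<in>F. (cmod (c n))\<^sup>2)"
proof -
  have "circle_avg (\<lambda>t. (\<Sum>n\<in>F. c n * character n t) * cnj (\<Sum>n\<in>F. c n * character n t)) =
     (\<Sum>n\<in>F. cnj (c n) * (if n \<in> F then c n else 0))"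
    by (subst circle_avg_mult_trig_poly[OF assms continuous_on_trig_poly]) (simp add: fc_trig_poly assms)
  also have "\<dots> = of_real (\<Sum>n\<in>F. (cmod (c n))\<^sup>2)"
    unfolding of_real_sum by (intro sum.cong) (auto simp: complex_norm_square[symmetric] mult.commute)
  finally show ?thesis by (simp add: circle_norm2_def)
qed

text \<open>Expand the nonnegative squared norm of g - p for the partial sum p: both mixed means and
  the squared norm of p are equal to S.\<close>

lemma bessel_inequality:
  assumes F: "finite F" and g: "continuous_on UNIV g"
  shows "(\<Sum>n\<in>F. (cmod (fc g n))\<^sup>2) \<le> circle_norm2 g"
proof -
  define p where "p = (\<lambda>t. \<Sum>n\<in>F. fc g n * character n t)"
  have p: "continuous_on UNIV p" unfolding p_def by (rule continuous_on_trig_poly)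
  define S where "S = (\<Sum>n\<in>F. (cmod (fc g n))\<^sup>2)"
  have gp: "circle_avg (\<lambda>t. g t * cnj (p t)) = of_real S"
    unfolding p_def S_def by (subst circle_avg_mult_trig_poly[OF F g])
      (simp add: complex_norm_square[symmetric] mult.commute)
  have pg: "circle_avg (\<lambda>t. p t * cnj (g t)) = of_real S"
    using circle_avg_cnj[of "\<lambda>t. g t * cnj (p t)"] gp by (simp add: mult.commute)
  have pp: "circle_norm2 p = S" unfolding p_def S_def by (rule circle_norm2_trig_poly[OF F])
  have "circle_avg (\<lambda>t. (g t - p t) * cnj (g t - p t)) =
      circle_avg (\<lambda>t. (g t * cnj (g t) - g t * cnj (p t)) - (p t * cnj (g t) - p t * cnj (p t)))"
    by (simp add: algebra_simps)
  also have "\<dots> = (circle_avg (\<lambda>t. g t * cnj (g t)) - of_real S) - (of_real S - circle_avg (\<lambda>t. p t * cnj (p t)))"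
    by (simp add: circle_avg_diff continuous_intros g p gp pg)
  finally have "circle_norm2 (\<lambda>t. g t - p t) = circle_norm2 g - S"
    using pp by (simp add: circle_norm2_def)
  then show ?thesis using circle_norm2_nonneg[of "\<lambda>t. g t - p t"] g p
    by (simp add: S_def continuous_on_diff)
qed

text \<open>For a trigonometric polynomial p the modulus of p g is that of p, so Bessel's inequality
  bounds the coefficients of p g by those of p. Truncations of \<open>u\<close> are of this kind,
  and the limit is taken coordinatewise. The constant 1 survives, as iteration requires.\<close>

lemma unimodular_conv_contraction:
  assumes g: "continuous_on UNIV g" "\<And>t. cmod (g t) = 1" "rapid (fc g)"
    and u: "tempered u" "l2_bounded (\<lambda>n. cmod (u n)) B"
  shows "l2_bounded (\<lambda>n. cmod (conv (fc g) u n)) B"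
proof (rule l2_bounded_tendsto)
  have B0: "B \<ge> 0" by (rule l2_bounded_nonneg[OF u(2)])
  show "((\<lambda>G. cmod (\<Sum>\<sigma>\<in>G. u \<sigma> * fc g (\<tau> - \<sigma>))) \<longlongrightarrow> cmod (conv (fc g) u \<tau>)) (finite_subsets_at_top UNIV)" for \<tau>
  proof -
    have "conv (fc g) u \<tau> = (\<Sum>\<^sub>\<infinity>\<sigma>. u \<sigma> * fc g (\<tau> - \<sigma>))"
      by (subst conv_commute) (simp add: conv_def)
    moreover have "(\<lambda>\<sigma>. u \<sigma> * fc g (\<tau> - \<sigma>)) summable_on UNIV"
      using conv_summable[OF g(3) u(1), of \<tau>]
      by (subst summable_on_reindex_bij_witness[of UNIV "\<lambda>\<sigma>. \<tau> - \<sigma>" "\<lambda>\<sigma>. \<tau> - \<sigma>" UNIV "\<lambda>\<sigma>. fc g \<sigma> * u (\<tau> - \<sigma>)"]) (auto simp: mult.commute)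
    ultimately show ?thesis by (auto intro!: tendsto_norm infsum_tendsto)
  qed
  have "l2_bounded (\<lambda>\<tau>. cmod (\<Sum>\<sigma>\<in>G. u \<sigma> * fc g (\<tau> - \<sigma>))) B" if G: "finite G" for G
    unfolding l2_bounded_iff_sum[OF B0]
  proof (intro allI impI)
    fix F :: "int set" assume F: "finite F"
    define p where "p = (\<lambda>t. \<Sum>\<sigma>\<in>G. u \<sigma> * character \<sigma> t)"
    have p: "continuous_on UNIV p" unfolding p_def by (rule continuous_on_trig_poly)
    have "fc (\<lambda>t. p t * g t) \<tau> = (\<Sum>\<sigma>\<in>G. u \<sigma> * fc g (\<tau> - \<sigma>))" for \<tau>
    proof -
      have "fc (\<lambda>t. p t * g t) \<tau> = fc (\<lambda>t. \<Sum>\<sigma>\<in>G. u \<sigma> * (character \<sigma> t * g t)) \<tau>"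
        by (simp add: p_def sum_distrib_right mult.assoc)
      also have "\<dots> = (\<Sum>\<sigma>\<in>G. fc (\<lambda>t. u \<sigma> * (character \<sigma> t * g t)) \<tau>)"
        by (intro fc_sum G continuous_intros g)
      finally show ?thesis by (simp add: fc_cmult fc_character_mult)
    qed
    then have "(\<Sum>\<tau>\<in>F. (cmod (\<Sum>\<sigma>\<in>G. u \<sigma> * fc g (\<tau> - \<sigma>)))\<^sup>2) \<le> circle_norm2 (\<lambda>t. p t * g t)"
      using bessel_inequality[OF F, of "\<lambda>t. p t * g t"] p g by (simp add: continuous_on_mult)
    also have "circle_norm2 (\<lambda>t. p t * g t) = circle_norm2 p"
    proof -
      have eq: "p t * g t * cnj (p t * g t) = p t * cnj (p t)" for t
        using g(2)[of t] complex_norm_square[of "g t"] by (simp add: algebra_simps)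
      show ?thesis by (simp only: circle_norm2_def eq)
    qed
    also have "\<dots> = (\<Sum>\<sigma>\<in>G. (cmod (u \<sigma>))\<^sup>2)"
      unfolding p_def by (rule circle_norm2_trig_poly[OF G])
    also have "\<dots> \<le> B\<^sup>2"
      using u(2) G by (simp add: l2_bounded_iff_sum[OF B0])
    finally show "(\<Sum>\<tau>\<in>F. (cmod (\<Sum>\<sigma>\<in>G. u \<sigma> * fc g (\<tau> - \<sigma>)))\<^sup>2) \<le> B\<^sup>2" .
  qed
  then show "\<forall>\<^sub>F G in finite_subsets_at_top UNIV. l2_bounded (\<lambda>\<tau>. cmod (\<Sum>\<sigma>\<in>G. u \<sigma> * fc g (\<tau> - \<sigma>))) B"
    by (auto intro: eventually_finite_subsets_at_top_weakI)
qed simp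

text \<open>The absolutely convergent series of g converges uniformly after multiplication by the
  bounded h, so it can be integrated term by term, and each character shifts the index of the
  coefficients of h.\<close>

lemma fc_mult:
  assumes c: "(\<lambda>n. cmod (c n)) summable_on UNIV" and g: "\<And>t. g t = (\<Sum>\<^sub>\<infinity>n. c n * character n t)"
    and h: "continuous_on UNIV h" "\<And>t. cmod (h t) \<le> B"
  shows "fc (\<lambda>t. g t * h t) n = conv c (fc h) n"
proof -
  have unif: "uniform_limit {0..2*pi} (\<lambda>F t. \<Sum>k\<in>F. c k * (character k t * (h t * character (- n) t)))
      (\<lambda>t. \<Sum>\<^sub>\<infinity>k. c k * (character k t * (h t * character (- n) t))) (finite_subsets_at_top UNIV)"
  proof (rule Weierstrass_m_test_general)
    show "(\<lambda>k. cmod (c k) * B) summable_on UNIV" by (intro summable_on_cmult_left c)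
    show "cmod (c k * (character k t * (h t * character (- n) t))) \<le> cmod (c k) * B" for k t
      by (simp add: norm_mult mult_left_mono h)
  qed
  obtain I J where I: "\<And>F. ((\<lambda>t. \<Sum>k\<in>F. c k * (character k t * (h t * character (- n) t))) has_integral I F) {0..2*pi}"
    and J: "((\<lambda>t. \<Sum>\<^sub>\<infinity>k. c k * (character k t * (h t * character (- n) t))) has_integral J) {0..2*pi}"
    and lim: "(I \<longlongrightarrow> J) (finite_subsets_at_top UNIV)"
    by (rule uniform_limit_integral[OF unif]) (auto intro!: continuous_intros continuous_on_subset[OF h(1)])
  have "I F / of_real (2 * pi) = (\<Sum>k\<in>F. c k * fc h (n - k))" if F: "finite F" for F
  proof -
    have "I F / of_real (2 * pi) = circle_avg (\<lambda>t. \<Sum>k\<in>F. c k * (character k t * (h t * character (- n) t)))"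
      using I[of F] by (simp add: circle_avg_def integral_unique)
    also have "\<dots> = (\<Sum>k\<in>F. c k * fc h (n - k))"
      by (subst circle_avg_sum[OF F]) (auto intro!: continuous_intros h sum.cong
        simp: circle_avg_cmult fc_character_mult[symmetric] fc_def[of "\<lambda>t. character _ t * h t"] mult.assoc)
    finally show ?thesis .
  qed
  moreover have "((\<lambda>F. I F / of_real (2 * pi)) \<longlongrightarrow> J / of_real (2 * pi)) (finite_subsets_at_top UNIV)"
    by (intro tendsto_intros lim) auto
  ultimately have "((\<lambda>F. \<Sum>k\<in>F. c k * fc h (n - k)) \<longlongrightarrow> J / of_real (2 * pi)) (finite_subsets_at_top UNIV)"
    by (elim Lim_transform_eventually) (auto intro!: eventually_finite_subsets_at_top_weakI)
  then have "((\<lambda>k. c k * fc h (n - k)) has_sum J / of_real (2 * pi)) UNIV"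
    by (simp add: has_sum_def)
  moreover have "J / of_real (2 * pi) = fc (\<lambda>t. g t * h t) n"
  proof -
    have "(\<Sum>\<^sub>\<infinity>k. c k * (character k t * (h t * character (- n) t))) = g t * h t * character (- n) t" for t
      unfolding g mult.assoc[symmetric] infsum_cmult_left' ..
    then show ?thesis using J by (simp add: fc_def circle_avg_def integral_unique)
  qed
  ultimately show ?thesis by (simp add: conv_def infsumI)
qed

section \<open>Pointwise Fourier inversion on the circle\<close>

lemma has_vector_derivative_quotient:
  fixes f :: "real \<Rightarrow> complex"
  assumes "(f has_vector_derivative D) (at x)"
  shows "((\<lambda>y. (f y - f x) / of_real (y - x)) \<longlongrightarrow> D) (at x)"
proof -
  have "((\<lambda>y. norm ((f y - f x) - (y - x) *\<^sub>R D) / norm (y - x)) \<longlongrightarrow> 0) (at x)"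
    using assms by (simp add: has_vector_derivative_def has_derivative_iff_norm)
  moreover have "norm ((f y - f x) - (y - x) *\<^sub>R D) / norm (y - x) = norm ((f y - f x) / of_real (y - x) - D)"
    if "y \<noteq> x" for y
  proof -
    have "(f y - f x) / of_real (y - x) - D = ((f y - f x) - (y - x) *\<^sub>R D) / of_real (y - x)"
      using that by (simp add: scaleR_conv_of_real field_simps)
    then show ?thesis by (simp add: norm_divide del: of_real_diff)
  qed
  ultimately have "((\<lambda>y. norm ((f y - f x) / of_real (y - x) - D)) \<longlongrightarrow> 0) (at x)"
    by (elim Lim_transform_eventually) (auto simp: eventually_at_filter)
  then show ?thesis using tendsto_norm_zero_iff Lim_null by blast
qed

lemma periodic_int_multiple:
  fixes g :: "real \<Rightarrow> 'a"
  assumes "\<And>t. g (t + 2 * pi) = g t"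
  shows "g (t + 2 * pi * of_int k) = g t"
proof -
  have nat: "g (t + 2 * pi * real n) = g t" for t and n :: nat
  proof (induction n)
    case (Suc n)
    have "g (t + 2 * pi * real (Suc n)) = g ((t + 2 * pi * real n) + 2 * pi)" by (simp add: algebra_simps)
    then show ?case using assms Suc by simp
  qed simp
  show ?thesis
  proof (cases k rule: int_cases2)
    case (nonneg n) then show ?thesis using nat by simp
  next
    case (nonpos n)
    then show ?thesis using nat[of "t + 2 * pi * of_int k" n] by simp
  qed
qed

text \<open>The Riemann-Lebesgue lemma along an injective sequence: by Bessel's inequality the
  squares are summable.\<close>

lemma fc_tendsto_0:
  assumes g: "continuous_on UNIV g" and i: "inj i"
  shows "(\<lambda>N::nat. fc g (i N)) \<longlonglongrightarrow> 0"
proof -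
  have "summable (\<lambda>N. (cmod (fc g (i N)))\<^sup>2)"
  proof (rule summableI_nonneg_bounded)
    fix n
    have "(\<Sum>N<n. (cmod (fc g (i N)))\<^sup>2) = (\<Sum>m\<in>i ` {..<n}. (cmod (fc g m))\<^sup>2)"
      by (subst sum.reindex) (use i in \<open>auto intro: inj_on_subset\<close>)
    also have "\<dots> \<le> circle_norm2 g" by (intro bessel_inequality g) auto
    finally show "(\<Sum>N<n. (cmod (fc g (i N)))\<^sup>2) \<le> circle_norm2 g" .
  qed simp
  then have "(\<lambda>N. (cmod (fc g (i N)))\<^sup>2) \<longlonglongrightarrow> 0" by (rule summable_LIMSEQ_zero)
  then have "(\<lambda>N. sqrt ((cmod (fc g (i N)))\<^sup>2)) \<longlonglongrightarrow> sqrt 0" by (rule tendsto_real_sqrt)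
  then show ?thesis by (simp add: tendsto_norm_zero_iff)
qed

text \<open>
  Chernoff's argument: \<open>h = (g - g t0) / (character 1 - character 1 t0)\<close> is continuous, so the
  partial sums at \<open>t0\<close> telescope to \<open>g t0\<close> up to two Fourier coefficients of \<open>h\<close> of high order.
\<close>
lemma fourier_inversion:
  assumes g: "\<And>t. g (t + 2 * pi) = g t" and g': "\<And>t. (g has_vector_derivative g' t) (at t)"
    and cg': "continuous_on UNIV g'" and s: "(\<lambda>n. cmod (fc g n)) summable_on UNIV"
  shows "((\<lambda>n. fc g n * character n t0) has_sum g t0) UNIV"
proof -
  let ?\<chi> = "character 1"
  have cg: "continuous_on UNIV g"
    using g' by (auto intro!: continuous_on_vector_derivative)
  \<comment> \<open>Where the denominator vanishes, \<open>h\<close> takes the limit of the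
    difference quotient, which makes it continuous.\<close>
  define h where "h = (\<lambda>t. if ?\<chi> t = ?\<chi> t0 then g' t / (\<i> * ?\<chi> t) else (g t - g t0) / (?\<chi> t - ?\<chi> t0))"
  \<comment> \<open>Zeros of the denominator differ from t0 by a multiple of the period, so the
    numerator vanishes there as well.\<close>
  have same: "g t1 = g t0" if eq: "?\<chi> t1 = ?\<chi> t0" for t1
  proof -
    have "sin t1 = sin t0 \<and> cos t1 = cos t0" using eq by (simp add: character_def complex_eq_iff)
    then obtain k :: int where "t1 = t0 + 2 * pi * k" using sin_cos_eq_iff by auto
    then show ?thesis using periodic_int_multiple[of g t0 k, OF g] by simp
  qed
  have nz: "?\<chi> t \<noteq> 0" for t by (metis norm_character norm_zero zero_neq_one)
  have "isCont h t1" for t1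
  proof (cases "?\<chi> t1 = ?\<chi> t0")
    case True
    have q1: "((\<lambda>t. (g t - g t1) / of_real (t - t1)) \<longlongrightarrow> g' t1) (at t1)"
      by (rule has_vector_derivative_quotient[OF g'])
    have q2: "((\<lambda>t. (?\<chi> t - ?\<chi> t1) / of_real (t - t1)) \<longlongrightarrow> \<i> * ?\<chi> t1) (at t1)"
      using has_vector_derivative_quotient[OF character_has_vector_derivative[of 1 t1]] by simp
    have "((\<lambda>t. ((g t - g t1) / of_real (t - t1)) / ((?\<chi> t - ?\<chi> t1) / of_real (t - t1))) \<longlongrightarrow> g' t1 / (\<i> * ?\<chi> t1)) (at t1)"
      by (rule tendsto_divide[OF q1 q2]) (simp add: nz)
    moreover have "\<forall>\<^sub>F t in at t1. ((g t - g t1) / of_real (t - t1)) / ((?\<chi> t - ?\<chi> t1) / of_real (t - t1)) = h t"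
    proof -
      have "\<forall>\<^sub>F t in at t1. (?\<chi> t - ?\<chi> t1) / of_real (t - t1) \<noteq> 0"
        by (rule tendsto_imp_eventually_ne[OF q2]) (simp add: nz)
      then show ?thesis
      proof (rule eventually_mono)
        fix t assume "(?\<chi> t - ?\<chi> t1) / complex_of_real (t - t1) \<noteq> 0"
        then have ne: "?\<chi> t \<noteq> ?\<chi> t1" "complex_of_real (t - t1) \<noteq> 0" by auto
        then show "((g t - g t1) / of_real (t - t1)) / ((?\<chi> t - ?\<chi> t1) / of_real (t - t1)) = h t"
          using True same[OF True] by (simp add: h_def del: of_real_diff)
      qed
    qed
    ultimately have "(h \<longlongrightarrow> g' t1 / (\<i> * ?\<chi> t1)) (at t1)" by (rule Lim_transform_eventually)
    then show ?thesis using True by (simp add: isCont_def h_def)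
  next
    case False
    have c\<chi>: "isCont ?\<chi> t" for t
      using continuous_on_character[of UNIV 1] by (simp add: continuous_on_eq_continuous_at)
    have cgt: "isCont g t" for t using cg by (simp add: continuous_on_eq_continuous_at)
    have "isCont (\<lambda>t. (g t - g t0) / (?\<chi> t - ?\<chi> t0)) t1"
      using False by (intro continuous_intros c\<chi> cgt) auto
    then have "((\<lambda>t. (g t - g t0) / (?\<chi> t - ?\<chi> t0)) \<longlongrightarrow> h t1) (at t1)"
      using False by (simp add: isCont_def h_def)
    moreover have "\<forall>\<^sub>F t in at t1. (g t - g t0) / (?\<chi> t - ?\<chi> t0) = h t"
    proof -
      have "\<forall>\<^sub>F t in at t1. ?\<chi> t \<noteq> ?\<chi> t0"
        by (rule tendsto_imp_eventually_ne[OF c\<chi>[of t1, unfolded isCont_def] False])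
      then show ?thesis by (rule eventually_mono) (simp add: h_def)
    qed
    ultimately show ?thesis unfolding isCont_def by (rule Lim_transform_eventually)
  qed
  then have ch: "continuous_on UNIV h" by (simp add: continuous_on_eq_continuous_at)
  have gh: "g t = g t0 * 1 + (?\<chi> t * h t - ?\<chi> t0 * h t)" for t
    using same[of t] by (auto simp: h_def field_simps)
  \<comment> \<open>Multiplication by \<open>character 1\<close> shifts the coefficients of
    \<open>h\<close> by one index.\<close>
  have coeff: "fc g n = g t0 * delta_seq n + (fc h (n - 1) - ?\<chi> t0 * fc h n)" for n
  proof -
    have "fc g n = fc (\<lambda>t. g t0 * 1 + (?\<chi> t * h t - ?\<chi> t0 * h t)) n"
      by (rule arg_cong[of g _ "\<lambda>g. fc g n"]) (rule ext, rule gh)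
    also have "\<dots> = fc (\<lambda>t. g t0 * 1) n + (fc (\<lambda>t. ?\<chi> t * h t) n - fc (\<lambda>t. ?\<chi> t0 * h t) n)"
      using fc_add[of "\<lambda>t. g t0 * 1" "\<lambda>t. ?\<chi> t * h t - ?\<chi> t0 * h t" n]
        fc_diff[of "\<lambda>t. ?\<chi> t * h t" "\<lambda>t. ?\<chi> t0 * h t" n]
      by (simp only: continuous_on_const continuous_on_mult continuous_on_diff continuous_on_character ch)
    also have "\<dots> = g t0 * delta_seq n + (fc h (n - 1) - ?\<chi> t0 * fc h n)"
      by (simp only: fc_cmult fc_character_mult fc_1)
    finally show ?thesis .
  qed
  \<comment> \<open>After multiplication by \<open>character n t0\<close> the differences telescope.
    The boundary coefficients of \<open>h\<close> sit at - N - 1 and N, and the constant contributes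
    at n = 0 only.\<close>
  have partial: "(\<Sum>n\<in>{- int N..int N}. fc g n * character n t0) =
      g t0 + (character (- int N) t0 * fc h (- int N - 1) - character (int N + 1) t0 * fc h (int N))" for N
  proof (induction N)
    case 0
    then show ?case by (simp add: coeff delta_seq_def)
  next
    case (Suc N)
    have set: "{- int (Suc N)..int (Suc N)} = insert (- int (Suc N)) (insert (int (Suc N)) {- int N..int N})"
      by auto
    have a1: "character (int N + 1 + 1) t0 = character (int N + 1) t0 * ?\<chi> t0"
      by (rule character_add)
    have a2: "character (- int N) t0 = character (- int (Suc N)) t0 * ?\<chi> t0"
      using character_add[of "- int (Suc N)" 1 t0] by simp
    have a3: "- 1 - int N = - int N - 1" by simp
    have "(\<Sum>n\<in>{- int (Suc N)..int (Suc N)}. fc g n * character n t0) =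
       fc g (- int (Suc N)) * character (- int (Suc N)) t0 + (fc g (int (Suc N)) * character (int (Suc N)) t0 +
        (\<Sum>n\<in>{- int N..int N}. fc g n * character n t0))"
      unfolding set by (subst sum.insert, simp, simp, subst sum.insert) auto
    then show ?case
      unfolding Suc using a1 a2 by (simp add: coeff delta_seq_def algebra_simps a3)
  qed
  have z1: "(\<lambda>N. character (- int N) t0 * fc h (- int N - 1)) \<longlonglongrightarrow> 0"
    by (rule tendsto_norm_zero_cancel)
      (use fc_tendsto_0[OF ch, of "\<lambda>N. - int N - 1"] in \<open>simp add: norm_mult inj_def tendsto_norm_zero\<close>)
  have z2: "(\<lambda>N. character (int N + 1) t0 * fc h (int N)) \<longlonglongrightarrow> 0"
    by (rule tendsto_norm_zero_cancel)
      (use fc_tendsto_0[OF ch, of int] in \<open>simp add: norm_mult inj_def tendsto_norm_zero\<close>)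
  have lim1: "(\<lambda>N. \<Sum>n\<in>{- int N..int N}. fc g n * character n t0) \<longlonglongrightarrow> g t0"
    unfolding partial using tendsto_add[OF tendsto_const[of "g t0"] tendsto_diff[OF z1 z2]] by simp
  have "(\<lambda>n. cmod (fc g n * character n t0)) summable_on UNIV" using s by (simp add: norm_mult)
  then have sm: "(\<lambda>n. fc g n * character n t0) summable_on UNIV" by (rule abs_summable_summable)
  \<comment> \<open>Symmetric intervals eventually contain every finite set, so the limit of the
    symmetric sums is the value of the unconditional sum.\<close>
  have fl: "filterlim (\<lambda>N. {- int N..int N}) (finite_subsets_at_top UNIV) sequentially"
    unfolding filterlim_finite_subsets_at_top
  proof (intro allI impI)
    fix X :: "int set" assume X: "finite X \<and> X \<subseteq> UNIV"
    define M where "M = nat (\<Sum>x\<in>X. \<bar>x\<bar>)"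
    have bound: "\<bar>x\<bar> \<le> int M" if "x \<in> X" for x
    proof -
      have "\<bar>x\<bar> \<le> (\<Sum>x\<in>X. \<bar>x\<bar>)" by (rule member_le_sum) (use that X in auto)
      then show ?thesis by (simp add: M_def)
    qed
    show "\<forall>\<^sub>F N in sequentially. finite {- int N..int N} \<and> X \<subseteq> {- int N..int N} \<and> {- int N..int N} \<subseteq> UNIV"
      unfolding eventually_sequentially
    proof (intro exI[of _ M] allI impI)
      fix N assume "M \<le> N"
      then have "x \<in> {- int N..int N}" if "x \<in> X" for x using bound[OF that] by auto
      then show "finite {- int N..int N} \<and> X \<subseteq> {- int N..int N} \<and> {- int N..int N} \<subseteq> UNIV" by auto
    qed
  qed
  have "(\<lambda>N. \<Sum>n\<in>{- int N..int N}. fc g n * character n t0) \<longlonglongrightarrow> (\<Sum>\<^sub>\<infinity>n. fc g n * character n t0)"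
    by (rule filterlim_compose[OF infsum_tendsto[OF sm] fl])
  then have "(\<Sum>\<^sub>\<infinity>n. fc g n * character n t0) = g t0" using lim1 LIMSEQ_unique by blast
  then show ?thesis using has_sum_infsum[OF sm] by simp
qed


section \<open>Decay of the coefficients of smooth functions and of exponentials\<close>

lemma wt_power_le: "wt n ^ p \<le> 2 ^ p * (1 + \<bar>real_of_int n\<bar> ^ p)"
proof -
  have "wt n ^ p \<le> (2 * max 1 \<bar>real_of_int n\<bar>) ^ p"
    by (intro power_mono) (auto simp: wt_def)
  also have "\<dots> = 2 ^ p * max 1 \<bar>real_of_int n\<bar> ^ p" by (simp add: power_mult_distrib)
  also have "max 1 \<bar>real_of_int n\<bar> ^ p \<le> 1 + \<bar>real_of_int n\<bar> ^ p"
    by (cases "\<bar>real_of_int n\<bar> \<le> 1") (auto simp: max_def)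
  finally show ?thesis by simp
qed

lemma periodic_reduction: "\<exists>k::int. t - 2 * pi * of_int k \<in> {0..2*pi}" for t :: real
proof -
  define k where "k = \<lfloor>t / (2 * pi)\<rfloor>"
  have "of_int k \<le> t / (2 * pi)" "t / (2 * pi) < of_int k + 1" by (auto simp: k_def)
  then have "2 * pi * of_int k \<le> t" "t \<le> 2 * pi * of_int k + 2 * pi" by (auto simp: field_simps)
  then show ?thesis by (intro exI[of _ k]) auto
qed

lemma continuous_periodic_bounded:
  fixes g :: "real \<Rightarrow> complex"
  assumes "continuous_on UNIV g" "\<And>t. g (t + 2 * pi) = g t"
  obtains B where "\<And>t. cmod (g t) \<le> B"
proof -
  have "compact (g ` {0..2*pi})"
    by (intro compact_continuous_image continuous_on_subset[OF assms(1)]) auto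
  then obtain B where B: "\<And>t. t \<in> {0..2*pi} \<Longrightarrow> cmod (g t) \<le> B"
    by (meson bounded_iff compact_imp_bounded imageI)
  have "cmod (g t) \<le> B" for t
  proof -
    obtain k :: int where "t - 2 * pi * of_int k \<in> {0..2*pi}" using periodic_reduction by blast
    moreover have "g t = g (t - 2 * pi * of_int k)"
      using periodic_int_multiple[of g "t - 2 * pi * of_int k" k, OF assms(2)] by simp
    ultimately show ?thesis using B by metis
  qed
  then show ?thesis using that by blast
qed

text \<open>\<open>G\<close> is a chain of successive derivatives; p integrations by parts trade
  them for powers of n. A chain, rather than an iterated \<open>deriv\<close>, allows complex values
  and a first member altered by a constant.\<close>

lemma rapid_fc_smooth:
  fixes G :: "nat \<Rightarrow> real \<Rightarrow> complex"
  assumes G: "\<And>k t. (G k has_vector_derivative G (Suc k) t) (at t)" "\<And>k t. G k (t + 2 * pi) = G k t"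
  shows "rapid (fc (G 0))"
  unfolding rapid_def
proof
  fix p
  have cont: "continuous_on UNIV (G k)" for k
    using G(1) by (auto intro!: continuous_on_vector_derivative)
  have power: "fc (G k) n = (\<i> * of_int n) ^ k * fc (G 0) n" for k n
  proof (induction k)
    case (Suc k)
    have "fc (G (Suc k)) n = \<i> * of_int n * fc (G k) n"
      by (rule fc_derivative[OF G(1) cont]) (use G(2)[of k 0] in simp)
    then show ?case using Suc by simp
  qed simp
  obtain B0 where B0: "\<And>t. cmod (G 0 t) \<le> B0"
    using continuous_periodic_bounded[of "G 0", OF cont G(2)] by blast
  obtain B where B: "\<And>t. cmod (G p t) \<le> B"
    using continuous_periodic_bounded[of "G p", OF cont G(2)] by blast
  have "cmod (fc (G 0) n) * wt n ^ p \<le> 2 ^ p * (B0 + B)" for n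
  proof -
    have "cmod (fc (G 0) n) * wt n ^ p \<le> cmod (fc (G 0) n) * (2 ^ p * (1 + \<bar>real_of_int n\<bar> ^ p))"
      by (intro mult_left_mono wt_power_le) auto
    also have "\<dots> = 2 ^ p * (cmod (fc (G 0) n) + cmod (fc (G p) n))"
      unfolding power[of p] by (simp add: norm_mult norm_power algebra_simps)
    also have "\<dots> \<le> 2 ^ p * (B0 + B)"
      by (intro mult_left_mono add_mono norm_fc_le cont B0 B) auto
    finally show ?thesis .
  qed
  then show "\<exists>C. \<forall>n. cmod (fc (G 0) n) * wt n ^ p \<le> C" by blast
qed

text \<open>Since \<open>wt n\<close> is at most \<open>wt \<sigma> * wt (n - \<sigma>)\<close>,
  decay of a fixed order survives convolution with a rapid sequence.\<close>

lemma conv_decay: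
  assumes k: "rapid k" and u: "\<And>n. cmod (u n) * wt n ^ p \<le> C"
  shows "cmod (conv k u n) * wt n ^ p \<le> (\<Sum>\<^sub>\<infinity>\<sigma>. cmod (k \<sigma>) * wt \<sigma> ^ p) * C"
proof -
  have tu: "tempered u" unfolding tempered_def
  proof (intro exI allI)
    show "cmod (u n) \<le> C * wt n ^ 0" for n
      using u[of n] mult_left_mono[OF wt_power_ge1[of n p], of "cmod (u n)"] by simp
  qed
  have "cmod (conv k u n) * wt n ^ p = cmod (\<Sum>\<^sub>\<infinity>\<sigma>. k \<sigma> * u (n - \<sigma>) * of_real (wt n ^ p))"
    unfolding conv_def infsum_cmult_left' norm_mult by (simp add: norm_power)
  also have "\<dots> \<le> (\<Sum>\<^sub>\<infinity>\<sigma>. cmod (k \<sigma>) * wt \<sigma> ^ p * C)"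
  proof (rule norm_infsum_le)
    show "((\<lambda>\<sigma>. k \<sigma> * u (n - \<sigma>) * of_real (wt n ^ p)) has_sum (\<Sum>\<^sub>\<infinity>\<sigma>. k \<sigma> * u (n - \<sigma>) * of_real (wt n ^ p))) UNIV"
      by (intro has_sum_infsum summable_on_cmult_left conv_summable k tu)
    show "((\<lambda>\<sigma>. cmod (k \<sigma>) * wt \<sigma> ^ p * C) has_sum (\<Sum>\<^sub>\<infinity>\<sigma>. cmod (k \<sigma>) * wt \<sigma> ^ p * C)) UNIV"
      by (intro has_sum_infsum summable_on_cmult_left rapid_summable k)
    fix \<sigma>
    have "wt n ^ p \<le> wt \<sigma> ^ p * wt (n - \<sigma>) ^ p"
      using wt_power_add_le[of \<sigma> "n - \<sigma>" p] by simp
    then have "cmod (k \<sigma>) * cmod (u (n - \<sigma>)) * wt n ^ p \<le> cmod (k \<sigma>) * cmod (u (n - \<sigma>)) * (wt \<sigma> ^ p * wt (n - \<sigma>) ^ p)"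
      by (rule mult_left_mono) simp
    also have "\<dots> = cmod (k \<sigma>) * wt \<sigma> ^ p * (cmod (u (n - \<sigma>)) * wt (n - \<sigma>) ^ p)" by simp
    also have "\<dots> \<le> cmod (k \<sigma>) * wt \<sigma> ^ p * C" by (intro mult_left_mono u) simp
    finally show "cmod (k \<sigma> * u (n - \<sigma>) * of_real (wt n ^ p)) \<le> cmod (k \<sigma>) * wt \<sigma> ^ p * C"
      by (simp add: norm_mult norm_power)
  qed
  finally show ?thesis by (simp add: infsum_cmult_left')
qed

text \<open>Each use of the relation between \<open>Dseq e\<close> and \<open>conv b e\<close> gains
  one power of decay, because \<open>wt n ^ Suc p\<close> is \<open>wt n ^ p\<close> plus
  \<bar>n\<bar> times it. This avoids higher derivatives of the exponential.\<close>

lemma rapid_bootstrap: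
  assumes b: "rapid b" and e: "\<And>n. cmod (e n) \<le> B" and D: "\<And>n. cmod (Dseq e n) = cmod (conv b e n)"
  shows "rapid e"
  unfolding rapid_def
proof
  fix p show "\<exists>C. \<forall>n. cmod (e n) * wt n ^ p \<le> C"
  proof (induction p)
    case 0 then show ?case using e by auto
  next
    case (Suc p)
    then obtain C where C: "\<And>n. cmod (e n) * wt n ^ p \<le> C" by blast
    have "cmod (e n) * wt n ^ Suc p \<le> C + (\<Sum>\<^sub>\<infinity>\<sigma>. cmod (b \<sigma>) * wt \<sigma> ^ p) * C" for n
    proof -
      have "cmod (e n) * wt n ^ Suc p = cmod (e n) * wt n ^ p + cmod (Dseq e n) * wt n ^ p"
        by (simp add: wt_def[of n] Dseq_def norm_mult algebra_simps)
      then show ?thesis using C[of n] conv_decay[OF b C, of n] D[of n] by simp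
    qed
    then show ?case by blast
  qed
qed

section \<open>The periodic primitive and its exponentials\<close>

lemma primitive_exists:
  fixes b :: "real \<Rightarrow> real"
  assumes "continuous_on UNIV b"
  obtains A where "\<And>t. (A has_real_derivative b t) (at t)"
proof -
  \<comment> \<open>An integral over an interval with reversed endpoints is 0, so the difference
    covers both signs of t.\<close>
  define A where "A = (\<lambda>t. integral {0..t} b - integral {t..0} b)"
  have int: "b integrable_on {x..y}" for x y
    by (rule integrable_continuous_interval[OF continuous_on_subset[OF assms]]) simp
  have "(A has_real_derivative b t) (at t)" for t
  proof -
    define T where "T = \<bar>t\<bar> + 1"
    have T: "- T < t" "t < T" "0 < T" by (auto simp: T_def)
    have A: "A s = integral {-T..s} b - integral {-T..0} b" if "- T < s" for s
    proof (cases "0 \<le> s")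
      case True
      have "integral {-T..0} b + integral {0..s} b = integral {-T..s} b"
        by (rule Henstock_Kurzweil_Integration.integral_combine) (use True T int in auto)
      moreover have "integral {s..0} b = 0"
        using True by (cases "s = 0") auto
      ultimately show ?thesis by (simp add: A_def)
    next
      case False
      have "integral {-T..s} b + integral {s..0} b = integral {-T..0} b"
        by (rule Henstock_Kurzweil_Integration.integral_combine) (use False that int in auto)
      moreover have "integral {0..s} b = 0" using False by simp
      ultimately show ?thesis by (simp add: A_def)
    qed
    have "((\<lambda>s. integral {-T..s} b) has_vector_derivative b t) (at t within {-T..T})"
      by (rule integral_has_vector_derivative[OF continuous_on_subset[OF assms]]) (use T in auto)
    then have "((\<lambda>s. integral {-T..s} b) has_real_derivative b t) (at t)"
      using T by (simp add: has_real_derivative_iff_has_vector_derivative at_within_Icc_at)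
    then have "((\<lambda>s. integral {-T..s} b - integral {-T..0} b) has_real_derivative b t) (at t)"
      by (auto intro!: derivative_eq_intros)
    then show ?thesis
      by (rule DERIV_cong_ev[THEN iffD1, rotated -1])
        (auto intro!: eventually_mono[OF eventually_nhds_in_open[of "{-T<..<T}" t]] simp: A T)
  qed
  then show ?thesis using that by blast
qed

lemma smooth_circleD:
  assumes "a \<in> smooth_circle"
  shows "((deriv ^^ k) a has_real_derivative (deriv ^^ Suc k) a t) (at t)"
    "(deriv ^^ k) a (t + 2 * pi) = (deriv ^^ k) a t"
    "continuous_on UNIV ((deriv ^^ k) a)"
proof -
  show d: "((deriv ^^ k) a has_real_derivative (deriv ^^ Suc k) a t) (at t)" for k t
    using assms by (simp add: smooth_circle_def DERIV_deriv_iff_real_differentiable)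
  show "(deriv ^^ k) a (t + 2 * pi) = (deriv ^^ k) a t" for k t
  proof (induction k arbitrary: t)
    case 0
    then show ?case using assms by (simp add: smooth_circle_def)
  next
    case (Suc k)
    have "((\<lambda>t. (deriv ^^ k) a (t + 2 * pi)) has_real_derivative (deriv ^^ Suc k) a (t + 2 * pi)) (at t)"
      using DERIV_shift[of "(deriv ^^ k) a" _ t "2 * pi"] d[of k "t + 2 * pi"] by simp
    then have "((deriv ^^ k) a has_real_derivative (deriv ^^ Suc k) a (t + 2 * pi)) (at t)"
      by (simp add: Suc)
    with d[of k t] show ?case using DERIV_unique by blast
  qed
  show "continuous_on UNIV ((deriv ^^ k) a)"
    using d[of k] by (meson DERIV_continuous_on has_field_derivative_at_within)
qed

lemma has_vector_derivative_of_real_complex: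
  "(f has_real_derivative D) (at t) \<Longrightarrow> ((\<lambda>t. complex_of_real (f t)) has_vector_derivative complex_of_real D) (at t)"
  by (rule has_vector_derivative_of_real)

text \<open>Removing the mean makes the primitive of the coefficient periodic.\<close>
lemma gauge_of_smooth:
  assumes a: "a \<in> smooth_circle"
  obtains e e' where "gauge (fc (\<lambda>t. of_real (a t - circle_mean a))) e e'"
proof -
  define b where "b = (\<lambda>t. a t - circle_mean a)"
  note sm = smooth_circleD[OF a]
  have cb: "continuous_on UNIV b" unfolding b_def using sm(3)[of 0] by (auto intro!: continuous_intros)
  have pb: "b (t + 2 * pi) = b t" for t using sm(2)[of 0 t] by (simp add: b_def)
  have db: "((\<lambda>t. complex_of_real (b t)) has_vector_derivative complex_of_real (deriv a t)) (at t)" for t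
    by (rule has_vector_derivative_of_real_complex) (use sm(1)[of 0 t] in \<open>auto simp: b_def intro!: derivative_eq_intros\<close>)
  define bh where "bh = fc (\<lambda>t. of_real (b t))"
  have rb: "rapid bh"
  proof -
    \<comment> \<open>Only the member with index 0 feels the subtracted mean.\<close>
    define G where "G = (\<lambda>k t. complex_of_real (if k = 0 then b t else (deriv ^^ k) a t))"
    have "rapid (fc (G 0))"
    proof (rule rapid_fc_smooth)
      show "(G k has_vector_derivative G (Suc k) t) (at t)" for k t
      proof (cases k)
        case 0 then show ?thesis using db by (simp add: G_def)
      next
        case (Suc j)
        have "((\<lambda>t. complex_of_real ((deriv ^^ k) a t)) has_vector_derivative complex_of_real ((deriv ^^ Suc k) a t)) (at t)"
          by (rule has_vector_derivative_of_real_complex[OF sm(1)])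
        then show ?thesis using Suc by (simp add: G_def)
      qed
      show "G k (t + 2 * pi) = G k t" for k t
        using sm(2)[of k t] pb[of t] by (simp add: G_def)
    qed
    then show ?thesis by (simp add: G_def bh_def)
  qed
  have sb: "(\<lambda>n. cmod (bh n)) summable_on UNIV" using rapid_summable[OF rb, of 0] by simp
  have bser: "of_real (b t) = (\<Sum>\<^sub>\<infinity>n. bh n * character n t)" for t
    unfolding bh_def
    by (rule infsumI[symmetric], rule fourier_inversion[OF _ db])
      (use pb sb sm(3)[of 1] in \<open>auto simp: bh_def intro!: continuous_intros\<close>)
  obtain A where A: "\<And>t. (A has_real_derivative b t) (at t)" using primitive_exists[OF cb] by blast
  have cA: "continuous_on UNIV A" using A by (meson DERIV_continuous_on has_field_derivative_at_within)
  have pA: "A (t + 2 * pi) = A t" for t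
  proof -
    have d0: "((\<lambda>s. A (s + 2 * pi) - A s) has_real_derivative 0) (at s)" for s
    proof -
      have "((\<lambda>s. A (s + 2 * pi)) has_real_derivative b s) (at s)"
        using DERIV_shift[of A _ s "2 * pi"] A[of "s + 2 * pi"] pb[of s] by simp
      then show ?thesis using DERIV_diff[OF _ A] by fastforce
    qed
    have "A (t + 2 * pi) - A t = A (0 + 2 * pi) - A 0"
      by (rule DERIV_isconst_all) (use d0 in blast)
    \<comment> \<open>The increment over one period is the integral of \<open>b\<close>, from which
      the mean has been removed.\<close>
    moreover have "A (2 * pi) - A 0 = 0"
    proof -
      have "(b has_integral (A (2 * pi) - A 0)) {0..2*pi}"
        by (rule fundamental_theorem_of_calculus)
          (use A in \<open>auto simp: has_real_derivative_iff_has_vector_derivative[symmetric] intro: has_field_derivative_at_within\<close>)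
      moreover have "(b has_integral (integral {0..2*pi} a - circle_mean a * (2 * pi))) {0..2*pi}"
      proof -
        have "a integrable_on {0..2*pi}"
          by (rule integrable_continuous_interval[OF continuous_on_subset[OF sm(3)[of 0, simplified]]]) simp
        then have "(a has_integral integral {0..2*pi} a) {0..2*pi}" by (rule integrable_integral)
        moreover have "((\<lambda>t. circle_mean a) has_integral (circle_mean a * (2 * pi))) {0..2*pi}"
          using has_integral_const_real[of "circle_mean a" 0 "2 * pi"] by (simp add: mult.commute)
        ultimately show ?thesis unfolding b_def by (rule has_integral_diff)
      qed
      ultimately have "A (2 * pi) - A 0 = integral {0..2*pi} a - circle_mean a * (2 * pi)"
        by (rule has_integral_unique)
      then show ?thesis by (simp add: circle_mean_def)
    qed
    ultimately show ?thesis by simp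
  qed
  \<comment> \<open>The values s = 1 and s = - 1 give the two gauge factors \<open>e\<close> and
    \<open>e'\<close>.\<close>
  define E where "E = (\<lambda>s t. cis (s * A t))"
  have cE: "continuous_on UNIV (E s)" for s unfolding E_def by (intro continuous_intros cA)
  have nE: "cmod (E s t) = 1" for s t by (simp add: E_def)
  have pE: "E s (t + 2 * pi) = E s t" for s t by (simp add: E_def pA)
  have dE: "(E s has_vector_derivative (\<i> * of_real s * (of_real (b t) * E s t))) (at t)" for s t
  proof -
    have "(A has_derivative (\<lambda>h. h * b t)) (at t)"
      using A[of t] by (simp add: has_field_derivative_def mult_commute_abs)
    then show ?thesis
      unfolding E_def has_vector_derivative_def
      by (auto intro!: derivative_eq_intros simp: scaleR_conv_of_real algebra_simps)
  qed
  have cdE: "continuous_on UNIV (\<lambda>t. \<i> * of_real s * (of_real (b t) * E s t))" for s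
    by (intro continuous_intros cb cE)
  define eh where "eh = (\<lambda>s. fc (E s))"
  have bE: "fc (\<lambda>t. of_real (b t) * E s t) n = conv bh (eh s) n" for s n
    unfolding eh_def by (rule fc_mult[OF sb bser cE, where B=1]) (simp add: nE)
  have De: "Dseq (eh s) = (\<lambda>n. \<i> * of_real s * conv bh (eh s) n)" for s
  proof
    fix n
    have "fc (\<lambda>t. \<i> * of_real s * (of_real (b t) * E s t)) n = \<i> * of_int n * fc (E s) n"
      by (rule fc_derivative[OF dE cdE]) (use pE[of s 0] in simp)
    then show "Dseq (eh s) n = \<i> * of_real s * conv bh (eh s) n"
      by (simp add: Dseq_def eh_def fc_cmult bE[unfolded eh_def] del: of_real_mult)
  qed
  have re: "rapid (eh s)" if "\<bar>s\<bar> = 1" for s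
  proof (rule rapid_bootstrap[OF rb, where B=1])
    show "cmod (eh s n) \<le> 1" for n unfolding eh_def by (rule norm_fc_le[OF cE]) (simp add: nE)
    show "cmod (Dseq (eh s) n) = cmod (conv bh (eh s) n)" for n
      using that by (simp add: De norm_mult)
  qed
  have inv: "conv (eh 1) (eh (- 1)) = delta_seq"
  proof
    fix n
    have s1: "(\<lambda>n. cmod (eh 1 n)) summable_on UNIV" using rapid_summable[OF re[of 1], of 0] by simp
    have ser: "E 1 t = (\<Sum>\<^sub>\<infinity>n. eh 1 n * character n t)" for t
      unfolding eh_def
      by (rule infsumI[symmetric], rule fourier_inversion[OF pE dE cdE]) (use s1 in \<open>simp add: eh_def\<close>)
    have "fc (\<lambda>t. E 1 t * E (- 1) t) n = conv (eh 1) (fc (E (- 1))) n"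
      by (rule fc_mult[OF s1 ser cE, where B=1]) (simp add: nE)
    moreover have "E 1 t * E (- 1) t = 1" for t by (simp add: E_def cis_mult)
    ultimately show "conv (eh 1) (eh (- 1)) n = delta_seq n" by (simp add: fc_1 eh_def)
  qed
  have "gauge bh (eh 1) (eh (- 1))"
  proof
    show "l2_bounded (\<lambda>n. cmod (conv (eh 1) u n)) B" if "tempered u" "l2_bounded (\<lambda>n. cmod (u n)) B" for u B
      unfolding eh_def by (rule unimodular_conv_contraction[OF cE nE re[unfolded eh_def] that]) simp
    show "l2_bounded (\<lambda>n. cmod (conv (eh (- 1)) u n)) B" if "tempered u" "l2_bounded (\<lambda>n. cmod (u n)) B" for u B
      unfolding eh_def by (rule unimodular_conv_contraction[OF cE nE re[unfolded eh_def] that]) simp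
  qed (use rb re inv De in auto)
  then show ?thesis using that by (simp add: bh_def b_def)
qed

section \<open>Test functions on the torus\<close>

lemma differentiable_imp_partials:
  fixes \<phi> :: "real \<times> real \<Rightarrow> complex"
  assumes "\<phi> differentiable (at (t, x))"
  shows "((\<lambda>s. \<phi> (s, x)) has_vector_derivative partial_t \<phi> (t, x)) (at t)"
    and "((\<lambda>y. \<phi> (t, y)) has_vector_derivative partial_x \<phi> (t, x)) (at x)"
proof -
  obtain D where D: "(\<phi> has_derivative D) (at (t, x))" using assms by (auto simp: differentiable_def)
  have "((\<lambda>s. \<phi> (s, x)) has_derivative (\<lambda>h. D (h, 0))) (at t)"
    by (rule has_derivative_compose[of "\<lambda>s. (s, x)" "\<lambda>h. (h, 0)" t UNIV \<phi> D, OF _ D])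
      (auto intro!: derivative_eq_intros)
  then have "(\<lambda>s. \<phi> (s, x)) differentiable (at t)" by (auto simp: differentiable_def)
  then show "((\<lambda>s. \<phi> (s, x)) has_vector_derivative partial_t \<phi> (t, x)) (at t)"
    by (simp add: partial_t_def vector_derivative_works[symmetric])
  have "((\<lambda>y. \<phi> (t, y)) has_derivative (\<lambda>h. D (0, h))) (at x)"
    by (rule has_derivative_compose[of "\<lambda>y. (t, y)" "\<lambda>h. (0, h)" x UNIV \<phi> D, OF _ D])
      (auto intro!: derivative_eq_intros)
  then have "(\<lambda>y. \<phi> (t, y)) differentiable (at x)" by (auto simp: differentiable_def)
  then show "((\<lambda>y. \<phi> (t, y)) has_vector_derivative partial_x \<phi> (t, x)) (at x)"
    by (simp add: partial_x_def vector_derivative_works[symmetric])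
qed

lemma partial_t_eqI:
  assumes "\<And>t x. ((\<lambda>s. \<phi> (s, x)) has_vector_derivative D (t, x)) (at t)"
  shows "partial_t \<phi> = D"
  using assms by (auto simp: partial_t_def fun_eq_iff intro: vector_derivative_at)

lemma partial_x_eqI:
  assumes "\<And>t x. ((\<lambda>y. \<phi> (t, y)) has_vector_derivative D (t, x)) (at x)"
  shows "partial_x \<phi> = D"
  using assms by (auto simp: partial_x_def fun_eq_iff intro: vector_derivative_at)

lemma C_order_SucD: "C_order (Suc k) \<phi> \<Longrightarrow> C_order k \<phi>"
proof (induction k arbitrary: \<phi>)
  case 0
  then show ?case
    by (auto simp: continuous_on_eq_continuous_at intro: differentiable_imp_continuous_within)
next
  case (Suc k)
  have p: "\<forall>z. \<phi> differentiable (at z)" "C_order (Suc k) (partial_t \<phi>)" "C_order (Suc k) (partial_x \<phi>)"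
    using Suc.prems unfolding C_order.simps(2)[of "Suc k"] by blast+
  show ?case
    unfolding C_order.simps(2)[of k] using p(1) Suc.IH[OF p(2)] Suc.IH[OF p(3)] by blast
qed

lemma C_order_const: "C_order k (\<lambda>_. c)"
proof (induction k arbitrary: c)
  case (Suc k)
  have "partial_t (\<lambda>_. c) = (\<lambda>_. 0)" "partial_x (\<lambda>_. c) = (\<lambda>_. 0)"
    by (auto intro!: partial_t_eqI partial_x_eqI)
  then show ?case using Suc by simp
qed simp

lemma C_order_add:
  "C_order k \<phi> \<Longrightarrow> C_order k \<psi> \<Longrightarrow> C_order k (\<lambda>z. \<phi> z + \<psi> z)"
proof (induction k arbitrary: \<phi> \<psi>)
  case 0
  then show ?case by (auto intro: continuous_intros)
next
  case (Suc k)
  have d: "\<phi> differentiable (at z)" "\<psi> differentiable (at z)" for z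
    using Suc.prems unfolding C_order.simps by blast+
  have "partial_t (\<lambda>z. \<phi> z + \<psi> z) = (\<lambda>z. partial_t \<phi> z + partial_t \<psi> z)"
    by (intro partial_t_eqI has_vector_derivative_add differentiable_imp_partials d)
  moreover have "partial_x (\<lambda>z. \<phi> z + \<psi> z) = (\<lambda>z. partial_x \<phi> z + partial_x \<psi> z)"
    by (intro partial_x_eqI has_vector_derivative_add differentiable_imp_partials d)
  ultimately show ?case using Suc d by (auto intro!: differentiable_add)
qed

lemma C_order_mult:
  "C_order k \<phi> \<Longrightarrow> C_order k \<psi> \<Longrightarrow> C_order k (\<lambda>z. \<phi> z * \<psi> z)"
proof (induction k arbitrary: \<phi> \<psi>)
  case 0
  then show ?case by (auto intro: continuous_intros)
next
  case (Suc k)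
  have d: "\<phi> differentiable (at z)" "\<psi> differentiable (at z)" for z
    using Suc.prems unfolding C_order.simps by blast+
  have "partial_t (\<lambda>z. \<phi> z * \<psi> z) = (\<lambda>z. \<phi> z * partial_t \<psi> z + partial_t \<phi> z * \<psi> z)"
    by (intro partial_t_eqI has_vector_derivative_mult differentiable_imp_partials d)
  moreover have "partial_x (\<lambda>z. \<phi> z * \<psi> z) = (\<lambda>z. \<phi> z * partial_x \<psi> z + partial_x \<phi> z * \<psi> z)"
    by (intro partial_x_eqI has_vector_derivative_mult differentiable_imp_partials d)
  ultimately show ?case
    using Suc d C_order_SucD[OF Suc.prems(1)] C_order_SucD[OF Suc.prems(2)]
    by (auto intro!: differentiable_mult C_order_add)
qed

section \<open>Characters and closure properties of test functions\<close>

definition torus_character :: "int \<times> int \<Rightarrow> real \<times> real \<Rightarrow> complex" where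
  "torus_character k z = character (fst k) (fst z) * character (snd k) (snd z)"

lemma norm_torus_character [simp]: "cmod (torus_character k z) = 1"
  by (simp add: torus_character_def norm_mult)

lemma partial_torus_character:
  "partial_t (\<lambda>z. c * torus_character k z) = (\<lambda>z. (c * (\<i> * of_int (fst k))) * torus_character k z)"
  "partial_x (\<lambda>z. c * torus_character k z) = (\<lambda>z. (c * (\<i> * of_int (snd k))) * torus_character k z)"
proof -
  show "partial_t (\<lambda>z. c * torus_character k z) = (\<lambda>z. (c * (\<i> * of_int (fst k))) * torus_character k z)"
  proof (rule partial_t_eqI)
    fix t x
    have "((\<lambda>s. (c * character (snd k) x) * character (fst k) s) has_vector_derivative
       (c * character (snd k) x) * (\<i> * of_int (fst k) * character (fst k) t)) (at t)"
      by (intro has_vector_derivative_mult_right character_has_vector_derivative)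
    then show "((\<lambda>s. c * torus_character k (s, x)) has_vector_derivative
         (c * (\<i> * of_int (fst k))) * torus_character k (t, x)) (at t)"
      by (simp add: torus_character_def mult_ac)
  qed
  show "partial_x (\<lambda>z. c * torus_character k z) = (\<lambda>z. (c * (\<i> * of_int (snd k))) * torus_character k z)"
  proof (rule partial_x_eqI)
    fix t x
    have "((\<lambda>y. (c * character (fst k) t) * character (snd k) y) has_vector_derivative
       (c * character (fst k) t) * (\<i> * of_int (snd k) * character (snd k) x)) (at x)"
      by (intro has_vector_derivative_mult_right character_has_vector_derivative)
    then show "((\<lambda>y. c * torus_character k (t, y)) has_vector_derivative
         (c * (\<i> * of_int (snd k))) * torus_character k (t, x)) (at x)"
      by (simp add: torus_character_def mult_ac)
  qed
qed

lemma has_derivative_character: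
  "(character n has_derivative (\<lambda>h. of_real h * (\<i> * of_int n * character n t))) (at t within S)"
  using character_has_vector_derivative[of n t S]
  by (simp add: has_vector_derivative_def scaleR_conv_of_real)

lemma differentiable_torus_character: "torus_character k differentiable (at z)"
proof -
  have "(\<lambda>z. character (fst k) (fst z)) differentiable (at z)"
    unfolding differentiable_def
    by (rule exI, rule has_derivative_compose[OF _ has_derivative_character]) (rule derivative_intros, rule has_derivative_ident)
  moreover have "(\<lambda>z. character (snd k) (snd z)) differentiable (at z)"
    unfolding differentiable_def
    by (rule exI, rule has_derivative_compose[OF _ has_derivative_character]) (rule derivative_intros, rule has_derivative_ident)
  ultimately show ?thesis unfolding torus_character_def by (intro differentiable_mult)
qed

lemma C_order_torus_character: "C_order n (\<lambda>z. c * torus_character k z)"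
proof (induction n arbitrary: c)
  case 0
  have "continuous_on UNIV (torus_character k)"
    by (intro continuous_at_imp_continuous_on ballI differentiable_imp_continuous_within differentiable_torus_character)
  then show ?case by (auto intro: continuous_intros)
next
  case (Suc n)
  then show ?case
    unfolding C_order.simps partial_torus_character
    by (auto intro!: differentiable_mult differentiable_torus_character)
qed

lemma test_functionsD:
  assumes "\<phi> \<in> test_functions"
  shows "\<phi> (t + 2 * pi, x) = \<phi> (t, x)" "\<phi> (t, x + 2 * pi) = \<phi> (t, x)" "C_order k \<phi>"
    "continuous_on S \<phi>" "\<phi> differentiable (at z)"
proof -
  show "\<phi> (t + 2 * pi, x) = \<phi> (t, x)" "\<phi> (t, x + 2 * pi) = \<phi> (t, x)" and c: "C_order k \<phi>" for k
    using assms by (auto simp: test_functions_def)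
  show "continuous_on S \<phi>" using c[of 0] by (auto intro: continuous_on_subset)
  show "\<phi> differentiable (at z)" using c[of "Suc 0"] unfolding C_order.simps by blast
qed

lemma torus_character_test: "torus_character k \<in> test_functions"
  using C_order_torus_character[of _ 1 k]
  by (auto simp: test_functions_def torus_character_def[abs_def])

lemma test_add: "\<phi> \<in> test_functions \<Longrightarrow> \<psi> \<in> test_functions \<Longrightarrow> (\<lambda>z. \<phi> z + \<psi> z) \<in> test_functions"
  by (auto simp: test_functions_def intro: C_order_add)

lemma test_mult: "\<phi> \<in> test_functions \<Longrightarrow> \<psi> \<in> test_functions \<Longrightarrow> (\<lambda>z. \<phi> z * \<psi> z) \<in> test_functions"
  by (auto simp: test_functions_def intro: C_order_mult)

lemma test_const: "(\<lambda>_. c) \<in> test_functions"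
  by (auto simp: test_functions_def intro: C_order_const)

lemma test_cmult: "\<phi> \<in> test_functions \<Longrightarrow> (\<lambda>z. c * \<phi> z) \<in> test_functions"
  by (rule test_mult[OF test_const])

lemma test_partials:
  assumes "\<phi> \<in> test_functions"
  shows "((\<lambda>s. \<phi> (s, x)) has_vector_derivative partial_t \<phi> (t, x)) (at t)"
    and "((\<lambda>y. \<phi> (t, y)) has_vector_derivative partial_x \<phi> (t, x)) (at x)"
  by (intro differentiable_imp_partials test_functionsD[OF assms])+

lemma has_vector_derivative_shift:
  fixes g :: "real \<Rightarrow> complex"
  assumes "(g has_vector_derivative D) (at (t + c))"
  shows "((\<lambda>s. g (s + c)) has_vector_derivative D) (at t)"
proof -
  have "((\<lambda>s. s + c) has_vector_derivative 1) (at t)"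
    by (auto intro!: derivative_eq_intros)
  from vector_diff_chain_at[OF this assms] show ?thesis by (simp add: o_def)
qed

lemma test_partial_t: assumes "\<phi> \<in> test_functions" shows "partial_t \<phi> \<in> test_functions"
proof -
  note d = test_functionsD[OF assms] note p = test_partials[OF assms]
  have "partial_t \<phi> (t + 2 * pi, x) = partial_t \<phi> (t, x)" for t x
    using vector_derivative_unique_at[OF has_vector_derivative_shift[OF p(1)[of x "t + 2 * pi"]], of "partial_t \<phi> (t, x)"]
      p(1)[of x t] by (simp add: d)
  moreover have "partial_t \<phi> (t, x + 2 * pi) = partial_t \<phi> (t, x)" for t x
    by (simp add: partial_t_def d)
  moreover have "C_order k (partial_t \<phi>)" for k using d(3)[of "Suc k"] by simp
  ultimately show ?thesis by (auto simp: test_functions_def)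
qed

lemma test_partial_x: assumes "\<phi> \<in> test_functions" shows "partial_x \<phi> \<in> test_functions"
proof -
  note d = test_functionsD[OF assms] note p = test_partials[OF assms]
  have "partial_x \<phi> (t, x + 2 * pi) = partial_x \<phi> (t, x)" for t x
    using vector_derivative_unique_at[OF has_vector_derivative_shift[OF p(2)[of t "x + 2 * pi"]], of "partial_x \<phi> (t, x)"]
      p(2)[of t x] by (simp add: d)
  moreover have "partial_x \<phi> (t + 2 * pi, x) = partial_x \<phi> (t, x)" for t x
    by (simp add: partial_x_def d)
  moreover have "C_order k (partial_x \<phi>)" for k using d(3)[of "Suc k"] by simp
  ultimately show ?thesis by (auto simp: test_functions_def)
qed

lemma test_partials_iter:
  "\<phi> \<in> test_functions \<Longrightarrow> (partial_t ^^ m) ((partial_x ^^ n) \<phi>) \<in> test_functions"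
proof (induction m)
  case 0
  then show ?case by (induction n) (auto intro: test_partial_x)
qed (auto intro: test_partial_t)

lemma test_bounded:
  assumes "\<phi> \<in> test_functions"
  obtains B where "\<And>z. cmod (\<phi> z) \<le> B"
proof -
  note d = test_functionsD[OF assms]
  have "compact (\<phi> ` ({0..2*pi} \<times> {0..2*pi}))"
    by (intro compact_continuous_image d compact_Times) auto
  then obtain B where B: "\<And>z. z \<in> {0..2*pi} \<times> {0..2*pi} \<Longrightarrow> cmod (\<phi> z) \<le> B"
    by (meson bounded_iff compact_imp_bounded imageI)
  have "cmod (\<phi> (t, x)) \<le> B" for t x
  proof -
    obtain k l :: int where kl: "t - 2 * pi * of_int k \<in> {0..2*pi}" "x - 2 * pi * of_int l \<in> {0..2*pi}"
      using periodic_reduction by blast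
    have "\<phi> (t, x) = \<phi> (t - 2 * pi * of_int k, x)"
      using periodic_int_multiple[of "\<lambda>s. \<phi> (s, x)" "t - 2 * pi * of_int k" k] d(1) by simp
    also have "\<dots> = \<phi> (t - 2 * pi * of_int k, x - 2 * pi * of_int l)"
      using periodic_int_multiple[of "\<lambda>s. \<phi> (t - 2 * pi * of_int k, s)" "x - 2 * pi * of_int l" l] d(2) by simp
    finally show ?thesis using B kl by simp
  qed
  then show ?thesis using that by force
qed

section \<open>Fourier coefficients and inversion for test functions\<close>

definition fc_x :: "(real \<times> real \<Rightarrow> complex) \<Rightarrow> int \<Rightarrow> real \<Rightarrow> complex" where
  "fc_x \<phi> \<xi> t = fc (\<lambda>x. \<phi> (t, x)) \<xi>"

text \<open>An iterated coefficient, x before t, so that the one-variable results apply in each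
  variable in turn.\<close>

definition torus_fc :: "(real \<times> real \<Rightarrow> complex) \<Rightarrow> int \<times> int \<Rightarrow> complex" where
  "torus_fc \<phi> k = fc (fc_x \<phi> (snd k)) (fst k)"

lemma continuous_slices:
  fixes \<phi> :: "real \<times> real \<Rightarrow> complex"
  assumes "continuous_on UNIV \<phi>"
  shows "continuous_on S (\<lambda>x. \<phi> (t, x))" "continuous_on S (\<lambda>t. \<phi> (t, x))"
  by (auto intro!: continuous_on_compose2[OF assms] continuous_intros)

lemma continuous_on_fc_x:
  assumes "continuous_on UNIV \<phi>"
  shows "continuous_on UNIV (fc_x \<phi> \<xi>)"
proof -
  have "continuous_on (UNIV \<times> cbox 0 (2*pi)) (\<lambda>(t, x). \<phi> (t, x) * character (- \<xi>) x)"
    unfolding case_prod_unfold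
    by (intro continuous_intros continuous_on_compose2[OF assms] continuous_on_compose2[OF continuous_on_character]) auto
  then have "continuous_on UNIV (\<lambda>t. integral (cbox 0 (2*pi)) (\<lambda>x. \<phi> (t, x) * character (- \<xi>) x))"
    by (rule integral_continuous_on_param)
  then show ?thesis
    unfolding fc_x_def[abs_def] fc_def circle_avg_def by (auto intro!: continuous_intros)
qed

text \<open>Differentiation under the integral sign; it makes \<open>fc_x \<phi> \<xi>\<close>
  accessible to \<open>fc_derivative\<close> and to the inversion theorem in t.\<close>

lemma fc_x_has_vector_derivative:
  assumes "\<phi> \<in> test_functions"
  shows "(fc_x \<phi> \<xi> has_vector_derivative fc_x (partial_t \<phi>) \<xi> t) (at t)"
proof -
  have c: "continuous_on UNIV (partial_t \<phi>)" by (rule test_functionsD[OF test_partial_t[OF assms]])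
  have "((\<lambda>t. integral (cbox 0 (2*pi)) (\<lambda>x. \<phi> (t, x) * character (- \<xi>) x)) has_vector_derivative
      integral (cbox 0 (2*pi)) (\<lambda>x. partial_t \<phi> (t, x) * character (- \<xi>) x)) (at t within UNIV)"
  proof (rule leibniz_rule_vector_derivative)
    show "((\<lambda>t. \<phi> (t, x) * character (- \<xi>) x) has_vector_derivative partial_t \<phi> (t, x) * character (- \<xi>) x) (at t within UNIV)" for t x
      by (intro has_vector_derivative_mult_left test_partials assms)
    show "(\<lambda>x. \<phi> (t, x) * character (- \<xi>) x) integrable_on cbox 0 (2 * pi)" for t
      by (intro integrable_continuous continuous_intros continuous_slices test_functionsD[OF assms])
    show "continuous_on (UNIV \<times> cbox 0 (2 * pi)) (\<lambda>(t, x). partial_t \<phi> (t, x) * character (- \<xi>) x)"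
      unfolding case_prod_unfold
      by (intro continuous_intros continuous_on_compose2[OF c] continuous_on_compose2[OF continuous_on_character]) auto
  qed auto
  then have "((\<lambda>t. integral (cbox 0 (2*pi)) (\<lambda>x. \<phi> (t, x) * character (- \<xi>) x) / of_real (2 * pi)) has_vector_derivative
      integral (cbox 0 (2*pi)) (\<lambda>x. partial_t \<phi> (t, x) * character (- \<xi>) x) / of_real (2 * pi)) (at t)"
    by (simp add: has_vector_derivative_divide)
  then show ?thesis unfolding fc_x_def[abs_def] fc_def circle_avg_def by simp
qed

lemma fc_x_periodic: "\<phi> \<in> test_functions \<Longrightarrow> fc_x \<phi> \<xi> (t + 2 * pi) = fc_x \<phi> \<xi> t"
  by (simp add: fc_x_def test_functionsD)

lemma torus_fc_partial_t:
  assumes "\<phi> \<in> test_functions"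
  shows "torus_fc (partial_t \<phi>) k = \<i> * of_int (fst k) * torus_fc \<phi> k"
  unfolding torus_fc_def
  by (rule fc_derivative[OF fc_x_has_vector_derivative[OF assms]])
    (use fc_x_periodic[OF assms, of _ 0] in \<open>auto intro: continuous_on_fc_x test_functionsD test_partial_t assms\<close>)

lemma torus_fc_partial_x:
  assumes "\<phi> \<in> test_functions"
  shows "torus_fc (partial_x \<phi>) k = \<i> * of_int (snd k) * torus_fc \<phi> k"
proof -
  have "fc_x (partial_x \<phi>) \<xi> t = \<i> * of_int \<xi> * fc_x \<phi> \<xi> t" for \<xi> t
    unfolding fc_x_def
    by (rule fc_derivative[OF test_partials(2)[OF assms]])
      (use test_functionsD(2)[OF assms, of t 0] in \<open>auto intro: continuous_slices test_functionsD test_partial_x assms\<close>)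
  then have "fc_x (partial_x \<phi>) (snd k) = (\<lambda>t. \<i> * of_int (snd k) * fc_x \<phi> (snd k) t)" by auto
  then show ?thesis by (simp add: torus_fc_def fc_cmult del: mult.assoc)
qed

lemma torus_fc_partials_iter:
  assumes "\<phi> \<in> test_functions"
  shows "torus_fc ((partial_t ^^ m) ((partial_x ^^ n) \<phi>)) k =
    (\<i> * of_int (fst k)) ^ m * (\<i> * of_int (snd k)) ^ n * torus_fc \<phi> k"
proof (induction m)
  case 0
  have "torus_fc ((partial_x ^^ n) \<phi>) k = (\<i> * of_int (snd k)) ^ n * torus_fc \<phi> k"
  proof (induction n)
    case (Suc n)
    then show ?case
      using torus_fc_partial_x[of "(partial_x ^^ n) \<phi>" k] test_partials_iter[OF assms, of 0 n] by simp
  qed simp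
  then show ?case by simp
next
  case (Suc m)
  then show ?case
    using torus_fc_partial_t[of "(partial_t ^^ m) ((partial_x ^^ n) \<phi>)" k] test_partials_iter[OF assms, of m n] by simp
qed

lemma norm_torus_fc_le:
  assumes "continuous_on UNIV \<phi>" "\<And>z. cmod (\<phi> z) \<le> B"
  shows "cmod (torus_fc \<phi> k) \<le> B"
  unfolding torus_fc_def fc_x_def[abs_def]
  by (intro norm_fc_le continuous_on_fc_x[unfolded fc_x_def[abs_def]] continuous_slices assms)

lemma torus_fc_add:
  assumes "\<phi> \<in> test_functions" "\<psi> \<in> test_functions"
  shows "torus_fc (\<lambda>z. \<phi> z + \<psi> z) k = torus_fc \<phi> k + torus_fc \<psi> k"
proof -
  note c = test_functionsD(4)[OF assms(1), of UNIV] test_functionsD(4)[OF assms(2), of UNIV]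
  have "fc_x (\<lambda>z. \<phi> z + \<psi> z) (snd k) = (\<lambda>t. fc_x \<phi> (snd k) t + fc_x \<psi> (snd k) t)"
    unfolding fc_x_def[abs_def] by (intro ext fc_add continuous_slices c)
  then show ?thesis
    unfolding torus_fc_def by (simp add: fc_add continuous_on_fc_x c)
qed

lemma torus_fc_cmult: "torus_fc (\<lambda>z. c * \<phi> z) k = c * torus_fc \<phi> k"
  by (simp add: torus_fc_def fc_x_def[abs_def] fc_cmult)

lemma torus_fc_character: "torus_fc (torus_character l) k = (if k = l then 1 else 0)"
proof -
  have "fc_x (torus_character l) (snd k) = (\<lambda>t. (if snd k = snd l then 1 else 0) * character (fst l) t)"
    by (simp add: fun_eq_iff fc_x_def torus_character_def fc_cmult fc_character)
  then have "torus_fc (torus_character l) k = (if snd k = snd l then 1 else 0) * fc (character (fst l)) (fst k)"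
    unfolding torus_fc_def by (simp only: fc_cmult)
  then show ?thesis by (auto simp: fc_character prod_eq_iff)
qed

lemma norm_le_SUP_test:
  assumes "\<phi> \<in> test_functions" shows "cmod (\<phi> z) \<le> (SUP z. cmod (\<phi> z))"
proof -
  obtain B where "\<And>z. cmod (\<phi> z) \<le> B" using test_bounded[OF assms] by blast
  then show ?thesis by (intro cSUP_upper bdd_aboveI2[where M=B]) auto
qed

lemma SUP_le_test_seminorm:
  assumes "\<phi> \<in> test_functions" "m \<le> N" "n \<le> N"
  shows "(SUP z. cmod ((partial_t ^^ m) ((partial_x ^^ n) \<phi>) z)) \<le> test_seminorm N \<phi>"
proof -
  have nn: "0 \<le> (SUP z. cmod ((partial_t ^^ m) ((partial_x ^^ n) \<phi>) z))" for m n
    using norm_le_SUP_test[OF test_partials_iter[OF assms(1)]] norm_ge_zero order_trans by blast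
  have "(SUP z. cmod ((partial_t ^^ m) ((partial_x ^^ n) \<phi>) z)) \<le>
     (\<Sum>n\<le>N. SUP z. cmod ((partial_t ^^ m) ((partial_x ^^ n) \<phi>) z))"
    by (rule member_le_sum) (use assms nn in auto)
  also have "\<dots> \<le> test_seminorm N \<phi>"
    unfolding test_seminorm_def
    by (rule member_le_sum[of m "{..N}" "\<lambda>m. \<Sum>n\<le>N. SUP z. cmod ((partial_t ^^ m) ((partial_x ^^ n) \<phi>) z)"])
      (use assms nn in \<open>auto intro: sum_nonneg\<close>)
  finally show ?thesis .
qed

text \<open>The product form makes sums over the lattice factor into one-variable sums.\<close>

definition wt2 :: "int \<times> int \<Rightarrow> real" where "wt2 k = wt (fst k) * wt (snd k)"

lemma wt2_pos [simp]: "wt2 k > 0" "wt2 k \<ge> 0" "wt2 k \<noteq> 0"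
  by (auto simp: wt2_def)

lemma wt2_ge1: "wt2 k \<ge> 1"
  unfolding wt2_def using mult_mono[OF wt_ge1[of "fst k"] wt_ge1[of "snd k"]] by simp

lemma wt2_minus [simp]: "wt2 (- k) = wt2 k"
  by (simp add: wt2_def)

lemma wt2_ge: "wt (fst k) \<le> wt2 k" "wt (snd k) \<le> wt2 k"
  unfolding wt2_def
  using mult_left_mono[OF wt_ge1[of "snd k"], of "wt (fst k)"] mult_right_mono[OF wt_ge1[of "fst k"], of "wt (snd k)"]
  by auto

lemma wt2_summable: "(\<lambda>k. 1 / wt2 k ^ 2) summable_on UNIV"
  using summable_on_times[OF summable_on_inverse_wt summable_on_inverse_wt]
  by (simp add: wt2_def power_mult_distrib case_prod_unfold)

text \<open>Powers of the frequencies times a coefficient are coefficients of derivatives. The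
  factor 4 ^ p comes from two uses of \<open>wt_power_le\<close>, the factor 4 from the four
  products of 1 and the p-th powers.\<close>

lemma torus_fc_decay:
  assumes "\<phi> \<in> test_functions"
  shows "cmod (torus_fc \<phi> k) * wt2 k ^ p \<le> 4 * 4 ^ p * test_seminorm p \<phi>"
proof -
  have le: "\<bar>real_of_int (fst k)\<bar> ^ m * \<bar>real_of_int (snd k)\<bar> ^ n * cmod (torus_fc \<phi> k) \<le> test_seminorm p \<phi>"
    if "m \<le> p" "n \<le> p" for m n
  proof -
    have "\<bar>real_of_int (fst k)\<bar> ^ m * \<bar>real_of_int (snd k)\<bar> ^ n * cmod (torus_fc \<phi> k) =
      cmod (torus_fc ((partial_t ^^ m) ((partial_x ^^ n) \<phi>)) k)"
      by (simp add: torus_fc_partials_iter assms norm_mult norm_power)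
    also have "\<dots> \<le> (SUP z. cmod ((partial_t ^^ m) ((partial_x ^^ n) \<phi>) z))"
      by (intro norm_torus_fc_le norm_le_SUP_test test_functionsD test_partials_iter assms)
    also have "\<dots> \<le> test_seminorm p \<phi>" by (rule SUP_le_test_seminorm[OF assms that])
    finally show ?thesis .
  qed
  let ?c = "cmod (torus_fc \<phi> k)" and ?x = "\<bar>real_of_int (fst k)\<bar> ^ p" and ?y = "\<bar>real_of_int (snd k)\<bar> ^ p"
  have "wt2 k ^ p \<le> (2 ^ p * (1 + ?x)) * (2 ^ p * (1 + ?y))"
    unfolding wt2_def power_mult_distrib by (intro mult_mono wt_power_le) auto
  then have "?c * wt2 k ^ p \<le> ?c * ((2 ^ p * (1 + ?x)) * (2 ^ p * (1 + ?y)))"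
    by (rule mult_left_mono) simp
  also have "\<dots> = 4 ^ p * (?c + ?x * ?c + ?y * ?c + ?x * ?y * ?c)"
    using power_mult_distrib[of "2::real" 2 p] by (simp add: algebra_simps)
  also have "\<dots> \<le> 4 ^ p * (test_seminorm p \<phi> + test_seminorm p \<phi> + test_seminorm p \<phi> + test_seminorm p \<phi>)"
    using le[of 0 0] le[of p 0] le[of 0 p] le[of p p] by (intro mult_left_mono add_mono) auto
  finally show ?thesis by simp
qed

lemma torus_fc_summable:
  assumes "\<phi> \<in> test_functions"
  shows "(\<lambda>k. cmod (torus_fc \<phi> k) * wt2 k ^ p) summable_on UNIV"
proof (rule summable_on_comparison_test)
  let ?C = "4 * 4 ^ (p + 2) * test_seminorm (p + 2) \<phi>"
  show "(\<lambda>k. ?C * (1 / wt2 k ^ 2)) summable_on UNIV"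
    by (intro summable_on_cmult_right wt2_summable)
  show "cmod (torus_fc \<phi> k) * wt2 k ^ p \<le> ?C * (1 / wt2 k ^ 2)" for k
    using torus_fc_decay[OF assms, of k "p + 2"] by (simp add: field_simps power_add power2_eq_square)
qed auto

text \<open>Inversion in t at fixed \<xi> is combined with inversion in x; absolute summability of
  all coefficients lets the iterated sum be read as one sum over pairs.\<close>

lemma torus_fourier_inversion:
  assumes "\<phi> \<in> test_functions"
  shows "((\<lambda>k. torus_fc \<phi> k * torus_character k z) has_sum \<phi> z) UNIV"
proof -
  obtain t x where z: "z = (t, x)" by (cases z)
  let ?f = "\<lambda>\<xi> \<tau>. torus_fc \<phi> (\<tau>, \<xi>)"
  have s0: "(\<lambda>k. cmod (torus_fc \<phi> k)) summable_on UNIV" using torus_fc_summable[OF assms, of 0] by simp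
  have s1: "(\<lambda>(\<xi>, \<tau>). cmod (?f \<xi> \<tau>)) summable_on UNIV \<times> UNIV"
    using summable_on_swap[of "\<lambda>k. cmod (torus_fc \<phi> k)" UNIV UNIV] s0 by (simp add: case_prod_unfold)
  have s\<tau>: "(\<lambda>\<tau>. cmod (?f \<xi> \<tau>)) summable_on UNIV" for \<xi>
    using summable_on_SigmaD1[OF s1, of \<xi>] by simp
  have s\<xi>: "(\<lambda>\<xi>. \<Sum>\<^sub>\<infinity>\<tau>. cmod (?f \<xi> \<tau>)) summable_on UNIV"
    using summable_on_Sigma_banach[OF s1] by simp
  have inner: "((\<lambda>\<tau>. ?f \<xi> \<tau> * character \<tau> t) has_sum fc_x \<phi> \<xi> t) UNIV" for \<xi>
    unfolding torus_fc_def fst_conv snd_conv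
  proof (rule fourier_inversion)
    show "fc_x \<phi> \<xi> (t + 2 * pi) = fc_x \<phi> \<xi> t" for t by (rule fc_x_periodic[OF assms])
    show "(fc_x \<phi> \<xi> has_vector_derivative fc_x (partial_t \<phi>) \<xi> t) (at t)" for t
      by (rule fc_x_has_vector_derivative[OF assms])
    show "continuous_on UNIV (fc_x (partial_t \<phi>) \<xi>)"
      by (intro continuous_on_fc_x test_functionsD test_partial_t assms)
    show "(\<lambda>n. cmod (fc (fc_x \<phi> \<xi>) n)) summable_on UNIV"
      using s\<tau>[of \<xi>] by (simp add: torus_fc_def)
  qed
  \<comment> \<open>Inversion in x needs the slice coefficients to be absolutely summable in \<xi>;
    the inner inversion bounds them by the sums over \<tau>.\<close>
  have sx: "(\<lambda>\<xi>. cmod (fc_x \<phi> \<xi> t)) summable_on UNIV"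
  proof (rule summable_on_comparison_test[OF s\<xi>])
    show "cmod (fc_x \<phi> \<xi> t) \<le> (\<Sum>\<^sub>\<infinity>\<tau>. cmod (?f \<xi> \<tau>))" for \<xi>
      by (rule norm_infsum_le[OF inner has_sum_infsum[OF s\<tau>]]) (simp add: norm_mult)
  qed auto
  have outer: "((\<lambda>\<xi>. fc_x \<phi> \<xi> t * character \<xi> x) has_sum \<phi> (t, x)) UNIV"
    unfolding fc_x_def
  proof (rule fourier_inversion)
    show "\<phi> (t, x + 2 * pi) = \<phi> (t, x)" for x by (rule test_functionsD[OF assms])
    show "((\<lambda>y. \<phi> (t, y)) has_vector_derivative partial_x \<phi> (t, x)) (at x)" for x
      by (rule test_partials[OF assms])
    show "continuous_on UNIV (\<lambda>x. partial_x \<phi> (t, x))"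
      by (intro continuous_slices test_functionsD test_partial_x assms)
    show "(\<lambda>n. cmod (fc (\<lambda>x. \<phi> (t, x)) n)) summable_on UNIV" using sx by (simp add: fc_x_def)
  qed
  define G where "G = (\<lambda>(\<xi>, \<tau>). ?f \<xi> \<tau> * torus_character (\<tau>, \<xi>) (t, x))"
  have "(\<lambda>k. cmod (G k)) summable_on UNIV \<times> UNIV"
    using s1 by (simp add: G_def case_prod_unfold norm_mult)
  then have sG: "G summable_on UNIV \<times> UNIV" by (rule abs_summable_summable)
  have G1: "((\<lambda>\<tau>. G (\<xi>, \<tau>)) has_sum fc_x \<phi> \<xi> t * character \<xi> x) UNIV" for \<xi>
    using has_sum_cmult_left[OF inner[of \<xi>], of "character \<xi> x"]
    by (simp add: G_def torus_character_def mult_ac)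
  have "(G has_sum \<phi> (t, x)) (UNIV \<times> UNIV)"
  proof -
    have "infsum G (UNIV \<times> UNIV) = (\<Sum>\<^sub>\<infinity>\<xi>. \<Sum>\<^sub>\<infinity>\<tau>. G (\<xi>, \<tau>))"
      by (rule infsum_Sigma_banach[OF sG, symmetric])
    also have "\<dots> = (\<Sum>\<^sub>\<infinity>\<xi>. fc_x \<phi> \<xi> t * character \<xi> x)"
      by (intro infsum_cong infsumI G1)
    also have "\<dots> = \<phi> (t, x)" using outer by (rule infsumI)
    finally show ?thesis using sG has_sum_infsum by fastforce
  qed
  then have "((\<lambda>(\<tau>, \<xi>). G (\<xi>, \<tau>)) has_sum \<phi> (t, x)) (UNIV \<times> UNIV)"
    by (subst (asm) has_sum_swap) (simp add: case_prod_unfold)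
  then show ?thesis by (simp add: z G_def case_prod_unfold)
qed

section \<open>Fourier coefficients of distributions\<close>

definition fourier_coeffs :: "functional \<Rightarrow> int \<times> int \<Rightarrow> complex" where
  "fourier_coeffs u k = fourier_coeff u (fst k) (snd k)"

text \<open>The coefficient families of distributions on the torus.\<close>

definition tempered2 :: "(int \<times> int \<Rightarrow> complex) \<Rightarrow> bool" where
  "tempered2 c \<longleftrightarrow> (\<exists>p C. \<forall>k. cmod (c k) \<le> C * wt2 k ^ p)"

lemma tempered2E:
  assumes "tempered2 c"
  obtains C p where "C \<ge> 0" "\<And>k. cmod (c k) \<le> C * wt2 k ^ p"
proof -
  obtain p C where *: "\<And>k. cmod (c k) \<le> C * wt2 k ^ p"
    using assms by (auto simp: tempered2_def)
  have "0 \<le> C * wt2 0 ^ p" using *[of 0] norm_ge_zero order_trans by blast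
  then have "0 \<le> C" by (simp add: wt2_def wt_def)
  then show ?thesis using that * by blast
qed

lemma tempered2_slice:
  assumes "tempered2 c" shows "tempered (\<lambda>\<tau>. c (\<tau>, \<xi>))"
proof -
  obtain C p where c: "C \<ge> 0" "\<And>k. cmod (c k) \<le> C * wt2 k ^ p" using assms tempered2E by blast
  show ?thesis unfolding tempered_def
    by (rule exI[of _ p], rule exI[of _ "C * wt \<xi> ^ p"])
      (use c(2)[of "(_, \<xi>)"] in \<open>simp add: wt2_def power_mult_distrib mult_ac\<close>)
qed

lemma fourier_coeff_eq: "fourier_coeff u \<tau> \<xi> = u (torus_character (- \<tau>, - \<xi>)) / of_real ((2 * pi)\<^sup>2)"
proof -
  have "(\<lambda>(t, x). exp (- (\<i> * complex_of_real (t * of_int \<tau> + x * of_int \<xi>)))) = torus_character (- \<tau>, - \<xi>)"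
    by (auto simp: fun_eq_iff torus_character_def character_def cis_mult cis_conv_exp algebra_simps mult_exp_exp)
  then show ?thesis by (simp add: fourier_coeff_def)
qed

text \<open>The sign of the index changes because a coefficient tests against the conjugate
  character while the pairing is bilinear.\<close>

lemma apply_torus_character: "u (torus_character k) = of_real ((2 * pi)\<^sup>2) * fourier_coeffs u (- k)"
  by (cases k) (simp add: fourier_coeffs_def fourier_coeff_eq)

lemma distributionsD:
  assumes "u \<in> distributions"
  shows "u \<in> extensional test_functions"
    "\<And>\<phi> \<psi>. \<phi> \<in> test_functions \<Longrightarrow> \<psi> \<in> test_functions \<Longrightarrow> u (\<lambda>z. \<phi> z + \<psi> z) = u \<phi> + u \<psi>"
    "\<And>c \<phi>. \<phi> \<in> test_functions \<Longrightarrow> u (\<lambda>z. c * \<phi> z) = c * u \<phi>"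
  using assms by (auto simp: distributions_def)

lemma distribution_bound:
  assumes "u \<in> distributions"
  shows "\<exists>K N. K \<ge> 0 \<and> (\<forall>\<phi>\<in>test_functions. cmod (u \<phi>) \<le> K * test_seminorm N \<phi>)"
proof -
  obtain N K where K: "\<forall>\<phi>\<in>test_functions. cmod (u \<phi>) \<le> K * test_seminorm N \<phi>"
    using assms unfolding distributions_def by blast
  have "test_seminorm N \<phi> \<ge> 0" if "\<phi> \<in> test_functions" for \<phi>
    using order_trans[OF norm_ge_zero norm_le_SUP_test[OF that]] SUP_le_test_seminorm[OF that, of 0 N 0] by fastforce
  then have "cmod (u \<phi>) \<le> \<bar>K\<bar> * test_seminorm N \<phi>" if "\<phi> \<in> test_functions" for \<phi>
    using bspec[OF K that] that mult_right_mono[of K "\<bar>K\<bar>" "test_seminorm N \<phi>"] by fastforce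
  then show ?thesis by (intro exI[of _ "\<bar>K\<bar>"] exI[of _ N]) auto
qed

lemma torus_poly:
  assumes "finite F"
  shows "(\<lambda>z. \<Sum>k\<in>F. c k * torus_character k z) \<in> test_functions"
    and "torus_fc (\<lambda>z. \<Sum>k\<in>F. c k * torus_character k z) l = (if l \<in> F then c l else 0)"
    and "u \<in> distributions \<Longrightarrow> u (\<lambda>z. \<Sum>k\<in>F. c k * torus_character k z) = (\<Sum>k\<in>F. c k * u (torus_character k))"
proof -
  have "(\<lambda>z. \<Sum>k\<in>F. c k * torus_character k z) \<in> test_functions \<and>
    torus_fc (\<lambda>z. \<Sum>k\<in>F. c k * torus_character k z) l = (if l \<in> F then c l else 0) \<and>
    (u \<in> distributions \<longrightarrow> u (\<lambda>z. \<Sum>k\<in>F. c k * torus_character k z) = (\<Sum>k\<in>F. c k * u (torus_character k)))"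
    using assms
  proof (induction F)
    case empty
    have "torus_fc (\<lambda>z. 0) l = 0" using torus_fc_cmult[of 0 "\<lambda>_. 0" l] by simp
    moreover have "u \<in> distributions \<Longrightarrow> u (\<lambda>z. 0) = 0"
      using distributionsD(3)[of u "\<lambda>_. 0" 0] test_const[of 0] by simp
    ultimately show ?case using test_const by simp
  next
    case (insert k F)
    have t: "(\<lambda>z. c k * torus_character k z) \<in> test_functions"
      by (intro test_cmult torus_character_test)
    let ?P = "\<lambda>z. \<Sum>k\<in>F. c k * torus_character k z"
    have P: "?P \<in> test_functions" using insert.IH by blast
    have split: "(\<lambda>z. \<Sum>k\<in>insert k F. c k * torus_character k z) = (\<lambda>z. c k * torus_character k z + ?P z)"
      using insert.hyps by simp
    have "u (\<lambda>z. c k * torus_character k z + ?P z) = c k * u (torus_character k) + u ?P" if "u \<in> distributions"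
      using distributionsD(2)[OF that t P] distributionsD(3)[OF that torus_character_test, of "c k" k] by simp
    then show ?case
      unfolding split using insert test_add[OF t P] torus_fc_add[OF t P]
      by (auto simp: torus_fc_cmult torus_fc_character)
  qed
  then show "(\<lambda>z. \<Sum>k\<in>F. c k * torus_character k z) \<in> test_functions"
    "torus_fc (\<lambda>z. \<Sum>k\<in>F. c k * torus_character k z) l = (if l \<in> F then c l else 0)"
    "u \<in> distributions \<Longrightarrow> u (\<lambda>z. \<Sum>k\<in>F. c k * torus_character k z) = (\<Sum>k\<in>F. c k * u (torus_character k))"
    by auto
qed

lemma norm_partials_iter_le:
  assumes "\<phi> \<in> test_functions"
  shows "(SUP z. cmod ((partial_t ^^ m) ((partial_x ^^ n) \<phi>) z)) \<le> (\<Sum>\<^sub>\<infinity>k. wt2 k ^ (m + n) * cmod (torus_fc \<phi> k))"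
proof (rule cSUP_least)
  fix z
  let ?\<psi> = "(partial_t ^^ m) ((partial_x ^^ n) \<phi>)"
  show "cmod (?\<psi> z) \<le> (\<Sum>\<^sub>\<infinity>k. wt2 k ^ (m + n) * cmod (torus_fc \<phi> k))"
  proof (rule norm_infsum_le)
    show "((\<lambda>k. torus_fc ?\<psi> k * torus_character k z) has_sum ?\<psi> z) UNIV"
      by (intro torus_fourier_inversion test_partials_iter assms)
    show "((\<lambda>k. wt2 k ^ (m + n) * cmod (torus_fc \<phi> k)) has_sum (\<Sum>\<^sub>\<infinity>k. wt2 k ^ (m + n) * cmod (torus_fc \<phi> k))) UNIV"
      using torus_fc_summable[OF assms, of "m + n"] by (intro has_sum_infsum) (simp add: mult.commute)
    fix k
    have le: "\<bar>real_of_int (fst k)\<bar> \<le> wt2 k" "\<bar>real_of_int (snd k)\<bar> \<le> wt2 k"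
      using wt2_ge[of k] by (auto simp: wt_def)
    then have "\<bar>real_of_int (fst k)\<bar> ^ m * \<bar>real_of_int (snd k)\<bar> ^ n \<le> wt2 k ^ m * wt2 k ^ n"
      by (intro mult_mono power_mono) auto
    then have "\<bar>real_of_int (fst k)\<bar> ^ m * \<bar>real_of_int (snd k)\<bar> ^ n * cmod (torus_fc \<phi> k) \<le> wt2 k ^ (m + n) * cmod (torus_fc \<phi> k)"
      by (intro mult_right_mono) (auto simp: power_add)
    then show "cmod (torus_fc ?\<psi> k * torus_character k z) \<le> wt2 k ^ (m + n) * cmod (torus_fc \<phi> k)"
      by (simp add: torus_fc_partials_iter assms norm_mult norm_power)
  qed
qed auto

text \<open>The converse of \<open>torus_fc_decay\<close>: by inversion, weighted sums of
  coefficients control the seminorms. The exponent 2 * N allows for N derivatives in each variable,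
  and the square counts the pairs of orders.\<close>

lemma test_seminorm_le:
  assumes "\<phi> \<in> test_functions"
  shows "test_seminorm N \<phi> \<le> (real N + 1)\<^sup>2 * (\<Sum>\<^sub>\<infinity>k. wt2 k ^ (2 * N) * cmod (torus_fc \<phi> k))"
proof -
  let ?S = "\<Sum>\<^sub>\<infinity>k. wt2 k ^ (2 * N) * cmod (torus_fc \<phi> k)"
  have s: "(\<lambda>k. wt2 k ^ p * cmod (torus_fc \<phi> k)) summable_on UNIV" for p
    using torus_fc_summable[OF assms, of p] by (simp add: mult.commute)
  have "(SUP z. cmod ((partial_t ^^ m) ((partial_x ^^ n) \<phi>) z)) \<le> ?S" if "m \<le> N" "n \<le> N" for m n
  proof -
    have "(\<Sum>\<^sub>\<infinity>k. wt2 k ^ (m + n) * cmod (torus_fc \<phi> k)) \<le> ?S"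
      by (intro infsum_mono s mult_right_mono power_increasing) (use that wt2_ge1 in auto)
    then show ?thesis using norm_partials_iter_le[OF assms, of m n] by linarith
  qed
  then have "test_seminorm N \<phi> \<le> (\<Sum>m\<le>N. \<Sum>n\<le>N. ?S)"
    unfolding test_seminorm_def by (intro sum_mono) auto
  then show ?thesis by (simp add: power2_eq_square algebra_simps)
qed

text \<open>This is continuity of \<open>u\<close>: the remainder after a finite set F has its
  coefficients off F, so its seminorm is bounded by a tail of a convergent sum.\<close>

lemma distribution_has_sum:
  assumes u: "u \<in> distributions" and \<psi>: "\<psi> \<in> test_functions"
  shows "((\<lambda>k. torus_fc \<psi> k * u (torus_character k)) has_sum u \<psi>) UNIV"
proof -
  obtain K N where K: "K \<ge> 0" "\<forall>\<phi>\<in>test_functions. cmod (u \<phi>) \<le> K * test_seminorm N \<phi>"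
    using distribution_bound[OF u] by (elim exE conjE)
  define h where "h = (\<lambda>k. wt2 k ^ (2 * N) * cmod (torus_fc \<psi> k))"
  have h: "h summable_on UNIV"
    using torus_fc_summable[OF \<psi>, of "2 * N"] by (simp add: h_def mult.commute)
  have bound: "cmod ((\<Sum>k\<in>F. torus_fc \<psi> k * u (torus_character k)) - u \<psi>) \<le>
      K * ((real N + 1)\<^sup>2 * (infsum h UNIV - sum h F))" if F: "finite F" for F
  proof -
    define P where "P = (\<lambda>z. \<Sum>k\<in>F. torus_fc \<psi> k * torus_character k z)"
    define R where "R = (\<lambda>z. \<psi> z + (- 1) * P z)"
    have P: "P \<in> test_functions" unfolding P_def by (rule torus_poly(1)[OF F])
    have mP: "(\<lambda>z. (- 1) * P z) \<in> test_functions" by (rule test_cmult[OF P])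
    have R: "R \<in> test_functions" unfolding R_def by (rule test_add[OF \<psi> mP])
    have "u P = (\<Sum>k\<in>F. torus_fc \<psi> k * u (torus_character k))" unfolding P_def by (rule torus_poly(3)[OF F u])
    then have "u R = u \<psi> - (\<Sum>k\<in>F. torus_fc \<psi> k * u (torus_character k))"
      unfolding R_def using distributionsD(2)[OF u \<psi> mP] distributionsD(3)[OF u P, of "- 1"] by simp
    then have "cmod ((\<Sum>k\<in>F. torus_fc \<psi> k * u (torus_character k)) - u \<psi>) = cmod (u R)"
      by (simp add: norm_minus_commute)
    also have "\<dots> \<le> K * test_seminorm N R" by (rule bspec[OF K(2) R])
    also have "\<dots> \<le> K * ((real N + 1)\<^sup>2 * (\<Sum>\<^sub>\<infinity>k. wt2 k ^ (2 * N) * cmod (torus_fc R k)))"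
      by (intro mult_left_mono test_seminorm_le R K)
    also have "(\<Sum>\<^sub>\<infinity>k. wt2 k ^ (2 * N) * cmod (torus_fc R k)) = infsum h (UNIV - F)"
    proof (rule infsum_cong_neutral)
      have tR: "torus_fc R k = (if k \<in> F then 0 else torus_fc \<psi> k)" for k
      proof -
        have "torus_fc R k = torus_fc \<psi> k + (- 1) * torus_fc P k"
          unfolding R_def torus_fc_add[OF \<psi> mP] torus_fc_cmult ..
        then show ?thesis by (simp add: P_def torus_poly(2)[OF F])
      qed
      show "wt2 k ^ (2 * N) * cmod (torus_fc R k) = 0" if "k \<in> UNIV - (UNIV - F)" for k
        using that by (simp add: tR)
      show "wt2 k ^ (2 * N) * cmod (torus_fc R k) = h k" if "k \<in> UNIV \<inter> (UNIV - F)" for k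
        using that by (simp add: tR h_def)
    qed auto
    also have "infsum h (UNIV - F) = infsum h UNIV - sum h F"
      using infsum_Diff[OF h, of F] F by simp
    finally show ?thesis .
  qed
  have "((\<lambda>F. K * ((real N + 1)\<^sup>2 * (infsum h UNIV - sum h F))) \<longlongrightarrow> K * ((real N + 1)\<^sup>2 * (infsum h UNIV - infsum h UNIV))) (finite_subsets_at_top UNIV)"
    by (intro tendsto_intros infsum_tendsto h)
  then have "((\<lambda>F. (\<Sum>k\<in>F. torus_fc \<psi> k * u (torus_character k)) - u \<psi>) \<longlongrightarrow> 0) (finite_subsets_at_top UNIV)"
    by (intro Lim_null_comparison[OF eventually_finite_subsets_at_top_weakI[OF bound]]) auto
  then show ?thesis unfolding has_sum_def by (simp add: Lim_null[symmetric])
qed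

text \<open>Parseval's relation for the bilinear pairing, hence the index - k.\<close>

lemma distribution_series:
  assumes u: "u \<in> distributions" and \<psi>: "\<psi> \<in> test_functions"
  shows "u \<psi> = of_real ((2 * pi)\<^sup>2) * (\<Sum>\<^sub>\<infinity>k. torus_fc \<psi> (- k) * fourier_coeffs u k)"
proof -
  have "u \<psi> = (\<Sum>\<^sub>\<infinity>k. torus_fc \<psi> k * u (torus_character k))"
    by (rule infsumI[symmetric, OF distribution_has_sum[OF assms]])
  also have "\<dots> = (\<Sum>\<^sub>\<infinity>k. of_real ((2 * pi)\<^sup>2) * (torus_fc \<psi> (- k) * fourier_coeffs u k))"
    by (rule infsum_reindex_bij_witness[of UNIV uminus uminus]) (auto simp: apply_torus_character)
  finally show ?thesis unfolding infsum_cmult_right' .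
qed

text \<open>The coefficients determine the values on test functions through the series;
  \<open>extensional\<close> settles all other arguments.\<close>

lemma distribution_eqI:
  assumes "u \<in> distributions" "v \<in> distributions" "fourier_coeffs u = fourier_coeffs v"
  shows "u = v"
proof (rule extensionalityI)
  show "u \<in> extensional test_functions" "v \<in> extensional test_functions"
    using assms distributionsD(1) by auto
  show "u \<psi> = v \<psi>" if "\<psi> \<in> test_functions" for \<psi>
    using distribution_series[OF assms(1) that] distribution_series[OF assms(2) that] assms(3) by simp
qed

lemma test_seminorm_torus_character:
  "test_seminorm N (torus_character k) \<le> (real N + 1)\<^sup>2 * wt2 k ^ (2 * N)"
proof -
  have "(\<Sum>\<^sub>\<infinity>l. wt2 l ^ (2 * N) * cmod (torus_fc (torus_character k) l)) =
      (\<Sum>\<^sub>\<infinity>l\<in>{k}. wt2 l ^ (2 * N) * cmod (torus_fc (torus_character k) l))"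
    by (rule infsum_cong_neutral) (auto simp: torus_fc_character)
  then show ?thesis
    using test_seminorm_le[OF torus_character_test, of N k] by (simp add: torus_fc_character)
qed

lemma tempered2_coeffs:
  assumes "u \<in> distributions" shows "tempered2 (fourier_coeffs u)"
proof -
  obtain K N where K: "K \<ge> 0" "\<forall>\<phi>\<in>test_functions. cmod (u \<phi>) \<le> K * test_seminorm N \<phi>"
    using distribution_bound[OF assms] by (elim exE conjE)
  have "cmod (fourier_coeffs u k) \<le> (K * (real N + 1)\<^sup>2 / (2 * pi)\<^sup>2) * wt2 k ^ (2 * N)" for k
  proof -
    have "cmod (fourier_coeffs u k) = cmod (u (torus_character (- k))) / (2 * pi)\<^sup>2"
      unfolding apply_torus_character norm_mult norm_of_real by simp
    also have "\<dots> \<le> (K * ((real N + 1)\<^sup>2 * wt2 k ^ (2 * N))) / (2 * pi)\<^sup>2"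
      using bspec[OF K(2) torus_character_test[of "- k"]] mult_left_mono[OF test_seminorm_torus_character[of N "- k"] K(1)]
      by (intro divide_right_mono) auto
    finally show ?thesis by simp
  qed
  then show ?thesis unfolding tempered2_def by blast
qed

text \<open>The inverse of \<open>fourier_coeffs\<close> on \<open>tempered2\<close> families,
  defined by the series that any distribution must satisfy.\<close>

definition dist_of_coeffs :: "(int \<times> int \<Rightarrow> complex) \<Rightarrow> functional" where
  "dist_of_coeffs c = (\<lambda>\<phi>\<in>test_functions. of_real ((2 * pi)\<^sup>2) * (\<Sum>\<^sub>\<infinity>k. torus_fc \<phi> (- k) * c k))"

lemma pairing_bound:
  assumes "\<And>k. cmod (c k) \<le> C * wt2 k ^ p" "C \<ge> 0" "\<phi> \<in> test_functions"
  shows "cmod (torus_fc \<phi> (- k) * c k) \<le> 4 * 4 ^ (p + 2) * C * test_seminorm (p + 2) \<phi> * (1 / wt2 k ^ 2)"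
proof -
  have "cmod (torus_fc \<phi> (- k) * c k) \<le> cmod (torus_fc \<phi> (- k)) * (C * wt2 k ^ p)"
    unfolding norm_mult by (intro mult_left_mono assms) auto
  also have "\<dots> = C * (cmod (torus_fc \<phi> (- k)) * wt2 (- k) ^ (p + 2)) * (1 / wt2 k ^ 2)"
    by (simp add: power_add power2_eq_square)
  also have "\<dots> \<le> C * (4 * 4 ^ (p + 2) * test_seminorm (p + 2) \<phi>) * (1 / wt2 k ^ 2)"
    by (intro mult_right_mono mult_left_mono torus_fc_decay assms) auto
  finally show ?thesis by (simp add: mult_ac)
qed

lemma pairing_summable:
  assumes "tempered2 c" "\<phi> \<in> test_functions"
  shows "(\<lambda>k. torus_fc \<phi> (- k) * c k) summable_on UNIV"
proof -
  obtain C p where c: "C \<ge> 0" "\<And>k. cmod (c k) \<le> C * wt2 k ^ p" using assms tempered2E by blast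
  have "(\<lambda>k. cmod (torus_fc \<phi> (- k) * c k)) summable_on UNIV"
  proof (rule Infinite_Sum.abs_summable_on_comparison_test')
    show "(\<lambda>k. 4 * 4 ^ (p + 2) * C * test_seminorm (p + 2) \<phi> * (1 / wt2 k ^ 2)) summable_on UNIV"
      by (intro summable_on_cmult_right wt2_summable)
  qed (rule pairing_bound[OF c(2,1) assms(2)])
  then show ?thesis by (rule abs_summable_summable)
qed

text \<open>Two derivatives beyond the growth order p make the pairing converge absolutely, with a
  bound by the seminorm of order p + 2; testing against a single character returns the
  coefficient.\<close>

lemma dist_of_coeffs:
  assumes "tempered2 c"
  shows "dist_of_coeffs c \<in> distributions" "fourier_coeffs (dist_of_coeffs c) = c"
proof -
  obtain C p where c: "C \<ge> 0" "\<And>k. cmod (c k) \<le> C * wt2 k ^ p" using assms tempered2E by blast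
  note s = pairing_summable[OF assms]
  show "dist_of_coeffs c \<in> distributions"
    unfolding distributions_def
  proof (intro CollectI conjI ballI allI)
    show "dist_of_coeffs c \<in> extensional test_functions" by (simp add: dist_of_coeffs_def)
    show "dist_of_coeffs c (\<lambda>z. \<phi> z + \<psi> z) = dist_of_coeffs c \<phi> + dist_of_coeffs c \<psi>"
      if "\<phi> \<in> test_functions" "\<psi> \<in> test_functions" for \<phi> \<psi>
      using that
      by (simp add: dist_of_coeffs_def test_add torus_fc_add distrib_right infsum_add s distrib_left)
    show "dist_of_coeffs c (\<lambda>z. d * \<phi> z) = d * dist_of_coeffs c \<phi>" if "\<phi> \<in> test_functions" for d \<phi>
      using that by (simp add: dist_of_coeffs_def test_cmult torus_fc_cmult mult.assoc infsum_cmult_right')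
    let ?K = "(2 * pi)\<^sup>2 * (4 * 4 ^ (p + 2) * C * (\<Sum>\<^sub>\<infinity>k. 1 / wt2 k ^ 2))"
    have "cmod (dist_of_coeffs c \<phi>) \<le> ?K * test_seminorm (p + 2) \<phi>" if "\<phi> \<in> test_functions" for \<phi>
    proof -
      have "cmod (\<Sum>\<^sub>\<infinity>k. torus_fc \<phi> (- k) * c k) \<le>
          (\<Sum>\<^sub>\<infinity>k. 4 * 4 ^ (p + 2) * C * test_seminorm (p + 2) \<phi> * (1 / wt2 k ^ 2))"
        by (rule norm_infsum_le[OF has_sum_infsum[OF s[OF that]] has_sum_infsum pairing_bound[OF c(2,1) that]])
          (intro summable_on_cmult_right wt2_summable)
      then have "(2 * pi)\<^sup>2 * cmod (\<Sum>\<^sub>\<infinity>k. torus_fc \<phi> (- k) * c k) \<le>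
          (2 * pi)\<^sup>2 * (4 * 4 ^ (p + 2) * C * test_seminorm (p + 2) \<phi> * (\<Sum>\<^sub>\<infinity>k. 1 / wt2 k ^ 2))"
        unfolding infsum_cmult_right' by (rule mult_left_mono) simp
      then show ?thesis using that
        by (simp add: dist_of_coeffs_def norm_mult norm_power mult_ac)
    qed
    then show "\<exists>N K. \<forall>\<phi>\<in>test_functions. cmod (dist_of_coeffs c \<phi>) \<le> K * test_seminorm N \<phi>" by blast
  qed
  show "fourier_coeffs (dist_of_coeffs c) = c"
  proof
    fix l
    have "(\<Sum>\<^sub>\<infinity>k. torus_fc (torus_character (- l)) (- k) * c k) =
      (\<Sum>\<^sub>\<infinity>k\<in>{l}. torus_fc (torus_character (- l)) (- k) * c k)"
      by (rule infsum_cong_neutral) (auto simp: torus_fc_character)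
    then have "dist_of_coeffs c (torus_character (- l)) = of_real ((2 * pi)\<^sup>2) * c l"
      by (simp add: dist_of_coeffs_def torus_character_test torus_fc_character)
    then show "fourier_coeffs (dist_of_coeffs c) l = c l"
      using apply_torus_character[of "dist_of_coeffs c" "- l"] by simp
  qed
qed

section \<open>The operator on the Fourier side\<close>

lemma smooth_circle_test:
  assumes "a \<in> smooth_circle"
  shows "(\<lambda>z. complex_of_real (a (fst z))) \<in> test_functions"
proof -
  note sm = smooth_circleD[OF assms]
  have "C_order k (\<lambda>z. complex_of_real ((deriv ^^ n) a (fst z)))" for k n
  proof (induction k arbitrary: n)
    case 0
    then show ?case
      by (auto intro!: continuous_intros continuous_on_compose2[OF sm(3)])
  next
    case (Suc k)
    have d: "((\<lambda>t. complex_of_real ((deriv ^^ n) a t)) has_vector_derivative complex_of_real ((deriv ^^ Suc n) a t)) (at t)" for t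
      by (rule has_vector_derivative_of_real_complex[OF sm(1)])
    have "partial_t (\<lambda>z. complex_of_real ((deriv ^^ n) a (fst z))) = (\<lambda>z. complex_of_real ((deriv ^^ Suc n) a (fst z)))"
      by (rule partial_t_eqI) (use d in simp)
    moreover have "partial_x (\<lambda>z. complex_of_real ((deriv ^^ n) a (fst z))) = (\<lambda>z. 0)"
      by (rule partial_x_eqI) simp
    moreover have "(\<lambda>z. complex_of_real ((deriv ^^ n) a (fst z))) differentiable (at z)" for z :: "real \<times> real"
      unfolding differentiable_def
      by (rule exI, rule has_derivative_compose[OF _ d[unfolded has_vector_derivative_def]])
        (rule derivative_intros, rule has_derivative_ident)
    ultimately show ?case using Suc[of "Suc n"] C_order_const[of k 0] by simp
  qed
  from this[of _ 0] show ?thesis using sm(2)[of 0] by (simp add: test_functions_def)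
qed

lemma rapid_fc_smooth_circle:
  assumes "a \<in> smooth_circle" shows "rapid (fc (\<lambda>t. complex_of_real (a t)))"
  using rapid_fc_smooth[of "\<lambda>k t. complex_of_real ((deriv ^^ k) a t)"]
    has_vector_derivative_of_real_complex[OF smooth_circleD(1)[OF assms]] smooth_circleD(2)[OF assms] by simp

text \<open>Since \<open>a\<close> depends on t only, it passes through the coefficient in x, and
  the product becomes a convolution in \<tau> at fixed \<xi>.\<close>

lemma torus_fc_mult_smooth_circle:
  assumes a: "a \<in> smooth_circle" and \<phi>: "\<phi> \<in> test_functions"
  shows "torus_fc (\<lambda>z. complex_of_real (a (fst z)) * \<phi> z) (\<tau>, \<xi>) =
    conv (fc (\<lambda>t. complex_of_real (a t))) (\<lambda>\<sigma>. torus_fc \<phi> (\<sigma>, \<xi>)) \<tau>"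
proof -
  note sm = smooth_circleD[OF a]
  have s: "(\<lambda>n. cmod (fc (\<lambda>t. complex_of_real (a t)) n)) summable_on UNIV"
    using rapid_summable[OF rapid_fc_smooth_circle[OF a], of 0] by simp
  have ser: "of_real (a t) = (\<Sum>\<^sub>\<infinity>n. fc (\<lambda>t. complex_of_real (a t)) n * character n t)" for t
    by (rule infsumI[symmetric], rule fourier_inversion[OF _ has_vector_derivative_of_real_complex[OF sm(1)[of 0, simplified]]])
      (use sm(2)[of 0] sm(3)[of 1] s in \<open>auto intro!: continuous_intros\<close>)
  obtain B where B: "\<And>z. cmod (\<phi> z) \<le> B" using test_bounded[OF \<phi>] by blast
  have "fc_x (\<lambda>z. complex_of_real (a (fst z)) * \<phi> z) \<xi> = (\<lambda>t. of_real (a t) * fc_x \<phi> \<xi> t)"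
    by (simp add: fun_eq_iff fc_x_def fc_cmult)
  moreover have "fc (\<lambda>t. of_real (a t) * fc_x \<phi> \<xi> t) \<tau> = conv (fc (\<lambda>t. complex_of_real (a t))) (fc (fc_x \<phi> \<xi>)) \<tau>"
  proof (rule fc_mult[OF s ser])
    show "continuous_on UNIV (fc_x \<phi> \<xi>)" by (intro continuous_on_fc_x test_functionsD[OF \<phi>])
    show "cmod (fc_x \<phi> \<xi> t) \<le> B" for t
      unfolding fc_x_def by (intro norm_fc_le continuous_slices test_functionsD[OF \<phi>] B)
  qed
  ultimately show ?thesis by (simp add: torus_fc_def[abs_def])
qed

text \<open>Multiplication by \<open>a\<close> on the Fourier side is self-adjoint for the bilinear pairing.\<close>
lemma conv_pairing:
  assumes k: "rapid k" and c: "tempered2 c" and \<phi>: "\<phi> \<in> test_functions"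
  shows "(\<Sum>\<^sub>\<infinity>(\<tau>, \<xi>). of_int \<xi> * c (\<tau>, \<xi>) * conv k (\<lambda>\<sigma>. torus_fc \<phi> (\<sigma>, - \<xi>)) (- \<tau>)) =
    (\<Sum>\<^sub>\<infinity>(\<tau>, \<xi>). of_int \<xi> * torus_fc \<phi> (- \<tau>, - \<xi>) * conv k (\<lambda>\<sigma>. c (\<sigma>, \<xi>)) \<tau>)"
    and "(\<lambda>(\<tau>, \<xi>). of_int \<xi> * torus_fc \<phi> (- \<tau>, - \<xi>) * conv k (\<lambda>\<sigma>. c (\<sigma>, \<xi>)) \<tau>) summable_on UNIV"
proof -
  obtain C p where C: "C \<ge> 0" "\<And>k. cmod (c k) \<le> C * wt2 k ^ p" using c tempered2E by blast
  define H where "H = (\<lambda>((\<tau>, \<xi>), \<sigma>). of_int \<xi> * torus_fc \<phi> (- \<tau>, - \<xi>) * (k \<sigma> * c (\<tau> - \<sigma>, \<xi>)))"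
  define G where "G = (\<lambda>((\<tau>, \<xi>), \<sigma>). of_int \<xi> * c (\<tau>, \<xi>) * (k \<sigma> * torus_fc \<phi> (- \<tau> - \<sigma>, - \<xi>)))"
  have sT: "(\<lambda>l. cmod (torus_fc \<phi> (- l)) * wt2 l ^ (p + 1)) summable_on UNIV"
  proof -
    have "(\<lambda>l. cmod (torus_fc \<phi> (- l)) * wt2 l ^ (p + 1)) summable_on UNIV \<longleftrightarrow>
        (\<lambda>l. cmod (torus_fc \<phi> l) * wt2 l ^ (p + 1)) summable_on UNIV"
      by (rule summable_on_reindex_bij_witness[of UNIV uminus uminus]) auto
    then show ?thesis using torus_fc_summable[OF \<phi>, of "p + 1"] by simp
  qed
  \<comment> \<open>The factor \<bar>\<xi>\<bar> and the growth of \<open>c\<close> are absorbed by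
    the decay of the test coefficients, the shift by \<sigma> by the decay of
    \<open>k\<close>.\<close>
  have sH: "H summable_on UNIV \<times> UNIV"
  proof (rule abs_summable_summable, rule Infinite_Sum.abs_summable_on_comparison_test')
    show "(\<lambda>x. C * (\<lambda>(l, \<sigma>). (cmod (torus_fc \<phi> (- l)) * wt2 l ^ (p + 1)) * (cmod (k \<sigma>) * wt \<sigma> ^ p)) x) summable_on UNIV \<times> UNIV"
      by (intro summable_on_cmult_right summable_on_times sT rapid_summable k)
    fix x :: "(int \<times> int) \<times> int"
    obtain \<tau> \<xi> \<sigma> where x: "x = ((\<tau>, \<xi>), \<sigma>)" by (metis surj_pair)
    have "wt2 (\<tau> - \<sigma>, \<xi>) ^ p \<le> wt2 (\<tau>, \<xi>) ^ p * wt \<sigma> ^ p"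
      using mult_right_mono[OF wt_power_diff_le[of \<tau> \<sigma> p], of "wt \<xi> ^ p"]
      by (simp add: wt2_def power_mult_distrib mult_ac)
    then have c1: "cmod (c (\<tau> - \<sigma>, \<xi>)) \<le> C * (wt2 (\<tau>, \<xi>) ^ p * wt \<sigma> ^ p)"
      using C(2)[of "(\<tau> - \<sigma>, \<xi>)"] mult_left_mono[OF _ C(1)] order_trans by blast
    have x1: "\<bar>real_of_int \<xi>\<bar> \<le> wt2 (\<tau>, \<xi>)" using wt2_ge(2)[of "(\<tau>, \<xi>)"] by (simp add: wt_def)
    have "cmod (H x) = (\<bar>real_of_int \<xi>\<bar> * cmod (c (\<tau> - \<sigma>, \<xi>))) * (cmod (torus_fc \<phi> (- \<tau>, - \<xi>)) * cmod (k \<sigma>))"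
      by (simp add: x H_def norm_mult)
    also have "\<dots> \<le> (wt2 (\<tau>, \<xi>) * (C * (wt2 (\<tau>, \<xi>) ^ p * wt \<sigma> ^ p))) * (cmod (torus_fc \<phi> (- \<tau>, - \<xi>)) * cmod (k \<sigma>))"
      by (intro mult_right_mono mult_mono c1 x1) (auto simp: C(1))
    finally show "cmod (H x) \<le> C * (\<lambda>(l, \<sigma>). (cmod (torus_fc \<phi> (- l)) * wt2 l ^ (p + 1)) * (cmod (k \<sigma>) * wt \<sigma> ^ p)) x"
      by (simp add: x mult_ac)
  qed
  \<comment> \<open>Shifting \<tau> by \<sigma> identifies the two triple families, so they are
    summable together with equal sums.\<close>
  have GH: "(G summable_on UNIV \<times> UNIV) = (H summable_on UNIV \<times> UNIV)" "infsum G (UNIV \<times> UNIV) = infsum H (UNIV \<times> UNIV)"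
    by (rule summable_on_reindex_bij_witness[of _ "\<lambda>((\<tau>, \<xi>), \<sigma>). ((\<tau> - \<sigma>, \<xi>), \<sigma>)" "\<lambda>((\<tau>, \<xi>), \<sigma>). ((\<tau> + \<sigma>, \<xi>), \<sigma>)"]
        infsum_reindex_bij_witness[of _ "\<lambda>((\<tau>, \<xi>), \<sigma>). ((\<tau> - \<sigma>, \<xi>), \<sigma>)" "\<lambda>((\<tau>, \<xi>), \<sigma>). ((\<tau> + \<sigma>, \<xi>), \<sigma>)"];
        auto simp: G_def H_def algebra_simps)+
  have Hi: "(\<Sum>\<^sub>\<infinity>\<sigma>. H (l, \<sigma>)) = (\<lambda>(\<tau>, \<xi>). of_int \<xi> * torus_fc \<phi> (- \<tau>, - \<xi>) * conv k (\<lambda>\<sigma>. c (\<sigma>, \<xi>)) \<tau>) l" for l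
    by (simp add: H_def case_prod_unfold infsum_cmult_right' conv_def)
  have Gi: "(\<Sum>\<^sub>\<infinity>\<sigma>. G (l, \<sigma>)) = (\<lambda>(\<tau>, \<xi>). of_int \<xi> * c (\<tau>, \<xi>) * conv k (\<lambda>\<sigma>. torus_fc \<phi> (\<sigma>, - \<xi>)) (- \<tau>)) l" for l
    by (simp add: G_def case_prod_unfold infsum_cmult_right' conv_def)
  have "(\<Sum>\<^sub>\<infinity>l. \<Sum>\<^sub>\<infinity>\<sigma>. G (l, \<sigma>)) = (\<Sum>\<^sub>\<infinity>l. \<Sum>\<^sub>\<infinity>\<sigma>. H (l, \<sigma>))"
    using infsum_Sigma_banach[OF sH] infsum_Sigma_banach[of G UNIV "\<lambda>_. UNIV"] GH sH by simp
  then show "(\<Sum>\<^sub>\<infinity>(\<tau>, \<xi>). of_int \<xi> * c (\<tau>, \<xi>) * conv k (\<lambda>\<sigma>. torus_fc \<phi> (\<sigma>, - \<xi>)) (- \<tau>)) =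
    (\<Sum>\<^sub>\<infinity>(\<tau>, \<xi>). of_int \<xi> * torus_fc \<phi> (- \<tau>, - \<xi>) * conv k (\<lambda>\<sigma>. c (\<sigma>, \<xi>)) \<tau>)"
    unfolding Hi Gi .
  have "(\<lambda>l. \<Sum>\<^sub>\<infinity>\<sigma>. H (l, \<sigma>)) summable_on UNIV"
    using summable_on_Sigma_banach[of "\<lambda>l \<sigma>. H (l, \<sigma>)" UNIV "\<lambda>_. UNIV"] sH by simp
  then show "(\<lambda>(\<tau>, \<xi>). of_int \<xi> * torus_fc \<phi> (- \<tau>, - \<xi>) * conv k (\<lambda>\<sigma>. c (\<sigma>, \<xi>)) \<tau>) summable_on UNIV"
    unfolding Hi .
qed

text \<open>The action of the operator on coefficients; \<xi> is a mere parameter, so the slices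
  decouple.\<close>

definition L_symbol :: "(real \<Rightarrow> real) \<Rightarrow> (int \<times> int \<Rightarrow> complex) \<Rightarrow> int \<times> int \<Rightarrow> complex" where
  "L_symbol a c = (\<lambda>(\<tau>, \<xi>). \<i> * of_int \<tau> * c (\<tau>, \<xi>) -
     \<i> * of_int \<xi> * conv (fc (\<lambda>t. complex_of_real (a t))) (\<lambda>\<sigma>. c (\<sigma>, \<xi>)) \<tau>)"

text \<open>Moving both derivatives onto the test function leaves u applied to
  \<open>partial_x\<close> of a \<phi> minus u applied to \<open>partial_t \<phi>\<close>. The
  series holds for every test function, so \<open>L_op a u\<close> can be compared with a
  distribution by extensionality.\<close>

lemma L_op_series:
  assumes a: "a \<in> smooth_circle" and u: "u \<in> distributions" and \<phi>: "\<phi> \<in> test_functions"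
  shows "L_op a u \<phi> = of_real ((2 * pi)\<^sup>2) * (\<Sum>\<^sub>\<infinity>k. torus_fc \<phi> (- k) * L_symbol a (fourier_coeffs u) k)"
proof -
  let ?ah = "fc (\<lambda>t. complex_of_real (a t))" and ?c = "fourier_coeffs u"
  define a\<phi> where "a\<phi> = (\<lambda>z. complex_of_real (a (fst z)) * \<phi> z)"
  have a\<phi>: "a\<phi> \<in> test_functions" unfolding a\<phi>_def by (intro test_mult smooth_circle_test a \<phi>)
  have c: "tempered2 ?c" by (rule tempered2_coeffs[OF u])
  have "L_op a u \<phi> = u (partial_x a\<phi>) - u (partial_t \<phi>)"
    using \<phi> a\<phi> by (simp add: L_op_def dist_diff_def dist_partial_t_def dist_mult_def dist_partial_x_def a\<phi>_def case_prod_unfold)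
  also have "u (partial_x a\<phi>) = of_real ((2 * pi)\<^sup>2) * (\<Sum>\<^sub>\<infinity>k. torus_fc (partial_x a\<phi>) (- k) * ?c k)"
    by (intro distribution_series u test_partial_x a\<phi>)
  also have "(\<Sum>\<^sub>\<infinity>k. torus_fc (partial_x a\<phi>) (- k) * ?c k) =
      (\<Sum>\<^sub>\<infinity>k. (- \<i>) * (case k of (\<tau>, \<xi>) \<Rightarrow> of_int \<xi> * ?c (\<tau>, \<xi>) * conv ?ah (\<lambda>\<sigma>. torus_fc \<phi> (\<sigma>, - \<xi>)) (- \<tau>)))"
    by (intro infsum_cong) (auto simp: torus_fc_partial_x[OF a\<phi>] torus_fc_mult_smooth_circle[OF a \<phi>, folded a\<phi>_def])
  also have "\<dots> = (\<Sum>\<^sub>\<infinity>k. (- \<i>) * (case k of (\<tau>, \<xi>) \<Rightarrow> of_int \<xi> * torus_fc \<phi> (- \<tau>, - \<xi>) * conv ?ah (\<lambda>\<sigma>. ?c (\<sigma>, \<xi>)) \<tau>))"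
    unfolding infsum_cmult_right' using conv_pairing(1)[OF rapid_fc_smooth_circle[OF a] c \<phi>] by simp
  also have "u (partial_t \<phi>) = of_real ((2 * pi)\<^sup>2) * (\<Sum>\<^sub>\<infinity>k. torus_fc (partial_t \<phi>) (- k) * ?c k)"
    by (intro distribution_series u test_partial_t \<phi>)
  finally have "L_op a u \<phi> = of_real ((2 * pi)\<^sup>2) *
     ((\<Sum>\<^sub>\<infinity>k. (- \<i>) * (case k of (\<tau>, \<xi>) \<Rightarrow> of_int \<xi> * torus_fc \<phi> (- \<tau>, - \<xi>) * conv ?ah (\<lambda>\<sigma>. ?c (\<sigma>, \<xi>)) \<tau>)) +
      (- 1) * (\<Sum>\<^sub>\<infinity>k. torus_fc (partial_t \<phi>) (- k) * ?c k))"
    by (simp add: algebra_simps)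
  also have "\<dots> = of_real ((2 * pi)\<^sup>2) *
     (\<Sum>\<^sub>\<infinity>k. (- \<i>) * (case k of (\<tau>, \<xi>) \<Rightarrow> of_int \<xi> * torus_fc \<phi> (- \<tau>, - \<xi>) * conv ?ah (\<lambda>\<sigma>. ?c (\<sigma>, \<xi>)) \<tau>) +
      (- 1) * (torus_fc (partial_t \<phi>) (- k) * ?c k))"
    unfolding infsum_cmult_right'[of "- 1", symmetric]
    by (subst infsum_add)
      (intro summable_on_cmult_right conv_pairing(2) pairing_summable rapid_fc_smooth_circle a c \<phi> test_partial_t refl)+
  also have "\<dots> = of_real ((2 * pi)\<^sup>2) * (\<Sum>\<^sub>\<infinity>k. torus_fc \<phi> (- k) * L_symbol a ?c k)"
    by (intro arg_cong2[of _ _ _ _ "(*)"] infsum_cong refl)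
      (auto simp: torus_fc_partial_t[OF \<phi>] L_symbol_def algebra_simps)
  finally show ?thesis .
qed

lemma coeffs_L_op:
  assumes a: "a \<in> smooth_circle" and u: "u \<in> distributions"
  shows "fourier_coeffs (L_op a u) = L_symbol a (fourier_coeffs u)"
proof
  fix l
  have "(\<Sum>\<^sub>\<infinity>k. torus_fc (torus_character (- l)) (- k) * L_symbol a (fourier_coeffs u) k) =
    (\<Sum>\<^sub>\<infinity>k\<in>{l}. torus_fc (torus_character (- l)) (- k) * L_symbol a (fourier_coeffs u) k)"
    by (rule infsum_cong_neutral) (auto simp: torus_fc_character)
  then have "L_op a u (torus_character (- l)) = of_real ((2 * pi)\<^sup>2) * L_symbol a (fourier_coeffs u) l"
    using L_op_series[OF assms torus_character_test, of "- l"] by (simp add: torus_fc_character)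
  then show "fourier_coeffs (L_op a u) l = L_symbol a (fourier_coeffs u) l"
    using apply_torus_character[of "L_op a u" "- l"] by simp
qed

lemma L_op_eq_iff:
  assumes a: "a \<in> smooth_circle" and u: "u \<in> distributions" and f: "f \<in> distributions"
  shows "L_op a u = f \<longleftrightarrow> L_symbol a (fourier_coeffs u) = fourier_coeffs f"
proof
  assume "L_op a u = f"
  then show "L_symbol a (fourier_coeffs u) = fourier_coeffs f" using coeffs_L_op[OF a u] by simp
next
  assume eq: "L_symbol a (fourier_coeffs u) = fourier_coeffs f"
  show "L_op a u = f"
  proof (rule extensionalityI)
    show "L_op a u \<in> extensional test_functions" by (simp add: L_op_def dist_diff_def)
    show "f \<in> extensional test_functions" by (rule distributionsD(1)[OF f])
    show "L_op a u \<phi> = f \<phi>" if "\<phi> \<in> test_functions" for \<phi>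
      using L_op_series[OF a u that] distribution_series[OF f that] eq by simp
  qed
qed

section \<open>Small divisors and the final estimate\<close>

text \<open>Rounding \<alpha> q down gives an error below 1 / q for every q. The bound ensures r > 1
  later, so that the bracket to the power 1 - r is at most 1.\<close>

lemma irrationality_measure_ge_1: "irrationality_measure \<alpha> \<ge> 1"
proof -
  let ?S = "{(p :: int, q :: nat). q > 0 \<and> \<bar>\<alpha> - of_int p / real q\<bar> < real q powr (- 1)}"
  have "(\<lambda>n. (\<lfloor>\<alpha> * real (Suc n)\<rfloor>, Suc n)) ` UNIV \<subseteq> ?S"
  proof clarify
    fix n
    have "0 \<le> \<alpha> * real (Suc n) - of_int \<lfloor>\<alpha> * real (Suc n)\<rfloor>" "\<alpha> * real (Suc n) - of_int \<lfloor>\<alpha> * real (Suc n)\<rfloor> < 1"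
      by linarith+
    then have "\<bar>\<alpha> * real (Suc n) - of_int \<lfloor>\<alpha> * real (Suc n)\<rfloor>\<bar> / real (Suc n) < 1 / real (Suc n)"
      by (intro divide_strict_right_mono) auto
    moreover have "\<alpha> - of_int \<lfloor>\<alpha> * real (Suc n)\<rfloor> / real (Suc n) = (\<alpha> * real (Suc n) - of_int \<lfloor>\<alpha> * real (Suc n)\<rfloor>) / real (Suc n)"
      by (simp add: diff_divide_distrib)
    moreover have "real (Suc n) powr (- 1) = 1 / real (Suc n)" by (simp add: powr_minus_divide)
    ultimately show "0 < Suc n \<and> \<bar>\<alpha> - of_int \<lfloor>\<alpha> * real (Suc n)\<rfloor> / real (Suc n)\<bar> < real (Suc n) powr (- 1)"
      by (simp only: abs_divide abs_of_nat) simp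
  qed
  moreover have "infinite (range (\<lambda>n. (\<lfloor>\<alpha> * real (Suc n)\<rfloor>, Suc n)))"
    by (rule range_inj_infinite) (auto simp: inj_def)
  ultimately have "infinite ?S" using infinite_super by blast
  then have "ereal 1 \<in> ereal ` {\<nu>. \<nu> > 0 \<and>
       infinite {(p :: int, q :: nat). q > 0 \<and> \<bar>\<alpha> - of_int p / real q\<bar> < real q powr (- \<nu>)}}"
    by (intro imageI) simp
  then have "ereal 1 \<le> irrationality_measure \<alpha>"
    unfolding irrationality_measure_def by (rule Sup_upper)
  then show ?thesis by (simp add: one_ereal_def)
qed

text \<open>Above the supremum only finitely many pairs violate the bound with constant 1. They are
  repaired by a smaller constant, which is positive because irrationality excludes p = q
  \<alpha>.\<close>

lemma diophantine_lower_bound: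
  assumes irr: "\<alpha> \<notin> \<rat>" and r: "ereal r > irrationality_measure \<alpha>"
  obtains c where "0 < c" "c \<le> 1"
    "\<And>\<tau> \<xi> :: int. \<xi> \<noteq> 0 \<Longrightarrow> c * bracket \<xi> powr (1 - r) \<le> \<bar>of_int \<tau> - of_int \<xi> * \<alpha>\<bar>"
proof -
  have r1: "r > 1" using le_less_trans[OF irrationality_measure_ge_1 r] by (simp add: one_ereal_def)
  define S where "S = {(p :: int, q :: nat). q > 0 \<and> \<bar>\<alpha> - of_int p / real q\<bar> < real q powr (- r)}"
  have fin: "finite S"
  proof (rule ccontr)
    assume "infinite S"
    then have "ereal r \<le> irrationality_measure \<alpha>"
      unfolding irrationality_measure_def S_def using r1 by (intro Sup_upper imageI) simp
    then show False using r by simp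
  qed
  have ne: "of_int p - real q * \<alpha> \<noteq> 0" if "q > 0" for p :: int and q :: nat
  proof
    assume "of_int p - real q * \<alpha> = 0"
    then have "\<alpha> = of_int p / of_nat q" using that by (simp add: field_simps)
    then show False using irr by (metis Rats_divide Rats_of_int Rats_of_nat)
  qed
  define g where "g = (\<lambda>(p :: int, q :: nat). \<bar>of_int p - real q * \<alpha>\<bar> * real q powr (r - 1))"
  \<comment> \<open>The inserted 1 serves the pairs outside \<open>S\<close> and keeps the minimum
    over a nonempty set.\<close>
  define c where "c = Min (insert 1 (g ` S))"
  have c_le: "c \<le> 1" "\<And>x. x \<in> S \<Longrightarrow> c \<le> g x" unfolding c_def using fin by auto
  have c_pos: "c > 0"
    unfolding c_def using fin ne by (subst Min_gr_iff) (auto simp: g_def S_def)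
  have key: "c * real q powr (1 - r) \<le> \<bar>of_int p - real q * \<alpha>\<bar>" if q: "q > 0" for p :: int and q :: nat
  proof (cases "(p, q) \<in> S")
    case True
    have "c * real q powr (1 - r) \<le> \<bar>of_int p - real q * \<alpha>\<bar> * real q powr (r - 1) * real q powr (1 - r)"
      using c_le(2)[OF True] by (intro mult_right_mono) (auto simp: g_def)
    also have "\<dots> = \<bar>of_int p - real q * \<alpha>\<bar>" using q by (simp add: mult.assoc flip: powr_add)
    finally show ?thesis .
  next
    case False
    then have "real q powr (- r) \<le> \<bar>\<alpha> - of_int p / real q\<bar>" using q by (simp add: S_def)
    then have "real q * real q powr (- r) \<le> real q * \<bar>\<alpha> - of_int p / real q\<bar>" by (rule mult_left_mono) simp
    moreover have "real q * real q powr (- r) = real q powr (1 - r)"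
      using q powr_add[of "real q" 1 "- r"] by simp
    moreover have "real q * \<bar>\<alpha> - of_int p / real q\<bar> = \<bar>of_int p - real q * \<alpha>\<bar>"
    proof -
      have "real q * (\<alpha> - of_int p / real q) = real q * \<alpha> - of_int p" using q by (simp add: field_simps)
      then show ?thesis by (metis abs_minus_commute abs_mult abs_of_nat)
    qed
    ultimately have "real q powr (1 - r) \<le> \<bar>of_int p - real q * \<alpha>\<bar>" by simp
    moreover have "c * real q powr (1 - r) \<le> 1 * real q powr (1 - r)" by (intro mult_right_mono c_le) simp
    ultimately show ?thesis by simp
  qed
  have "c * bracket \<xi> powr (1 - r) \<le> \<bar>of_int \<tau> - of_int \<xi> * \<alpha>\<bar>" if \<xi>: "\<xi> \<noteq> 0" for \<tau> \<xi> :: int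
  proof -
    have q: "nat \<bar>\<xi>\<bar> > 0" using \<xi> by simp
    \<comment> \<open>The exponent is negative, so passing from \<bar>\<xi>\<bar> to the larger
      bracket lowers the value.\<close>
    have "bracket \<xi> powr (1 - r) \<le> real (nat \<bar>\<xi>\<bar>) powr (1 - r)"
      using abs_le_japanese_bracket[of "of_int \<xi>"] \<xi> r1 by (intro powr_mono2') auto
    then have "c * bracket \<xi> powr (1 - r) \<le> c * real (nat \<bar>\<xi>\<bar>) powr (1 - r)"
      using c_pos by (intro mult_left_mono) auto
    also have "\<dots> \<le> \<bar>of_int (sgn \<xi> * \<tau>) - real (nat \<bar>\<xi>\<bar>) * \<alpha>\<bar>" by (rule key[OF q])
    also have "\<dots> = \<bar>of_int \<tau> - of_int \<xi> * \<alpha>\<bar>"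
      using \<xi> by (cases "\<xi> > 0") (auto simp: abs_minus_commute)
    finally show ?thesis .
  qed
  then show ?thesis using that c_pos c_le(1) by blast
qed

text \<open>Negative frequencies are handled by exchanging \<open>e\<close> and \<open>e'\<close>.\<close>
lemma gauge_signed:
  assumes g: "gauge b e e'" and \<xi>: "\<xi> \<noteq> 0"
  shows "\<exists>b' \<beta>. (gauge b' e e' \<and> b' = b \<and> \<beta> = \<alpha> \<or> gauge b' e' e \<and> b' = (\<lambda>n. - b n) \<and> \<beta> = - \<alpha>) \<and>
    real (nat \<bar>\<xi>\<bar>) * \<beta> = of_int \<xi> * \<alpha> \<and>
    (\<forall>u \<tau>. of_nat (nat \<bar>\<xi>\<bar>) * (of_real \<beta> * u \<tau> + conv b' u \<tau>) = of_int \<xi> * (of_real \<alpha> * u \<tau> + conv b u \<tau>))"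
proof (cases "\<xi> > 0")
  case True
  then show ?thesis using g by (intro exI[of _ b] exI[of _ \<alpha>]) simp
next
  case False
  have neg: "conv (\<lambda>n. - b n) u = (\<lambda>n. - conv b u n)" for u
    using conv_cmult_left[of "- 1" b u] by simp
  have n: "int (nat \<bar>\<xi>\<bar>) = - \<xi>" using False by simp
  have nc: "of_nat (nat \<bar>\<xi>\<bar>) = - complex_of_int \<xi>" and nr: "real (nat \<bar>\<xi>\<bar>) = - real_of_int \<xi>"
    using n by (metis of_int_minus of_int_of_nat_eq)+
  show ?thesis
  proof (intro exI[of _ "\<lambda>n. - b n"] exI[of _ "- \<alpha>"] conjI allI)
    show "real (nat \<bar>\<xi>\<bar>) * (- \<alpha>) = of_int \<xi> * \<alpha>" unfolding nr by simp
    show "of_nat (nat \<bar>\<xi>\<bar>) * (of_real (- \<alpha>) * u \<tau> + conv (\<lambda>n. - b n) u \<tau>) = of_int \<xi> * (of_real \<alpha> * u \<tau> + conv b u \<tau>)" for u \<tau>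
      unfolding nc neg by (simp add: algebra_simps)
  qed (use gauge.gauge_swap[OF g] in blast)
qed

section \<open>Solvability and estimates on slices of either sign\<close>

definition slice_eq :: "(int \<Rightarrow> complex) \<Rightarrow> real \<Rightarrow> int \<Rightarrow> (int \<Rightarrow> complex) \<Rightarrow> (int \<Rightarrow> complex) \<Rightarrow> bool" where
  "slice_eq b \<alpha> \<xi> u f \<longleftrightarrow>
     (\<forall>\<tau>. \<i> * of_int \<tau> * u \<tau> - \<i> * of_int \<xi> * (of_real \<alpha> * u \<tau> + conv b u \<tau>) = f \<tau>)"

lemma slice_unique:
  assumes g: "gauge b e e'" and \<xi>: "\<xi> \<noteq> 0" and nr: "\<And>\<tau>. real_of_int \<tau> \<noteq> of_int \<xi> * \<alpha>"
    and t: "tempered u" "tempered v" "tempered f" and eq: "slice_eq b \<alpha> \<xi> u f" "slice_eq b \<alpha> \<xi> v f"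
  shows "u = v"
proof -
  obtain b' \<beta> where b': "gauge b' e e' \<and> b' = b \<and> \<beta> = \<alpha> \<or> gauge b' e' e \<and> b' = (\<lambda>n. - b n) \<and> \<beta> = - \<alpha>"
    "real (nat \<bar>\<xi>\<bar>) * \<beta> = of_int \<xi> * \<alpha>"
    "\<forall>u \<tau>. of_nat (nat \<bar>\<xi>\<bar>) * (of_real \<beta> * u \<tau> + conv b' u \<tau>) = of_int \<xi> * (of_real \<alpha> * u \<tau> + conv b u \<tau>)"
    using gauge_signed[OF g \<xi>, of \<alpha>] by (elim exE conjE) (rule that)
  have eq': "\<i> * of_int \<tau> * w \<tau> - \<i> * of_nat (nat \<bar>\<xi>\<bar>) * (of_real \<beta> * w \<tau> + conv b' w \<tau>) = f \<tau>"
    if "slice_eq b \<alpha> \<xi> w f" for w \<tau>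
    using that b'(3)[rule_format, of w \<tau>] by (simp add: slice_eq_def mult.assoc)
  from b'(1) have "\<exists>d d'. gauge b' d d'" by (elim disjE conjE) (rule exI, rule exI, assumption)+
  then obtain d d' where "gauge b' d d'" by (elim exE)
  then interpret gauge b' d d' .
  show ?thesis
    using solution_formula[OF t(1,3) eq'[OF eq(1)]] solution_formula[OF t(2,3) eq'[OF eq(2)]] nr b'(2) by simp
qed

lemma slice_exists:
  assumes g: "gauge b e e'" and \<xi>: "\<xi> \<noteq> 0" and \<delta>: "\<delta> > 0" "\<And>\<tau>. \<delta> \<le> \<bar>real_of_int \<tau> - of_int \<xi> * \<alpha>\<bar>"
    and f: "tempered f"
  shows "\<exists>u. tempered u \<and> slice_eq b \<alpha> \<xi> u f"
proof -
  obtain b' \<beta> where b': "gauge b' e e' \<and> b' = b \<and> \<beta> = \<alpha> \<or> gauge b' e' e \<and> b' = (\<lambda>n. - b n) \<and> \<beta> = - \<alpha>"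
    "real (nat \<bar>\<xi>\<bar>) * \<beta> = of_int \<xi> * \<alpha>"
    "\<forall>u \<tau>. of_nat (nat \<bar>\<xi>\<bar>) * (of_real \<beta> * u \<tau> + conv b' u \<tau>) = of_int \<xi> * (of_real \<alpha> * u \<tau> + conv b u \<tau>)"
    using gauge_signed[OF g \<xi>, of \<alpha>] by (elim exE conjE) (rule that)
  from b'(1) have "\<exists>d d'. gauge b' d d'" by (elim disjE conjE) (rule exI, rule exI, assumption)+
  then obtain d d' where "gauge b' d d'" by (elim exE)
  then interpret gauge b' d d' .
  obtain u where "tempered u"
    "\<And>\<tau>. \<i> * of_int \<tau> * u \<tau> - \<i> * of_nat (nat \<bar>\<xi>\<bar>) * (of_real \<beta> * u \<tau> + conv b' u \<tau>) = f \<tau>"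
    using solution_exists[OF f \<delta>(1), of "nat \<bar>\<xi>\<bar>" \<beta>] \<delta>(2) unfolding b'(2) by blast
  then show ?thesis using b'(3) by (auto simp: slice_eq_def mult.assoc)
qed

text \<open>Both signs of \<xi> reduce to \<open>solution_estimate\<close> with m =
  \<bar>\<xi>\<bar>, once for \<alpha> and once for - \<alpha>; the larger of the two constants
  serves every slice.\<close>

lemma slice_estimate:
  assumes g: "gauge b e e'" and \<theta>: "0 \<le> \<theta>" "\<theta> \<le> 1"
  shows "\<exists>C\<ge>1. \<forall>\<xi> \<delta> f u B. \<xi> \<noteq> 0 \<longrightarrow> 0 < \<delta> \<longrightarrow> \<delta> \<le> 1 \<longrightarrow> (\<forall>\<tau>. \<delta> \<le> \<bar>real_of_int \<tau> - of_int \<xi> * \<alpha>\<bar>) \<longrightarrow>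
     tempered f \<longrightarrow> tempered u \<longrightarrow> slice_eq b \<alpha> \<xi> u f \<longrightarrow>
     sobolev_bounded q f B \<longrightarrow>
     sobolev_bounded (q + \<theta>) u
       (C * (bracket \<xi> powr (\<bar>q\<bar> + \<theta>) / \<delta>) * B)"
proof -
  let ?P = "\<lambda>C b \<beta>. \<forall>m>0. \<forall>\<delta> f u B. 0 < \<delta> \<longrightarrow> \<delta> \<le> 1 \<longrightarrow> (\<forall>\<tau>. \<bar>real_of_int \<tau> - real m * \<beta>\<bar> \<ge> \<delta>) \<longrightarrow>
     tempered f \<longrightarrow> tempered u \<longrightarrow>
     (\<forall>\<tau>. \<i> * of_int \<tau> * u \<tau> - \<i> * of_nat m * (of_real \<beta> * u \<tau> + conv b u \<tau>) = f \<tau>) \<longrightarrow>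
     sobolev_bounded q f B \<longrightarrow>
     sobolev_bounded (q + \<theta>) u
       (C * (japanese_bracket (real m) powr (\<bar>q\<bar> + \<theta>) / \<delta>) * B)"
  obtain C1 where C1: "C1 \<ge> 1" "?P C1 b \<alpha>"
    using gauge.solution_estimate[OF g \<theta>, of \<alpha> q] by blast
  obtain C2 where C2: "C2 \<ge> 1" "?P C2 (\<lambda>n. - b n) (- \<alpha>)"
    using gauge.solution_estimate[OF gauge.gauge_swap[OF g] \<theta>, of "- \<alpha>" q] by blast
  have "sobolev_bounded (q + \<theta>) u
       (max C1 C2 * (bracket \<xi> powr (\<bar>q\<bar> + \<theta>) / \<delta>) * B)"
    if \<xi>: "\<xi> \<noteq> 0" and \<delta>: "0 < \<delta>" "\<delta> \<le> 1" "\<forall>\<tau>. \<delta> \<le> \<bar>real_of_int \<tau> - of_int \<xi> * \<alpha>\<bar>"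
      and t: "tempered f" "tempered u" and eq: "slice_eq b \<alpha> \<xi> u f"
      and B: "sobolev_bounded q f B" for \<xi> \<delta> f u B
  proof -
    obtain b' \<beta> where b': "gauge b' e e' \<and> b' = b \<and> \<beta> = \<alpha> \<or> gauge b' e' e \<and> b' = (\<lambda>n. - b n) \<and> \<beta> = - \<alpha>"
      "real (nat \<bar>\<xi>\<bar>) * \<beta> = of_int \<xi> * \<alpha>"
      "\<forall>u \<tau>. of_nat (nat \<bar>\<xi>\<bar>) * (of_real \<beta> * u \<tau> + conv b' u \<tau>) = of_int \<xi> * (of_real \<alpha> * u \<tau> + conv b u \<tau>)"
      using gauge_signed[OF g \<xi>, of \<alpha>] by (elim exE conjE) (rule that)
    have "\<exists>C\<le>max C1 C2. ?P C b' \<beta>"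
      using b'(1)
    proof (elim disjE conjE)
      assume "b' = b" "\<beta> = \<alpha>"
      then show ?thesis using C1(2) by (intro exI[of _ C1] conjI) simp_all
    next
      assume "b' = (\<lambda>n. - b n)" "\<beta> = - \<alpha>"
      then show ?thesis using C2(2) by (intro exI[of _ C2] conjI) (simp, (simp only:)?)
    qed
    then obtain C where C: "C \<le> max C1 C2" "?P C b' \<beta>" by (elim exE conjE)
    have m: "nat \<bar>\<xi>\<bar> > 0" using \<xi> by simp
    have eq': "\<forall>\<tau>. \<i> * of_int \<tau> * u \<tau> - \<i> * of_nat (nat \<bar>\<xi>\<bar>) * (of_real \<beta> * u \<tau> + conv b' u \<tau>) = f \<tau>"
      using eq b'(3)[rule_format, of u] by (simp add: slice_eq_def mult.assoc)
    have nr: "\<forall>\<tau>. \<delta> \<le> \<bar>real_of_int \<tau> - real (nat \<bar>\<xi>\<bar>) * \<beta>\<bar>" unfolding b'(2) by (rule \<delta>(3))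
    have "sobolev_bounded (q + \<theta>) u
       (C * (japanese_bracket (real (nat \<bar>\<xi>\<bar>)) powr (\<bar>q\<bar> + \<theta>) / \<delta>) * B)"
      using C(2)[rule_format, OF m \<delta>(1,2) nr[rule_format] t eq'[rule_format] B] by blast
    moreover have "C * (japanese_bracket (real (nat \<bar>\<xi>\<bar>)) powr (\<bar>q\<bar> + \<theta>) / \<delta>) * B \<le>
       max C1 C2 * (bracket \<xi> powr (\<bar>q\<bar> + \<theta>) / \<delta>) * B"
      using C(1) \<delta>(1) l2_bounded_nonneg[OF B] by (auto intro!: mult_right_mono divide_right_mono)
    ultimately show ?thesis by (rule l2_bounded_weaken)
  qed
  then show ?thesis using C1(1) by (intro exI[of _ "max C1 C2"]) auto
qed

section \<open>Summation of the slice estimates\<close>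

definition coeff_term :: "real \<Rightarrow> real \<Rightarrow> (int \<times> int \<Rightarrow> complex) \<Rightarrow> int \<times> int \<Rightarrow> real" where
  "coeff_term s1 s2 c = (\<lambda>(\<tau>, \<xi>). bracket \<tau> powr (2 * s1) *
     bracket \<xi> powr (2 * s2) * (cmod (c (\<tau>, \<xi>)))\<^sup>2)"

lemma mix_term_eq: "mix_term s1 s2 u = coeff_term s1 s2 (fourier_coeffs u)"
  by (simp add: mix_term_def coeff_term_def fourier_coeffs_def fun_eq_iff)

lemma coeff_term_nonneg [simp]: "coeff_term s1 s2 c k \<ge> 0"
  by (simp add: coeff_term_def case_prod_unfold)

lemma coeff_term_square:
  "coeff_term s1 s2 c (\<tau>, \<xi>) = bracket \<xi> powr (2 * s2) *
     (bracket \<tau> powr s1 * cmod (c (\<tau>, \<xi>)))\<^sup>2"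
  by (simp add: coeff_term_def power_mult_distrib powr_power mult_ac)

text \<open>The weight in \<xi> is constant on a slice, so a loss of the bracket of \<xi> to the
  power k2 - s2 is exactly compensated when the weight exponent k2 is replaced by s2. No constant
  depending on k2 or s2 enters.\<close>

lemma coeff_term_summable_by_slices:
  assumes f: "coeff_term k1 k2 fh summable_on UNIV" and C: "C \<ge> 0"
    and slice: "\<And>\<xi> B. sobolev_bounded k1 (\<lambda>\<tau>. fh (\<tau>, \<xi>)) B \<Longrightarrow>
       sobolev_bounded s1 (\<lambda>\<tau>. uh (\<tau>, \<xi>))
         (C * bracket \<xi> powr (k2 - s2) * B)"
  shows "coeff_term s1 s2 uh summable_on UNIV"
    and "infsum (coeff_term s1 s2 uh) UNIV \<le> C\<^sup>2 * infsum (coeff_term k1 k2 fh) UNIV"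
proof -
  define g where "g = (\<lambda>\<xi> \<tau>. coeff_term k1 k2 fh (\<tau>, \<xi>))"
  have sg: "(\<lambda>(\<xi>, \<tau>). g \<xi> \<tau>) summable_on UNIV \<times> UNIV"
    using summable_on_swap[of "coeff_term k1 k2 fh" UNIV UNIV] f by (simp add: g_def case_prod_unfold)
  have g\<tau>: "g \<xi> summable_on UNIV" for \<xi>
    using summable_on_SigmaD1[OF sg, of \<xi>] by simp
  have g\<xi>: "(\<lambda>\<xi>. infsum (g \<xi>) UNIV) summable_on UNIV"
    using summable_on_Sigma_banach[OF sg] by simp
  have gtotal: "(\<Sum>\<^sub>\<infinity>\<xi>. infsum (g \<xi>) UNIV) = infsum (coeff_term k1 k2 fh) UNIV"
  proof -
    have "(\<Sum>\<^sub>\<infinity>\<xi>. infsum (g \<xi>) UNIV) = infsum (\<lambda>(\<xi>, \<tau>). g \<xi> \<tau>) (UNIV \<times> UNIV)"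
      using infsum_Sigma_banach[OF sg] by simp
    also have "\<dots> = infsum (coeff_term k1 k2 fh) UNIV"
      by (rule infsum_reindex_bij_witness[of _ prod.swap prod.swap]) (auto simp: g_def)
    finally show ?thesis .
  qed
  have row: "(\<Sum>\<tau>\<in>T. coeff_term s1 s2 uh (\<tau>, \<xi>)) \<le> C\<^sup>2 * infsum (g \<xi>) UNIV" if T: "finite T" for T \<xi>
  proof -
    let ?j = "bracket \<xi>"
    \<comment> \<open>The norm of the slice with the weight in \<xi> divided out, the smallest
      admissible bound.\<close>
    define B where "B = sqrt (infsum (g \<xi>) UNIV / ?j powr (2 * k2))"
    have B0: "B \<ge> 0" unfolding B_def by (intro real_sqrt_ge_zero divide_nonneg_nonneg infsum_nonneg) (auto simp: g_def)
    have B2: "B\<^sup>2 = infsum (g \<xi>) UNIV / ?j powr (2 * k2)"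
      unfolding B_def by (intro real_sqrt_pow2 divide_nonneg_nonneg infsum_nonneg) (auto simp: g_def)
    have "sobolev_bounded k1 (\<lambda>\<tau>. fh (\<tau>, \<xi>)) B"
      unfolding l2_bounded_iff_sum[OF B0]
    proof (intro allI impI)
      fix F :: "int set" assume F: "finite F"
      have "?j powr (2 * k2) * (\<Sum>\<tau>\<in>F. (bracket \<tau> powr k1 * cmod (fh (\<tau>, \<xi>)))\<^sup>2) = (\<Sum>\<tau>\<in>F. g \<xi> \<tau>)"
        by (simp add: g_def coeff_term_square sum_distrib_left)
      also have "\<dots> \<le> infsum (g \<xi>) UNIV" by (intro finite_sum_le_infsum g\<tau> F) (auto simp: g_def)
      finally show "(\<Sum>\<tau>\<in>F. (bracket \<tau> powr k1 * cmod (fh (\<tau>, \<xi>)))\<^sup>2) \<le> B\<^sup>2"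
        by (simp add: B2 pos_le_divide_eq mult.commute)
    qed
    from slice[OF this] have "sobolev_bounded s1 (\<lambda>\<tau>. uh (\<tau>, \<xi>)) (C * ?j powr (k2 - s2) * B)" .
    then have "(\<Sum>\<tau>\<in>T. (bracket \<tau> powr s1 * cmod (uh (\<tau>, \<xi>)))\<^sup>2) \<le> (C * ?j powr (k2 - s2) * B)\<^sup>2"
      using T C B0 by (subst (asm) l2_bounded_iff_sum) auto
    then have "?j powr (2 * s2) * (\<Sum>\<tau>\<in>T. (bracket \<tau> powr s1 * cmod (uh (\<tau>, \<xi>)))\<^sup>2) \<le>
        ?j powr (2 * s2) * (C * ?j powr (k2 - s2) * B)\<^sup>2" by (rule mult_left_mono) simp
    also have "\<dots> = C\<^sup>2 * (?j powr (2 * s2) * ?j powr (2 * (k2 - s2))) * B\<^sup>2"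
      by (simp add: power_mult_distrib powr_power mult_ac)
    also have "?j powr (2 * s2) * ?j powr (2 * (k2 - s2)) = ?j powr (2 * k2)"
      by (simp flip: powr_add)
    also have "C\<^sup>2 * ?j powr (2 * k2) * B\<^sup>2 = C\<^sup>2 * infsum (g \<xi>) UNIV" by (simp add: B2)
    finally show ?thesis by (simp add: coeff_term_square sum_distrib_left)
  qed
  have bound: "sum (coeff_term s1 s2 uh) Z \<le> C\<^sup>2 * infsum (coeff_term k1 k2 fh) UNIV" if Z: "finite Z" for Z
  proof -
    \<comment> \<open>Enlarging to a rectangle lets the nonnegative terms be summed row by
      row.\<close>
    have "sum (coeff_term s1 s2 uh) Z \<le> sum (coeff_term s1 s2 uh) (fst ` Z \<times> snd ` Z)"
    proof (rule sum_mono2)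
      show "Z \<subseteq> fst ` Z \<times> snd ` Z" by force
    qed (use Z in auto)
    also have "\<dots> = (\<Sum>\<xi>\<in>snd ` Z. \<Sum>\<tau>\<in>fst ` Z. coeff_term s1 s2 uh (\<tau>, \<xi>))"
      by (subst sum.swap) (simp add: sum.cartesian_product)
    also have "\<dots> \<le> (\<Sum>\<xi>\<in>snd ` Z. C\<^sup>2 * infsum (g \<xi>) UNIV)"
      by (intro sum_mono row) (use Z in auto)
    also have "\<dots> \<le> C\<^sup>2 * (\<Sum>\<^sub>\<infinity>\<xi>. infsum (g \<xi>) UNIV)"
      unfolding sum_distrib_left[symmetric]
      by (intro mult_left_mono finite_sum_le_infsum g\<xi>) (use Z in \<open>auto intro: infsum_nonneg simp: g_def\<close>)
    finally show ?thesis by (simp add: gtotal)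
  qed
  show s: "coeff_term s1 s2 uh summable_on UNIV"
    by (rule nonneg_bdd_above_summable_on) (auto intro!: bdd_aboveI2 bound)
  show "infsum (coeff_term s1 s2 uh) UNIV \<le> C\<^sup>2 * infsum (coeff_term k1 k2 fh) UNIV"
    by (rule infsum_le_finite_sums[OF s]) (use bound in auto)
qed

text \<open>A single term is at most the whole sum, and \<open>japanese_bracket_peetre\<close> at 0
  bounds the weights below by inverse powers of \<open>wt\<close>. It serves to assemble slicewise
  solutions into one distribution.\<close>

lemma tempered2_of_coeff_term_summable:
  assumes "coeff_term s1 s2 c summable_on UNIV"
  shows "tempered2 c"
proof -
  define S where "S = infsum (coeff_term s1 s2 c) UNIV"
  define p where "p = nat \<lceil>\<bar>s1\<bar>\<rceil> + nat \<lceil>\<bar>s2\<bar>\<rceil>"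
  have jle: "1 \<le> wt \<tau> ^ p * bracket \<tau> powr s" if "nat \<lceil>\<bar>s\<bar>\<rceil> \<le> p" for \<tau> s
  proof -
    have "1 \<le> wt \<tau> ^ nat \<lceil>\<bar>s\<bar>\<rceil> * bracket \<tau> powr s"
      using japanese_bracket_peetre[of 0 s "- \<tau>"] by (simp add: japanese_bracket_def)
    also have "\<dots> \<le> wt \<tau> ^ p * bracket \<tau> powr s"
      by (intro mult_right_mono wt_power_mono that) auto
    finally show ?thesis .
  qed
  have "cmod (c k) \<le> sqrt S * wt2 k ^ p" for k
  proof -
    obtain \<tau> \<xi> where k: "k = (\<tau>, \<xi>)" by (cases k)
    let ?j1 = "bracket \<tau> powr s1" and ?j2 = "bracket \<xi> powr s2"
    have "(?j1 * ?j2 * cmod (c k))\<^sup>2 = coeff_term s1 s2 c k"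
      by (simp add: k coeff_term_def power_mult_distrib powr_power mult_ac)
    also have "\<dots> \<le> S"
      using finite_sum_le_infsum[OF assms, of "{k}"] by (simp add: S_def)
    finally have "?j1 * ?j2 * cmod (c k) \<le> sqrt S" by (rule real_le_rsqrt)
    then have le: "wt2 k ^ p * (?j1 * ?j2 * cmod (c k)) \<le> wt2 k ^ p * sqrt S" by (rule mult_left_mono) simp
    have "1 * 1 * cmod (c k) \<le> (wt \<tau> ^ p * ?j1) * (wt \<xi> ^ p * ?j2) * cmod (c k)"
      by (intro mult_right_mono mult_mono jle) (auto simp: p_def)
    also have "\<dots> = wt2 k ^ p * (?j1 * ?j2 * cmod (c k))"
      by (simp add: wt2_def k power_mult_distrib mult_ac)
    finally have "cmod (c k) \<le> wt2 k ^ p * (?j1 * ?j2 * cmod (c k))" by simp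
    also note le
    finally show ?thesis by (simp add: mult.commute)
  qed
  then show ?thesis unfolding tempered2_def by blast
qed

lemma japanese_bracket_mono_powr: "q \<le> k \<Longrightarrow> japanese_bracket x powr q \<le> japanese_bracket x powr k"
  by (intro powr_mono japanese_bracket_ge1)

text \<open>There is no small divisor at \<open>\<xi> = 0\<close>, except at \<open>\<tau> = 0\<close>, where both sides vanish.\<close>
lemma zero_slice_estimate:
  assumes eq: "\<And>\<tau>. \<i> * of_int \<tau> * u \<tau> = f \<tau>" and u0: "u 0 = 0" and q: "q \<le> k" and \<theta>: "\<theta> \<le> 1"
    and B: "sobolev_bounded k f B"
  shows "sobolev_bounded (q + \<theta>) u (2 * B)"
proof (rule l2_bounded_mono[OF l2_bounded_cmult[OF B, of 2]])
  fix \<tau> :: int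
  let ?j = "bracket \<tau>"
  show "?j powr (q + \<theta>) * cmod (u \<tau>) \<le> 2 * (?j powr k * cmod (f \<tau>))"
  proof (cases "\<tau> = 0")
    case True then show ?thesis by (simp add: u0)
  next
    case False
    have f: "cmod (f \<tau>) = \<bar>real_of_int \<tau>\<bar> * cmod (u \<tau>)"
      unfolding eq[symmetric] by (simp add: norm_mult)
    have "1 \<le> \<bar>real_of_int \<tau>\<bar>" using False by linarith
    \<comment> \<open>This holds because \<tau> \<noteq> 0 and is the origin of the factor 2 in the
      claim.\<close>
    then have "?j \<le> 2 * \<bar>real_of_int \<tau>\<bar>" using japanese_bracket_le[of "of_int \<tau>"] by linarith
    moreover have "?j powr \<theta> \<le> ?j powr 1" by (rule japanese_bracket_mono_powr[OF \<theta>])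
    ultimately have "?j powr \<theta> \<le> 2 * \<bar>real_of_int \<tau>\<bar>" by simp
    then have "?j powr q * ?j powr \<theta> * cmod (u \<tau>) \<le> ?j powr k * (2 * \<bar>real_of_int \<tau>\<bar>) * cmod (u \<tau>)"
      by (intro mult_right_mono mult_mono japanese_bracket_mono_powr q) auto
    then show ?thesis by (simp add: f powr_add)
  qed
qed auto

text \<open>With \<delta> the Diophantine bound, the loss on a slice is the bracket of \<xi> to the
  power \<bar>q\<bar> + \<theta> + r - 1, which is k2 minus the new second exponent. The condition q
  \<le> k1 enters by monotonicity of bracket powers, and C is chosen before k2.\<close>

lemma coefficient_estimate:
  assumes g: "gauge b e e'" and irr: "\<alpha> \<notin> \<rat>" and r: "ereal r > irrationality_measure \<alpha>"
    and q: "q \<le> k1" and \<theta>: "0 \<le> \<theta>" "\<theta> \<le> 1"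
  shows "\<exists>C>0. \<forall>k2 fh uh. coeff_term k1 k2 fh summable_on UNIV \<longrightarrow>
     (\<forall>\<xi>. tempered (\<lambda>\<tau>. fh (\<tau>, \<xi>)) \<and> tempered (\<lambda>\<tau>. uh (\<tau>, \<xi>)) \<and>
        slice_eq b \<alpha> \<xi> (\<lambda>\<tau>. uh (\<tau>, \<xi>)) (\<lambda>\<tau>. fh (\<tau>, \<xi>))) \<longrightarrow> uh (0, 0) = 0 \<longrightarrow>
     coeff_term (q + \<theta>) (k2 + 1 - r - \<bar>q\<bar> - \<theta>) uh summable_on UNIV \<and>
     infsum (coeff_term (q + \<theta>) (k2 + 1 - r - \<bar>q\<bar> - \<theta>) uh) UNIV \<le> C\<^sup>2 * infsum (coeff_term k1 k2 fh) UNIV"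
proof -
  obtain c where c: "0 < c" "c \<le> 1"
    "\<And>\<tau> \<xi> :: int. \<xi> \<noteq> 0 \<Longrightarrow> c * bracket \<xi> powr (1 - r) \<le> \<bar>of_int \<tau> - of_int \<xi> * \<alpha>\<bar>"
    using diophantine_lower_bound[OF irr r] by blast
  have r1: "r \<ge> 1" using le_less_trans[OF irrationality_measure_ge_1 r] by (simp add: one_ereal_def)
  obtain K where K: "K \<ge> 1" and est: "\<And>\<xi> \<delta> f u B. \<xi> \<noteq> 0 \<Longrightarrow> 0 < \<delta> \<Longrightarrow> \<delta> \<le> 1 \<Longrightarrow> (\<And>\<tau>. \<delta> \<le> \<bar>real_of_int \<tau> - of_int \<xi> * \<alpha>\<bar>) \<Longrightarrow>
     tempered f \<Longrightarrow> tempered u \<Longrightarrow> slice_eq b \<alpha> \<xi> u f \<Longrightarrow>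
     sobolev_bounded q f B \<Longrightarrow>
     sobolev_bounded (q + \<theta>) u
       (K * (bracket \<xi> powr (\<bar>q\<bar> + \<theta>) / \<delta>) * B)"
    using slice_estimate[OF g \<theta>, of \<alpha> q] by blast
  \<comment> \<open>The 2 serves the slice \<xi> = 0, the quotient K / c all others.\<close>
  define C where "C = max 2 (K / c)"
  have "coeff_term (q + \<theta>) (k2 + 1 - r - \<bar>q\<bar> - \<theta>) uh summable_on UNIV \<and>
     infsum (coeff_term (q + \<theta>) (k2 + 1 - r - \<bar>q\<bar> - \<theta>) uh) UNIV \<le> C\<^sup>2 * infsum (coeff_term k1 k2 fh) UNIV"
    if f: "coeff_term k1 k2 fh summable_on UNIV"
      and sl: "\<And>\<xi>. tempered (\<lambda>\<tau>. fh (\<tau>, \<xi>))" "\<And>\<xi>. tempered (\<lambda>\<tau>. uh (\<tau>, \<xi>))"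
        "\<And>\<xi>. slice_eq b \<alpha> \<xi> (\<lambda>\<tau>. uh (\<tau>, \<xi>)) (\<lambda>\<tau>. fh (\<tau>, \<xi>))"
      and u0: "uh (0, 0) = 0" for k2 fh uh
  proof -
    have slice: "sobolev_bounded (q + \<theta>) (\<lambda>\<tau>. uh (\<tau>, \<xi>))
         (C * bracket \<xi> powr (k2 - (k2 + 1 - r - \<bar>q\<bar> - \<theta>)) * B)"
      if B: "sobolev_bounded k1 (\<lambda>\<tau>. fh (\<tau>, \<xi>)) B" for \<xi> B
    proof (cases "\<xi> = 0")
      case True
      have "sobolev_bounded (q + \<theta>) (\<lambda>\<tau>. uh (\<tau>, 0)) (2 * B)"
        by (rule zero_slice_estimate[where k=k1 and f="\<lambda>\<tau>. fh (\<tau>, 0)"])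
          (use sl(3)[of 0] u0 q \<theta> B True in \<open>auto simp: slice_eq_def\<close>)
      moreover have "2 * B \<le> C * B" using l2_bounded_nonneg[OF B] by (intro mult_right_mono) (auto simp: C_def)
      ultimately have "sobolev_bounded (q + \<theta>) (\<lambda>\<tau>. uh (\<tau>, 0)) (C * B)"
        by (rule l2_bounded_weaken)
      then show ?thesis using True by (simp add: japanese_bracket_def[of 0])
    next
      case False
      let ?j = "bracket \<xi>"
      define \<delta> where "\<delta> = c * ?j powr (1 - r)"
      have \<delta>: "0 < \<delta>" "\<delta> \<le> 1"
      proof -
        show "0 < \<delta>" using c by (simp add: \<delta>_def)
        have "?j powr (1 - r) \<le> ?j powr 0" using r1 by (intro japanese_bracket_mono_powr) simp
        then have "c * ?j powr (1 - r) \<le> 1 * 1" using c by (intro mult_mono) auto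
        then show "\<delta> \<le> 1" by (simp add: \<delta>_def)
      qed
      have Bq: "sobolev_bounded q (\<lambda>\<tau>. fh (\<tau>, \<xi>)) B"
        by (rule l2_bounded_mono[OF B]) (auto intro!: mult_right_mono japanese_bracket_mono_powr q)
      have "sobolev_bounded (q + \<theta>) (\<lambda>\<tau>. uh (\<tau>, \<xi>))
         (K * (?j powr (\<bar>q\<bar> + \<theta>) / \<delta>) * B)"
        by (rule est[OF False \<delta> _ sl Bq]) (use c(3)[OF False] in \<open>simp add: \<delta>_def\<close>)
      moreover have "K * (?j powr (\<bar>q\<bar> + \<theta>) / \<delta>) * B \<le> C * ?j powr (k2 - (k2 + 1 - r - \<bar>q\<bar> - \<theta>)) * B"
      proof -
        have eq: "?j powr (\<bar>q\<bar> + \<theta>) / ?j powr (1 - r) = ?j powr (k2 - (k2 + 1 - r - \<bar>q\<bar> - \<theta>))"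
          by (simp add: algebra_simps flip: powr_diff)
        have "K * (x / (c * y)) = K / c * (x / y)" for x y :: real by simp
        then have "K * (?j powr (\<bar>q\<bar> + \<theta>) / \<delta>) = K / c * ?j powr (k2 - (k2 + 1 - r - \<bar>q\<bar> - \<theta>))"
          unfolding \<delta>_def eq[symmetric] .
        also have "\<dots> \<le> C * ?j powr (k2 - (k2 + 1 - r - \<bar>q\<bar> - \<theta>))"
          by (intro mult_right_mono) (auto simp: C_def)
        finally show ?thesis using l2_bounded_nonneg[OF B] by (rule mult_right_mono)
      qed
      ultimately show ?thesis by (rule l2_bounded_weaken)
    qed
    show ?thesis
      using coeff_term_summable_by_slices[OF f _ slice] by (simp add: C_def)
  qed
  moreover have "C > 0" by (simp add: C_def)
  ultimately show ?thesis by blast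
qed

lemma slice_eq_0_iff: "slice_eq b \<alpha> 0 u f \<longleftrightarrow> (\<forall>\<tau>. \<i> * of_int \<tau> * u \<tau> = f \<tau>)"
  by (simp add: slice_eq_def)

text \<open>The mean of \<open>a\<close> is split off as a multiple of \<open>delta_seq\<close>, so
  convolution with the coefficients of \<open>a\<close> becomes a scalar multiple plus convolution
  with those of the mean-free part. Temperedness of the slices justifies splitting the sum.\<close>

lemma L_symbol_eq_iff_slices:
  assumes a: "a \<in> smooth_circle" and g: "gauge (fc (\<lambda>t. of_real (a t - circle_mean a))) e e'" and c: "tempered2 c"
  shows "L_symbol a c = d \<longleftrightarrow>
    (\<forall>\<xi>. slice_eq (fc (\<lambda>t. of_real (a t - circle_mean a))) (circle_mean a) \<xi> (\<lambda>\<tau>. c (\<tau>, \<xi>)) (\<lambda>\<tau>. d (\<tau>, \<xi>)))"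
proof -
  let ?b = "fc (\<lambda>t. of_real (a t - circle_mean a))" and ?ah = "fc (\<lambda>t. complex_of_real (a t))"
  have cont: "continuous_on UNIV (\<lambda>t. complex_of_real (a t))"
    using smooth_circleD(3)[OF a, of 0] by (auto intro!: continuous_intros)
  have ah: "?ah n = ?b n + of_real (circle_mean a) * delta_seq n" for n
  proof -
    have "?b n = ?ah n - fc (\<lambda>t. of_real (circle_mean a)) n"
      using fc_diff[OF cont continuous_on_const, of "of_real (circle_mean a)" n] by simp
    moreover have "fc (\<lambda>t. of_real (circle_mean a)) n = of_real (circle_mean a) * delta_seq n"
      using fc_cmult[of "of_real (circle_mean a)" "\<lambda>_. 1" n] by (simp add: fc_1)
    ultimately show ?thesis by simp
  qed
  have rd: "rapid (\<lambda>n. of_real (circle_mean a) * delta_seq n)"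
    by (rule rapid_cmult) (auto simp: rapid_def delta_seq_def wt_def intro!: exI[of _ 1])
  have conv_ah: "conv ?ah u \<tau> = of_real (circle_mean a) * u \<tau> + conv ?b u \<tau>" if u: "tempered u" for u \<tau>
  proof -
    have "conv ?ah u \<tau> = (\<Sum>\<^sub>\<infinity>\<sigma>. ?b \<sigma> * u (\<tau> - \<sigma>) + of_real (circle_mean a) * delta_seq \<sigma> * u (\<tau> - \<sigma>))"
      unfolding conv_def ah distrib_right ..
    also have "\<dots> = conv ?b u \<tau> + conv (\<lambda>n. of_real (circle_mean a) * delta_seq n) u \<tau>"
      unfolding conv_def by (intro infsum_add conv_summable rd u gauge.rapid_b[OF g])
    finally show ?thesis by (simp add: conv_cmult_left conv_delta)
  qed
  show ?thesis
    using conv_ah[OF tempered2_slice[OF c]] by (auto simp: L_symbol_def slice_eq_def fun_eq_iff)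
qed

theorem corollary5p3:
  fixes a :: "real \<Rightarrow> real" and a0 :: real
  assumes "a \<in> smooth_circle"
    and "a0 = circle_mean a"
    and "a0 \<notin> \<rat>"
    and "irrationality_measure a0 < \<infinity>"
  shows "(\<forall>k1 k2 f. f \<in> H_mix k1 k2 \<and> fourier_coeff f 0 0 = 0 \<longrightarrow>
            (\<exists>!u. u \<in> distributions \<and> L_op a u = f \<and> fourier_coeff u 0 0 = 0)) \<and>
         (\<forall>k1 q r \<theta> :: real.
            ereal r > irrationality_measure a0 \<and> q \<le> k1 \<and> 0 \<le> \<theta> \<and> \<theta> \<le> 1 \<longrightarrow>
            (\<exists>C>0. \<forall>k2 f u.
               f \<in> H_mix k1 k2 \<and> fourier_coeff f 0 0 = 0 \<and>
               u \<in> distributions \<and> L_op a u = f \<and> fourier_coeff u 0 0 = 0 \<longrightarrow>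
               u \<in> H_mix (q + \<theta>) (k2 + 1 - r - \<bar>q\<bar> - \<theta>) \<and>
               H_mix_norm (q + \<theta>) (k2 + 1 - r - \<bar>q\<bar> - \<theta>)
                   (dist_diff u (dist_of_fun (\<lambda>z. fourier_coeff u 0 0)))
                 \<le> C * H_mix_norm k1 k2 f))"
proof -
  note a = assms(1) and a0 = assms(2) and irr = assms(3)
  let ?b = "fc (\<lambda>t. of_real (a t - circle_mean a))"
  obtain e e' where g: "gauge ?b e e'" using gauge_of_smooth[OF a] by blast
  \<comment> \<open>Finiteness of the measure provides a real exponent beyond it; one such exponent
    suffices for solvability.\<close>
  obtain r0 where r0: "ereal r0 > irrationality_measure a0"
    using ereal_dense2[OF assms(4)] by blast
  obtain c where c: "0 < c"
    "\<And>\<tau> \<xi> :: int. \<xi> \<noteq> 0 \<Longrightarrow> c * bracket \<xi> powr (1 - r0) \<le> \<bar>of_int \<tau> - of_int \<xi> * a0\<bar>"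
    using diophantine_lower_bound[OF irr r0] by metis
  have nonres: "real_of_int \<tau> \<noteq> of_int \<xi> * a0" if "\<xi> \<noteq> 0" for \<tau> \<xi> :: int
  proof -
    have "0 < c * bracket \<xi> powr (1 - r0)" using c(1) by simp
    also note c(2)[OF that, of \<tau>]
    finally show ?thesis by simp
  qed
  have slices: "L_op a u = f \<longleftrightarrow> (\<forall>\<xi>. slice_eq ?b a0 \<xi> (\<lambda>\<tau>. fourier_coeffs u (\<tau>, \<xi>)) (\<lambda>\<tau>. fourier_coeffs f (\<tau>, \<xi>)))"
    if "u \<in> distributions" "f \<in> distributions" for u f
    using L_op_eq_iff[OF a that] L_symbol_eq_iff_slices[OF a g tempered2_coeffs[OF that(1)]] by (simp add: a0)
  have t: "tempered (\<lambda>\<tau>. fourier_coeffs u (\<tau>, \<xi>))" if "u \<in> distributions" for u \<xi>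
    by (intro tempered2_slice tempered2_coeffs that)
  have zero: "fourier_coeffs u (0, 0) = fourier_coeff u 0 0" for u by (simp add: fourier_coeffs_def)
  have unique: "\<exists>!u. u \<in> distributions \<and> L_op a u = f \<and> fourier_coeff u 0 0 = 0"
    if f: "f \<in> H_mix k1 k2" and f0: "fourier_coeff f 0 0 = 0" for k1 k2 f
  proof -
    have fd: "f \<in> distributions" and fs: "coeff_term k1 k2 (fourier_coeffs f) summable_on UNIV"
      using f by (auto simp: H_mix_def mix_term_eq)
    \<comment> \<open>The middle clause forces the value 0 at \<tau> = 0 on the slice \<xi> = 0 and
      is void elsewhere, so that one choice of \<open>v\<close> serves all slices.\<close>
    have "\<exists>v. tempered v \<and> v 0 = (if \<xi> = 0 then 0 else v 0) \<and> slice_eq ?b a0 \<xi> v (\<lambda>\<tau>. fourier_coeffs f (\<tau>, \<xi>))" for \<xi>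
    proof (cases "\<xi> = 0")
      case True
      \<comment> \<open>At \<tau> = 0 division by zero yields 0, the required normalisation; the
        equation holds there because the mean of \<open>f\<close> vanishes.\<close>
      let ?v = "\<lambda>\<tau>. fourier_coeffs f (\<tau>, 0) / (\<i> * of_int \<tau>)"
      have "tempered ?v"
      proof (rule tempered_mult[OF t[OF fd, of 0], where d=0 and D=1])
        fix n
        show "cmod (?v n) \<le> 1 * wt n ^ 0 * cmod (fourier_coeffs f (n, 0))"
        proof (cases "n = 0")
          case False
          then have "1 \<le> \<bar>real_of_int n\<bar>" by linarith
          then show ?thesis
            using mult_left_mono[of 1 "\<bar>real_of_int n\<bar>" "cmod (fourier_coeffs f (n, 0))"]
            by (simp add: norm_divide norm_mult divide_le_eq)
        qed simp
      qed simp
      moreover have "slice_eq ?b a0 0 ?v (\<lambda>\<tau>. fourier_coeffs f (\<tau>, 0))"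
        unfolding slice_eq_0_iff using f0 by (auto simp: zero)
      ultimately show ?thesis using True by (intro exI[of _ ?v]) simp
    next
      case False
      show ?thesis
        using slice_exists[OF g False _ c(2)[OF False] t[OF fd, of \<xi>]] c(1) False by auto
    qed
    then obtain v where v: "\<And>\<xi>. tempered (v \<xi>)" "\<And>\<xi>. v \<xi> 0 = (if \<xi> = 0 then 0 else v \<xi> 0)"
      "\<And>\<xi>. slice_eq ?b a0 \<xi> (v \<xi>) (\<lambda>\<tau>. fourier_coeffs f (\<tau>, \<xi>))" by metis
    define uh where "uh = (\<lambda>(\<tau>, \<xi>). v \<xi> \<tau>)"
    have uh0: "uh (0, 0) = 0" using v(2)[of 0] by (simp add: uh_def)
    \<comment> \<open>The a priori estimate, with q = k1 and \<theta> = 0, controls the slicewise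
      solutions uniformly in \<xi>, so that they are the coefficients of a distribution.\<close>
    obtain C where "coeff_term (k1 + 0) (k2 + 1 - r0 - \<bar>k1\<bar> - 0) uh summable_on UNIV"
      using coefficient_estimate[OF g irr r0, of k1 k1 0] fs t[OF fd] v uh0 by (auto simp: uh_def)
    then have tuh: "tempered2 uh" by (rule tempered2_of_coeff_term_summable)
    define u where "u = dist_of_coeffs uh"
    have u: "u \<in> distributions" "fourier_coeffs u = uh"
      unfolding u_def by (rule dist_of_coeffs[OF tuh])+
    show ?thesis
    proof (rule ex1I[of _ u])
      show "u \<in> distributions \<and> L_op a u = f \<and> fourier_coeff u 0 0 = 0"
        using u slices[OF u(1) fd] v(3) uh0 by (simp add: uh_def flip: zero)
      fix w assume w: "w \<in> distributions \<and> L_op a w = f \<and> fourier_coeff w 0 0 = 0"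
      \<comment> \<open>Uniqueness is read off the coefficients: for \<xi> \<noteq> 0 from
        \<open>slice_unique\<close>, for \<xi> = 0 by cancelling \<tau>, and at (0, 0) from the
        normalisation.\<close>
      have "fourier_coeffs w (\<tau>, \<xi>) = fourier_coeffs u (\<tau>, \<xi>)" for \<tau> \<xi>
      proof -
        have ws: "slice_eq ?b a0 \<xi> (\<lambda>\<tau>. fourier_coeffs w (\<tau>, \<xi>)) (\<lambda>\<tau>. fourier_coeffs f (\<tau>, \<xi>))" for \<xi>
          using w slices[of w f] fd by blast
        have us: "slice_eq ?b a0 \<xi> (\<lambda>\<tau>. fourier_coeffs u (\<tau>, \<xi>)) (\<lambda>\<tau>. fourier_coeffs f (\<tau>, \<xi>))" for \<xi>
          using v(3)[of \<xi>] by (simp add: u(2) uh_def)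
        show ?thesis
        proof (cases "\<xi> = 0")
          case True
          show ?thesis
          proof (cases "\<tau> = 0")
            case True
            then show ?thesis using w \<open>\<xi> = 0\<close> uh0 by (simp add: zero u(2))
          next
            case False
            have "\<i> * of_int \<tau> * fourier_coeffs w (\<tau>, 0) = \<i> * of_int \<tau> * fourier_coeffs u (\<tau>, 0)"
              using ws[of 0] us[of 0] by (simp add: slice_eq_0_iff)
            then show ?thesis using False \<open>\<xi> = 0\<close> by simp
          qed
        next
          case False
          have "(\<lambda>\<tau>. fourier_coeffs w (\<tau>, \<xi>)) = (\<lambda>\<tau>. fourier_coeffs u (\<tau>, \<xi>))"
            by (rule slice_unique[OF g False nonres[OF False] t t t ws us]) (use w u fd in auto)
          then show ?thesis by (rule fun_cong)
        qed
      qed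
      then show "w = u" using w u(1) by (intro distribution_eqI) (auto simp: fun_eq_iff)
    qed
  qed
  have estimate: "\<exists>C>0. \<forall>k2 f u.
       f \<in> H_mix k1 k2 \<and> fourier_coeff f 0 0 = 0 \<and>
       u \<in> distributions \<and> L_op a u = f \<and> fourier_coeff u 0 0 = 0 \<longrightarrow>
       u \<in> H_mix (q + \<theta>) (k2 + 1 - r - \<bar>q\<bar> - \<theta>) \<and>
       H_mix_norm (q + \<theta>) (k2 + 1 - r - \<bar>q\<bar> - \<theta>)
           (dist_diff u (dist_of_fun (\<lambda>z. fourier_coeff u 0 0))) \<le> C * H_mix_norm k1 k2 f"
    if r: "ereal r > irrationality_measure a0" and q: "q \<le> k1" and \<theta>: "0 \<le> \<theta>" "\<theta> \<le> 1" for k1 q r \<theta> :: real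
  proof -
    obtain C where C: "C > 0" and est: "\<And>k2 fh uh. coeff_term k1 k2 fh summable_on UNIV \<Longrightarrow>
     (\<And>\<xi>. tempered (\<lambda>\<tau>. fh (\<tau>, \<xi>)) \<and> tempered (\<lambda>\<tau>. uh (\<tau>, \<xi>)) \<and>
        slice_eq ?b a0 \<xi> (\<lambda>\<tau>. uh (\<tau>, \<xi>)) (\<lambda>\<tau>. fh (\<tau>, \<xi>))) \<Longrightarrow> uh (0, 0) = 0 \<Longrightarrow>
     coeff_term (q + \<theta>) (k2 + 1 - r - \<bar>q\<bar> - \<theta>) uh summable_on UNIV \<and>
     infsum (coeff_term (q + \<theta>) (k2 + 1 - r - \<bar>q\<bar> - \<theta>) uh) UNIV \<le> C\<^sup>2 * infsum (coeff_term k1 k2 fh) UNIV"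
      using coefficient_estimate[OF g irr r q \<theta>] by blast
    show ?thesis
    proof (intro exI[of _ C] conjI allI impI C)
      fix k2 f u
      assume *: "f \<in> H_mix k1 k2 \<and> fourier_coeff f 0 0 = 0 \<and>
        u \<in> distributions \<and> L_op a u = f \<and> fourier_coeff u 0 0 = 0"
      then have fd: "f \<in> distributions" and fs: "coeff_term k1 k2 (fourier_coeffs f) summable_on UNIV"
        and ud: "u \<in> distributions" and u0: "fourier_coeff u 0 0 = 0"
        by (auto simp: H_mix_def mix_term_eq)
      let ?s1 = "q + \<theta>" and ?s2 = "k2 + 1 - r - \<bar>q\<bar> - \<theta>"
      have E: "coeff_term ?s1 ?s2 (fourier_coeffs u) summable_on UNIV"
        "infsum (coeff_term ?s1 ?s2 (fourier_coeffs u)) UNIV \<le> C\<^sup>2 * infsum (coeff_term k1 k2 (fourier_coeffs f)) UNIV"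
        using est[OF fs, of "fourier_coeffs u"] t[OF fd] t[OF ud] slices[OF ud fd] * u0 by (auto simp: zero)
      show "u \<in> H_mix ?s1 ?s2" using E(1) ud by (simp add: H_mix_def mix_term_eq)
      \<comment> \<open>The subtracted constant is 0 by the normalisation, so the difference is
        \<open>u\<close> itself.\<close>
      have "dist_diff u (dist_of_fun (\<lambda>z. fourier_coeff u 0 0)) = u"
      proof (rule extensionalityI)
        show "dist_diff u (dist_of_fun (\<lambda>z. fourier_coeff u 0 0)) \<in> extensional test_functions"
          by (simp add: dist_diff_def)
        show "u \<in> extensional test_functions" by (rule distributionsD(1)[OF ud])
      qed (simp add: dist_diff_def dist_of_fun_def u0)
      moreover have "H_mix_norm ?s1 ?s2 u \<le> C * H_mix_norm k1 k2 f"
      proof -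
        have "H_mix_norm ?s1 ?s2 u \<le> sqrt (C\<^sup>2 * infsum (coeff_term k1 k2 (fourier_coeffs f)) UNIV)"
          unfolding H_mix_norm_def mix_term_eq by (intro real_sqrt_le_mono E)
        also have "\<dots> = C * H_mix_norm k1 k2 f"
          unfolding H_mix_norm_def mix_term_eq using C by (simp add: real_sqrt_mult)
        finally show ?thesis .
      qed
      ultimately show "H_mix_norm ?s1 ?s2 (dist_diff u (dist_of_fun (\<lambda>z. fourier_coeff u 0 0))) \<le> C * H_mix_norm k1 k2 f"
        by simp
    qed
  qed
  show ?thesis using unique estimate by blast
qed

end
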